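(* Let $\{Y_i;i\ge 1\}$ be a sequence of independent and identically distributed random variables on a sub-linear expectation space $(\Omega,\mathscr H,\widehat{\mathbb E})$, and let $\{\beta_j\}_{j=-\infty}^{\infty}$ be real numbers with $\sum_{j=-\infty}^\infty|\beta_j|<\infty$; put $\beta=\sum_{j=-\infty}^\infty\beta_j$. Let $X_t=\sum_{j=-\infty}^{t-1}\beta_jY_{t-j}$ for $t\ge1$, $T_n=\sum_{t=1}^nX_t$ and $a_n=\sqrt{2n\log\log n}$. Suppose that $$\breve{\mathbb E}[Y_1]=\breve{\mathbb E}[-Y_1]=0,\qquad \overline{\sigma}_Y^2=\breve{\mathbb E}[Y_1^2]<\infty,\qquad C_{\widehat{\mathbb V}}\left[\frac{Y_1^2}{\log\log|Y_1|}\right]<\infty.$$ Then $$\widehat{\mathcal V}^{\ast}\left(\limsup_{n\to\infty}\frac{|T_n|}{a_n}\le|\beta|\,\overline{\sigma}_Y\right)=1.$$ Furthermore, suppose in addition that $\widehat{\mathbb E}$ is regular on $\mathscr H_b=\{\varphi\in\mathscr H:\varphi\text{ is bounded}\}$, in the sense that $\widehat{\mathbb E}[\varphi_n]\to0$ whenever $\varphi_n\in\mathscr H_b$ and $\varphi_n\searrow0$ (pointwise on $\Omega$). Then $$\widehat{\mathbb V}^{\ast}\left(C\Big\{\frac{T_n}{a_n}\Big\}=\big[-|\beta|\overline{\sigma}_Y,\ |\beta|\overline{\sigma}_Y\big]\right)=1,$$ where $C\{x_n\}$ denotes the cluster set (set of limit points of subsequences) of a real sequence $\{x_n\}$.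
   Context: Sub-linear expectation space: $(\Omega,\mathcal F)$ is a measurable space and $\mathscr H$ is a linear space of real-valued measurable functions on $(\Omega,\mathcal F)$ such that $X_1,\dots,X_n\in\mathscr H$ implies $\varphi(X_1,\dots,X_n)\in\mathscr H$ for every $\varphi\in C_{l,Lip}(\mathbb R^n)$, the space of functions satisfying $|\varphi(\mathbf x)-\varphi(\mathbf y)|\le C(1+|\mathbf x|^m+|\mathbf y|^m)|\mathbf x-\mathbf y|$ for all $\mathbf x,\mathbf y$, for some $C>0$, $m\in\mathbb N$ depending on $\varphi$. $C_{b,Lip}(\mathbb R^n)$ denotes the bounded Lipschitz functions. A sub-linear expectation is a map $\widehat{\mathbb E}:\mathscr H\to[-\infty,\infty]$ such that for all $X,Y\in\mathscr H$: $X\ge Y$ implies $\widehat{\mathbb E}[X]\ge\widehat{\mathbb E}[Y]$; $\widehat{\mathbb E}[X+Y]\le\widehat{\mathbb E}[X]+\widehat{\mathbb E}[Y]$ whenever the right side is not of the form $+\infty-\infty$ or $-\infty+\infty$; $\widehat{\mathbb E}[c]=c$ for constants $c$ and $\widehat{\mathbb E}[\lambda X]=\lambda\widehat{\mathbb E}[X]$ for $\lambda>0$. Identical distribution: $X\overset{d}=Y$ means $\widehat{\mathbb E}[\varphi(X)]=\widehat{\mathbb E}[\varphi(Y)]$ for all $\varphi\in C_{b,Lip}(\mathbb R)$; $\{Y_i\}$ is identically distributed if $Y_i\overset{d}=Y_1$ for all $i$. Independence: a random vector $\mathbf Y=(Y_1,\dots,Y_n)$, $Y_i\in\mathscr H$,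 is independent relative to $\mathbf X=(X_1,\dots,X_m)$, $X_i\in\mathscr H$, if $\widehat{\mathbb E}[\varphi(\mathbf X,\mathbf Y)]=\widehat{\mathbb E}\big[\widehat{\mathbb E}[\varphi(\mathbf x,\mathbf Y)]\big|_{\mathbf x=\mathbf X}\big]$ for each $\varphi\in C_{b,Lip}(\mathbb R^m\times\mathbb R^n)$. A sequence $\{Y_n;n\ge1\}$ in $\mathscr H$ is independent if $Y_{i+1}$ is independent relative to $(Y_1,\dots,Y_i)$ for each $i\ge1$. Capacities: for $A\in\mathcal F$, $\widehat{\mathbb V}(A)=\inf\{\widehat{\mathbb E}[\xi]: I_A\le\xi,\ \xi\in\mathscr H\}$; its countably sub-additive extension is $\widehat{\mathbb V}^{\ast}(A)=\inf\{\sum_{n=1}^\infty\widehat{\mathbb V}(A_n):A\subset\bigcup_{n=1}^\infty A_n,\ A_n\in\mathcal F\}$, and $\widehat{\mathcal V}^{\ast}(A)=1-\widehat{\mathbb V}^{\ast}(A^c)$. Choquet expectation: $C_{\widehat{\mathbb V}}[X]=\int_0^\infty\widehat{\mathbb V}(X\ge t)\,dt+\int_{-\infty}^0[\widehat{\mathbb V}(X\ge t)-1]\,dt$. Truncated expectation: $X^{(c)}=(-c)\vee(X\wedge c)$ and $\breve{\mathbb E}[X]=\lim_{c\to\infty}\widehat{\mathbb E}[X^{(c)}]$ if the limit exists; a statement about the value of $\breve{\mathbb E}[\cdot]$ includes that this limit exists. Conventions: $\log x=\ln\max(e,x)$ (so $\log\log x=\log(\log x)\ge1$). The series defining $X_t$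 converge absolutely outside a set of $\widehat{\mathbb V}^{\ast}$-capacity zero; on the exceptional set where a series does not converge absolutely the value of $X_t$ is immaterial and may be set to $0$. $X_t$ and $T_n$ need not belong to $\mathscr H$. *)

theory Defs
  imports "HOL-Analysis.Analysis"
begin

(* A vector of R^n is encoded by the first n coordinates of a function nat => real. The Lipschitz
   conditions below force a test function to depend on these coordinates only. *)

definition vnorm :: "nat \<Rightarrow> (nat \<Rightarrow> real) \<Rightarrow> real" where
  "vnorm n x = L2_set x {..<n}"

definition C_l_Lip :: "nat \<Rightarrow> ((nat \<Rightarrow> real) \<Rightarrow> real) set" where
  "C_l_Lip n = {\<phi>. \<exists>C>0. \<exists>m::nat. \<forall>x y.
     \<bar>\<phi> x - \<phi> y\<bar> \<le> C * (1 + vnorm n x ^ m + vnorm n y ^ m) * vnorm n (\<lambda>i. x i - y i)}"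

definition C_b_Lip :: "nat \<Rightarrow> ((nat \<Rightarrow> real) \<Rightarrow> real) set" where
  "C_b_Lip n = {\<phi>. bounded (range \<phi>) \<and>
     (\<exists>L. \<forall>x y. \<bar>\<phi> x - \<phi> y\<bar> \<le> L * vnorm n (\<lambda>i. x i - y i))}"

(* The measure of M plays no role: M only carries Omega = space M and the sigma-algebra sets M.
   Values of the elements of H outside space M are immaterial, by monotonicity of E. *)

locale sublinear_expectation_space =
  fixes M :: "'a measure"
    and H :: "('a \<Rightarrow> real) set"
    and E :: "('a \<Rightarrow> real) \<Rightarrow> ereal"
  assumes H_measurable: "X \<in> H \<Longrightarrow> X \<in> borel_measurable M"
    and H_zero: "(\<lambda>\<omega>. 0) \<in> H"
    and H_add: "X \<in> H \<Longrightarrow> Y \<in> H \<Longrightarrow> (\<lambda>\<omega>. X \<omega> + Y \<omega>) \<in> H"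
    and H_scale: "X \<in> H \<Longrightarrow> (\<lambda>\<omega>. c * X \<omega>) \<in> H"
    and H_comp: "(\<And>i. i < n \<Longrightarrow> Z i \<in> H) \<Longrightarrow> \<phi> \<in> C_l_Lip n \<Longrightarrow> (\<lambda>\<omega>. \<phi> (\<lambda>i. Z i \<omega>)) \<in> H"
    and E_mono: "X \<in> H \<Longrightarrow> Y \<in> H \<Longrightarrow> (\<And>\<omega>. \<omega> \<in> space M \<Longrightarrow> Y \<omega> \<le> X \<omega>) \<Longrightarrow> E Y \<le> E X"
    and E_subadd: "X \<in> H \<Longrightarrow> Y \<in> H \<Longrightarrow>
      \<not> (E X = \<infinity> \<and> E Y = -\<infinity>) \<Longrightarrow> \<not> (E X = -\<infinity> \<and> E Y = \<infinity>) \<Longrightarrow>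
      E (\<lambda>\<omega>. X \<omega> + Y \<omega>) \<le> E X + E Y"
    and E_const: "E (\<lambda>\<omega>. c) = ereal c"
    and E_scale: "X \<in> H \<Longrightarrow> 0 < c \<Longrightarrow> E (\<lambda>\<omega>. c * X \<omega>) = ereal c * E X"

definition same_distr :: "(('a \<Rightarrow> real) \<Rightarrow> ereal) \<Rightarrow> ('a \<Rightarrow> real) \<Rightarrow> ('a \<Rightarrow> real) \<Rightarrow> bool" where
  "same_distr E X Y \<longleftrightarrow>
     (\<forall>\<phi>::real \<Rightarrow> real. bounded (range \<phi>) \<and> (\<exists>L. L-lipschitz_on UNIV \<phi>) \<longrightarrow>
        E (\<lambda>\<omega>. \<phi> (X \<omega>)) = E (\<lambda>\<omega>. \<phi> (Y \<omega>)))"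

definition vconcat :: "nat \<Rightarrow> (nat \<Rightarrow> real) \<Rightarrow> (nat \<Rightarrow> real) \<Rightarrow> nat \<Rightarrow> real" where
  "vconcat m x y = (\<lambda>i. if i < m then x i else y (i - m))"

(* indep_rel E m X n Y: the vector (Y 0, ..., Y (n-1)) is independent relative to
   (X 0, ..., X (m-1)). The inner sub-linear expectation is finite because phi is bounded, so
   real_of_ereal loses nothing. *)

definition indep_rel ::
  "(('a \<Rightarrow> real) \<Rightarrow> ereal) \<Rightarrow> nat \<Rightarrow> (nat \<Rightarrow> 'a \<Rightarrow> real) \<Rightarrow> nat \<Rightarrow> (nat \<Rightarrow> 'a \<Rightarrow> real) \<Rightarrow> bool" where
  "indep_rel E m X n Y \<longleftrightarrow>
     (\<forall>\<phi> \<in> C_b_Lip (m + n).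
        E (\<lambda>\<omega>. \<phi> (vconcat m (\<lambda>i. X i \<omega>) (\<lambda>i. Y i \<omega>))) =
        E (\<lambda>\<omega>. real_of_ereal (E (\<lambda>\<omega>'. \<phi> (vconcat m (\<lambda>i. X i \<omega>) (\<lambda>i. Y i \<omega>'))))))"

(* Sequences Y_1, Y_2, ... are functions on nat whose value at 0 is never used. *)

definition indep_seq :: "(('a \<Rightarrow> real) \<Rightarrow> ereal) \<Rightarrow> (nat \<Rightarrow> 'a \<Rightarrow> real) \<Rightarrow> bool" where
  "indep_seq E Y \<longleftrightarrow> (\<forall>i\<ge>1. indep_rel E i (\<lambda>k. Y (Suc k)) 1 (\<lambda>k. Y (Suc i)))"

definition ident_distr_seq :: "(('a \<Rightarrow> real) \<Rightarrow> ereal) \<Rightarrow> (nat \<Rightarrow> 'a \<Rightarrow> real) \<Rightarrow> bool" where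
  "ident_distr_seq E Y \<longleftrightarrow> (\<forall>i\<ge>1. same_distr E (Y i) (Y 1))"

definition upper_cap ::
  "'a measure \<Rightarrow> ('a \<Rightarrow> real) set \<Rightarrow> (('a \<Rightarrow> real) \<Rightarrow> ereal) \<Rightarrow> 'a set \<Rightarrow> ereal" where
  "upper_cap M H E A = Inf {E \<xi> |\<xi>. \<xi> \<in> H \<and> (\<forall>\<omega>\<in>space M. indicator A \<omega> \<le> \<xi> \<omega>)}"

definition upper_cap_star ::
  "'a measure \<Rightarrow> ('a \<Rightarrow> real) set \<Rightarrow> (('a \<Rightarrow> real) \<Rightarrow> ereal) \<Rightarrow> 'a set \<Rightarrow> ereal" where
  "upper_cap_star M H E A =
     Inf {(\<Sum>n. upper_cap M H E (B n)) |B :: nat \<Rightarrow> 'a set.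
            range B \<subseteq> sets M \<and> A \<subseteq> (\<Union>n. B n)}"

definition lower_cap_star ::
  "'a measure \<Rightarrow> ('a \<Rightarrow> real) set \<Rightarrow> (('a \<Rightarrow> real) \<Rightarrow> ereal) \<Rightarrow> 'a set \<Rightarrow> ereal" where
  "lower_cap_star M H E A = 1 - upper_cap_star M H E (space M - A)"

(* Capacities take values in [0,1], so both integrands below are nonnegative. If both integrals
   are infinite, ereal subtraction yields infinity; for X >= 0 the second one vanishes. *)

definition choquet ::
  "'a measure \<Rightarrow> ('a \<Rightarrow> real) set \<Rightarrow> (('a \<Rightarrow> real) \<Rightarrow> ereal) \<Rightarrow> ('a \<Rightarrow> real) \<Rightarrow> ereal" where
  "choquet M H E X =
     enn2ereal (\<integral>\<^sup>+t\<in>{0..}. e2ennreal (upper_cap M H E {\<omega>\<in>space M. t \<le> X \<omega>}) \<partial>lborel)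
     - enn2ereal (\<integral>\<^sup>+t\<in>{..0}. e2ennreal (1 - upper_cap M H E {\<omega>\<in>space M. t \<le> X \<omega>}) \<partial>lborel)"

definition trunc :: "real \<Rightarrow> ('a \<Rightarrow> real) \<Rightarrow> 'a \<Rightarrow> real" where
  "trunc c X = (\<lambda>\<omega>. max (- c) (min (X \<omega>) c))"

definition has_trunc_expectation ::
  "(('a \<Rightarrow> real) \<Rightarrow> ereal) \<Rightarrow> ('a \<Rightarrow> real) \<Rightarrow> ereal \<Rightarrow> bool" where
  "has_trunc_expectation E X l \<longleftrightarrow> ((\<lambda>c. E (trunc c X)) \<longlongrightarrow> l) at_top"

definition regular_on_bounded ::
  "'a measure \<Rightarrow> ('a \<Rightarrow> real) set \<Rightarrow> (('a \<Rightarrow> real) \<Rightarrow> ereal) \<Rightarrow> bool" where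
  "regular_on_bounded M H E \<longleftrightarrow>
     (\<forall>\<phi> :: nat \<Rightarrow> 'a \<Rightarrow> real.
        (\<forall>n. \<phi> n \<in> H \<and> bounded (\<phi> n ` space M)) \<and>
        (\<forall>\<omega>\<in>space M. decseq (\<lambda>n. \<phi> n \<omega>) \<and> (\<lambda>n. \<phi> n \<omega>) \<longlonglongrightarrow> 0)
        \<longrightarrow> (\<lambda>n. E (\<phi> n)) \<longlonglongrightarrow> 0)"

definition llog :: "real \<Rightarrow> real" where
  "llog x = ln (max (exp 1) x)"

definition lil_norm :: "nat \<Rightarrow> real" where
  "lil_norm n = sqrt (2 * real n * llog (llog (real n)))"

(* Over the reals, summability of an infsum is absolute summability, and the value is 0 otherwise. *)

definition linear_process ::
  "(int \<Rightarrow> real) \<Rightarrow> (nat \<Rightarrow> 'a \<Rightarrow> real) \<Rightarrow> nat \<Rightarrow> 'a \<Rightarrow> real" where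
  "linear_process \<beta> Y t \<omega> = (\<Sum>\<^sub>\<infinity>j\<in>{..int t - 1}. \<beta> j * Y (nat (int t - j)) \<omega>)"

definition process_sum ::
  "(int \<Rightarrow> real) \<Rightarrow> (nat \<Rightarrow> 'a \<Rightarrow> real) \<Rightarrow> nat \<Rightarrow> 'a \<Rightarrow> real" where
  "process_sum \<beta> Y n \<omega> = (\<Sum>t=1..n. linear_process \<beta> Y t \<omega>)"

definition cluster_set :: "(nat \<Rightarrow> real) \<Rightarrow> real set" where
  "cluster_set x = {l. \<exists>r. strict_mono r \<and> (x \<circ> r) \<longlonglongrightarrow> l}"

end

theory Submission
  imports Defs
begin

text \<open>
  Interchanging the order of summation, \<open>process_sum\<close> is a mixture, with weights \<open>\<beta> j\<close>, of increments of
  the partial sums \<open>S\<close> of \<open>Y\<close>. These increments are dominated, outside a null set of the countably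
  sub-additive capacity, by a sequence that is summable against \<open>\<beta>\<close>, so dominated convergence reduces
  everything to \<open>S\<close>. The domination and the upper half of the law follow from a Fuk--Nagaev inequality
  whose third-moment term is summed with the Choquet condition. For the lower half, an exponential tilt
  bounds from below the upper expectation of the event that a block sum hits a prescribed window;
  independence of the blocks makes the product of all hitting events as likely as desired, and
  regularity transfers this from finite products to the capacity of the limit event.
\<close>

subsection \<open>Bounded Lipschitz functions\<close>

text \<open>The obstacle is that \<open>E\<close> carries no measure: it is only sub-additive,
  \<open>cap\<close> is only finitely sub-additive, and independence is directional and tests
  bounded Lipschitz functions alone. So indicators become ramps, a change of measure becomes a
  pointwise inequality, and coordinates are integrated out from the last to the first. Equalities
  survive for expressions that are affine in the last block with a nonnegative coefficient; this is
  why hits are recorded as \<open>1 - miss\<close>, whose upper expectation can be computed exactly.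
  The Choquet condition controls Y^2 / LL|Y| and not Y^2, which fixes the truncation level at a
  constant multiple of \<open>lil_norm n\<close>. At this level \<open>cube_tail\<close> plays three
  roles: it is the error of the exponential moments, it bounds the capacity of exceeding the level,
  and it is summable, weighted by n, along geometric sequences. In the lower half the blocks end at
  factorials: they grow fast enough to make the past negligible and slowly enough for the sum of
  exp(-\<theta> LL n) to diverge when \<theta> < 1.\<close>

definition bdd_lip :: "('b \<Rightarrow> 'b \<Rightarrow> real) \<Rightarrow> ('b \<Rightarrow> real) \<Rightarrow> bool" where
  "bdd_lip d \<phi> \<longleftrightarrow> bounded (range \<phi>) \<and> (\<exists>L. \<forall>x y. \<bar>\<phi> x - \<phi> y\<bar> \<le> L * d x y)"

lemma bdd_lipI: "(\<And>x. \<bar>\<phi> x\<bar> \<le> B) \<Longrightarrow> (\<And>x y. \<bar>\<phi> x - \<phi> y\<bar> \<le> L * d x y) \<Longrightarrow> bdd_lip d \<phi>"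
  unfolding bdd_lip_def bounded_iff by auto

lemma bdd_lip_bound:
  assumes "bdd_lip d \<phi>" obtains B where "0 \<le> B" "\<And>x. \<bar>\<phi> x\<bar> \<le> B"
proof -
  obtain B where "\<And>x. \<bar>\<phi> x\<bar> \<le> B" using assms unfolding bdd_lip_def bounded_iff by auto
  then have "\<And>x. \<bar>\<phi> x\<bar> \<le> \<bar>B\<bar>" by (meson abs_ge_self order_trans)
  then show ?thesis using that[of "\<bar>B\<bar>"] by auto
qed

lemma bdd_lip_lip:
  assumes "bdd_lip d \<phi>" obtains L where "\<And>x y. \<bar>\<phi> x - \<phi> y\<bar> \<le> L * d x y"
  using assms unfolding bdd_lip_def by auto

named_theorems bdd_lip_intros

lemma bdd_lip_const [bdd_lip_intros]: "bdd_lip d (\<lambda>_. c)"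
  by (rule bdd_lipI[where B = "\<bar>c\<bar>" and L = 0]) auto

lemma bdd_lip_add [bdd_lip_intros]:
  assumes "bdd_lip d \<phi>" "bdd_lip d \<psi>" shows "bdd_lip d (\<lambda>x. \<phi> x + \<psi> x)"
proof -
  obtain B1 B2 L1 L2 where *: "\<And>x. \<bar>\<phi> x\<bar> \<le> B1" "\<And>x. \<bar>\<psi> x\<bar> \<le> B2"
    "\<And>x y. \<bar>\<phi> x - \<phi> y\<bar> \<le> L1 * d x y" "\<And>x y. \<bar>\<psi> x - \<psi> y\<bar> \<le> L2 * d x y"
    using assms by (metis bdd_lip_bound bdd_lip_lip)
  show ?thesis
  proof (rule bdd_lipI[where B = "B1 + B2" and L = "L1 + L2"])
    fix x y
    show "\<bar>\<phi> x + \<psi> x\<bar> \<le> B1 + B2" using *(1)[of x] *(2)[of x] by linarith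
    show "\<bar>\<phi> x + \<psi> x - (\<phi> y + \<psi> y)\<bar> \<le> (L1 + L2) * d x y"
      using *(3)[of x y] *(4)[of x y] by (simp add: algebra_simps)
  qed
qed

lemma bdd_lip_mult [bdd_lip_intros]:
  assumes "bdd_lip d \<phi>" "bdd_lip d \<psi>" shows "bdd_lip d (\<lambda>x. \<phi> x * \<psi> x)"
proof -
  obtain B1 where B1: "0 \<le> B1" "\<And>x. \<bar>\<phi> x\<bar> \<le> B1" using assms(1) by (rule bdd_lip_bound) blast
  obtain B2 where B2: "0 \<le> B2" "\<And>x. \<bar>\<psi> x\<bar> \<le> B2" using assms(2) by (rule bdd_lip_bound) blast
  obtain L1 where L1: "\<And>x y. \<bar>\<phi> x - \<phi> y\<bar> \<le> L1 * d x y" using assms(1) by (rule bdd_lip_lip) blast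
  obtain L2 where L2: "\<And>x y. \<bar>\<psi> x - \<psi> y\<bar> \<le> L2 * d x y" using assms(2) by (rule bdd_lip_lip) blast
  show ?thesis
  proof (rule bdd_lipI[where B = "B1 * B2" and L = "B1 * L2 + B2 * L1"])
    fix x y
    show "\<bar>\<phi> x * \<psi> x\<bar> \<le> B1 * B2" unfolding abs_mult using B1 B2 by (intro mult_mono) auto
    have "\<phi> x * \<psi> x - \<phi> y * \<psi> y = \<phi> x * (\<psi> x - \<psi> y) + \<psi> y * (\<phi> x - \<phi> y)"
      by (simp add: algebra_simps)
    also have "\<bar>\<dots>\<bar> \<le> \<bar>\<phi> x\<bar> * \<bar>\<psi> x - \<psi> y\<bar> + \<bar>\<psi> y\<bar> * \<bar>\<phi> x - \<phi> y\<bar>"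
      by (metis abs_mult abs_triangle_ineq)
    also have "\<dots> \<le> B1 * \<bar>\<psi> x - \<psi> y\<bar> + B2 * \<bar>\<phi> x - \<phi> y\<bar>"
      using B1 B2 by (intro add_mono mult_right_mono) auto
    also have "\<dots> \<le> B1 * (L2 * d x y) + B2 * (L1 * d x y)"
      using B1 B2 L1 L2 by (intro add_mono mult_left_mono) auto
    finally show "\<bar>\<phi> x * \<psi> x - \<phi> y * \<psi> y\<bar> \<le> (B1 * L2 + B2 * L1) * d x y"
      by (simp add: algebra_simps)
  qed
qed

text \<open>A bounded function takes values in a compact interval, so it suffices that
  \<open>h\<close> is Lipschitz on each such interval. This admits \<open>exp\<close>, which is not
  globally Lipschitz.\<close>

lemma bdd_lip_comp:
  assumes "bdd_lip d \<phi>" and h: "\<And>B. \<exists>K. \<forall>s\<in>{-B..B}. \<forall>t\<in>{-B..B}. \<bar>h s - h t\<bar> \<le> K * \<bar>s - t\<bar>"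
  shows "bdd_lip d (\<lambda>x. h (\<phi> x) :: real)"
proof -
  obtain B where B: "0 \<le> B" "\<And>x. \<bar>\<phi> x\<bar> \<le> B" using assms(1) by (rule bdd_lip_bound) blast
  obtain L where L: "\<And>x y. \<bar>\<phi> x - \<phi> y\<bar> \<le> L * d x y" using assms(1) by (rule bdd_lip_lip) blast
  obtain K where K: "\<forall>s\<in>{-B..B}. \<forall>t\<in>{-B..B}. \<bar>h s - h t\<bar> \<le> K * \<bar>s - t\<bar>" using h by blast
  have in_B: "\<phi> x \<in> {-B..B}" for x using B(2)[of x] by auto
  have K': "\<bar>h (\<phi> x) - h s\<bar> \<le> \<bar>K\<bar> * \<bar>\<phi> x - s\<bar>" if "s \<in> {-B..B}" for x s
    using K in_B that by (smt (verit) mult_right_mono)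
  show ?thesis
  proof (rule bdd_lipI[where B = "\<bar>h 0\<bar> + \<bar>K\<bar> * B" and L = "\<bar>K\<bar> * L"])
    fix x y
    have "\<bar>h (\<phi> x) - h 0\<bar> \<le> \<bar>K\<bar> * \<bar>\<phi> x\<bar>" using K'[of 0 x] B(1) by simp
    also have "\<dots> \<le> \<bar>K\<bar> * B" using B(2)[of x] by (intro mult_left_mono) auto
    finally show "\<bar>h (\<phi> x)\<bar> \<le> \<bar>h 0\<bar> + \<bar>K\<bar> * B" by linarith
    have "\<bar>h (\<phi> x) - h (\<phi> y)\<bar> \<le> \<bar>K\<bar> * \<bar>\<phi> x - \<phi> y\<bar>" using K' in_B by blast
    also have "\<dots> \<le> \<bar>K\<bar> * (L * d x y)" using L by (intro mult_left_mono) auto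
    finally show "\<bar>h (\<phi> x) - h (\<phi> y)\<bar> \<le> \<bar>K\<bar> * L * d x y" by (simp add: mult.assoc)
  qed
qed

lemma bdd_lip_uminus [bdd_lip_intros]: "bdd_lip d \<phi> \<Longrightarrow> bdd_lip d (\<lambda>x. - \<phi> x)"
  using bdd_lip_mult[OF bdd_lip_const[of d "-1"]] by fastforce

lemma bdd_lip_diff [bdd_lip_intros]: "bdd_lip d \<phi> \<Longrightarrow> bdd_lip d \<psi> \<Longrightarrow> bdd_lip d (\<lambda>x. \<phi> x - \<psi> x)"
  using bdd_lip_add[OF _ bdd_lip_uminus] by fastforce

lemma bdd_lip_divide [bdd_lip_intros]: "bdd_lip d \<phi> \<Longrightarrow> bdd_lip d (\<lambda>x. \<phi> x / c)"
  using bdd_lip_mult[OF _ bdd_lip_const[of d "inverse c"]] by (fastforce simp: divide_inverse)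

lemma bdd_lip_abs [bdd_lip_intros]: "bdd_lip d \<phi> \<Longrightarrow> bdd_lip d (\<lambda>x. \<bar>\<phi> x\<bar>)"
  by (erule bdd_lip_comp) (auto intro!: exI[of _ 1])

lemma bdd_lip_max [bdd_lip_intros]:
  assumes "bdd_lip d \<phi>" "bdd_lip d \<psi>" shows "bdd_lip d (\<lambda>x. max (\<phi> x) (\<psi> x))"
proof -
  have "(\<lambda>x. max (\<phi> x) (\<psi> x)) = (\<lambda>x. (\<phi> x + \<psi> x + \<bar>\<phi> x - \<psi> x\<bar>) / 2)" by (auto simp: max_def field_simps)
  then show ?thesis using assms by (auto intro!: bdd_lip_intros)
qed

lemma bdd_lip_min [bdd_lip_intros]:
  assumes "bdd_lip d \<phi>" "bdd_lip d \<psi>" shows "bdd_lip d (\<lambda>x. min (\<phi> x) (\<psi> x))"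
proof -
  have "(\<lambda>x. min (\<phi> x) (\<psi> x)) = (\<lambda>x. (\<phi> x + \<psi> x - \<bar>\<phi> x - \<psi> x\<bar>) / 2)" by (auto simp: min_def field_simps)
  then show ?thesis using assms by (auto intro!: bdd_lip_intros)
qed

lemma bdd_lip_power [bdd_lip_intros]: "bdd_lip d \<phi> \<Longrightarrow> bdd_lip d (\<lambda>x. \<phi> x ^ n)"
  by (induction n) (auto intro!: bdd_lip_intros)

lemma bdd_lip_sum [bdd_lip_intros]: "(\<And>i. i \<in> I \<Longrightarrow> bdd_lip d (\<phi> i)) \<Longrightarrow> bdd_lip d (\<lambda>x. \<Sum>i\<in>I. \<phi> i x)"
  by (induction I rule: infinite_finite_induct) (auto intro!: bdd_lip_intros)

lemma bdd_lip_prod [bdd_lip_intros]: "(\<And>i. i \<in> I \<Longrightarrow> bdd_lip d (\<phi> i)) \<Longrightarrow> bdd_lip d (\<lambda>x. \<Prod>i\<in>I. \<phi> i x)"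
  by (induction I rule: infinite_finite_induct) (auto intro!: bdd_lip_intros)

lemma exp_lipschitz: "\<bar>exp s - exp t\<bar> \<le> exp B * \<bar>s - t\<bar>" if "s \<le> B" "t \<le> B" for s t B :: real
proof -
  have *: "exp v - exp u \<le> exp B * (v - u)" if "u \<le> v" "v \<le> B" for u v :: real
  proof -
    have "exp v * (1 - (v - u)) \<le> exp v * exp (u - v)"
      using exp_ge_add_one_self[of "u - v"] by (intro mult_left_mono) (simp_all add: algebra_simps)
    then have "exp v - exp u \<le> exp v * (v - u)" by (simp add: algebra_simps flip: exp_add)
    also have "\<dots> \<le> exp B * (v - u)" using that by (intro mult_right_mono) auto
    finally show ?thesis .
  qed
  show ?thesis using *[of s t] *[of t s] that by (cases s t rule: le_cases) (auto simp: abs_if)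
qed

lemma bdd_lip_exp [bdd_lip_intros]: "bdd_lip d \<phi> \<Longrightarrow> bdd_lip d (\<lambda>x. exp (\<phi> x))"
  by (erule bdd_lip_comp, rule_tac x = "exp B" in exI) (auto intro: exp_lipschitz)

text \<open>\<open>rdist\<close> and \<open>vdist\<close> are the two distances for which
  \<open>bdd_lip\<close> is used, so that one set of closure rules serves both. On sequences
  \<open>vdist n\<close> is only a pseudometric; its null pairs are those that agree in the first
  \<open>n\<close> coordinates, which is how a test function is kept from depending on later
  ones.\<close>

definition rdist :: "real \<Rightarrow> real \<Rightarrow> real" where "rdist s t = \<bar>s - t\<bar>"

definition vdist :: "nat \<Rightarrow> (nat \<Rightarrow> real) \<Rightarrow> (nat \<Rightarrow> real) \<Rightarrow> real" where
  "vdist n x y = vnorm n (\<lambda>i. x i - y i)"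

lemma vdist_nonneg: "0 \<le> vdist n x y"
  unfolding vdist_def vnorm_def by (simp add: L2_set_nonneg)

lemma C_b_Lip_iff: "\<phi> \<in> C_b_Lip n \<longleftrightarrow> bdd_lip (vdist n) \<phi>"
  unfolding C_b_Lip_def bdd_lip_def vdist_def by simp

lemma rdist_le_vdist: "i < n \<Longrightarrow> rdist (x i) (y i) \<le> vdist n x y"
  unfolding rdist_def vdist_def vnorm_def
  using member_le_L2_set[of "{..<n}" i "\<lambda>i. \<bar>x i - y i\<bar>"] by (simp add: L2_set_def)

lemma vdist_mono: "n \<le> m \<Longrightarrow> vdist n x y \<le> vdist m x y"
  unfolding vdist_def vnorm_def L2_set_def
  by (intro real_sqrt_le_mono sum_mono2) auto

lemma bdd_lip_mono_dist:
  assumes "bdd_lip d \<phi>" "\<And>x y. 0 \<le> d x y" "\<And>x y. d x y \<le> d' x y" shows "bdd_lip d' \<phi>"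
proof -
  obtain B where B: "0 \<le> B" "\<And>x. \<bar>\<phi> x\<bar> \<le> B" using assms(1) by (rule bdd_lip_bound) blast
  obtain L where L: "\<And>x y. \<bar>\<phi> x - \<phi> y\<bar> \<le> L * d x y" using assms(1) by (rule bdd_lip_lip) blast
  have "\<bar>\<phi> x - \<phi> y\<bar> \<le> \<bar>L\<bar> * d' x y" for x y
  proof -
    have "L * d x y \<le> \<bar>L\<bar> * d x y" using assms(2) by (intro mult_right_mono) auto
    also have "\<dots> \<le> \<bar>L\<bar> * d' x y" using assms(3) by (intro mult_left_mono) auto
    finally show ?thesis using L order_trans by blast
  qed
  then show ?thesis using B by (intro bdd_lipI) auto
qed

lemma bdd_lip_vdist_mono: "bdd_lip (vdist n) \<phi> \<Longrightarrow> n \<le> m \<Longrightarrow> bdd_lip (vdist m) \<phi>"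
  by (erule bdd_lip_mono_dist) (auto simp: vdist_nonneg vdist_mono)

lemma bdd_lip_coord [bdd_lip_intros]:
  assumes "bdd_lip rdist g" "i < n" shows "bdd_lip (vdist n) (\<lambda>x. g (x i))"
proof -
  obtain B where B: "0 \<le> B" "\<And>x. \<bar>g x\<bar> \<le> B" using assms(1) by (rule bdd_lip_bound) blast
  obtain L where L: "\<And>x y. \<bar>g x - g y\<bar> \<le> L * rdist x y" using assms(1) by (rule bdd_lip_lip) blast
  have "\<bar>g (x i) - g (y i)\<bar> \<le> \<bar>L\<bar> * vdist n x y" for x y :: "nat \<Rightarrow> real"
  proof -
    have "L * rdist (x i) (y i) \<le> \<bar>L\<bar> * rdist (x i) (y i)"
      by (intro mult_right_mono) (auto simp: rdist_def)
    also have "\<dots> \<le> \<bar>L\<bar> * vdist n x y" using rdist_le_vdist[OF assms(2)] by (intro mult_left_mono) auto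
    finally show ?thesis using L order_trans by blast
  qed
  then show ?thesis using B by (intro bdd_lipI) auto
qed

lemma bdd_lip_rdist_iff: "bdd_lip rdist g \<longleftrightarrow> bounded (range g) \<and> (\<exists>L. L-lipschitz_on UNIV g)"
proof -
  have "(\<exists>L. \<forall>x y. \<bar>g x - g y\<bar> \<le> L * rdist x y) \<longleftrightarrow> (\<exists>L. L-lipschitz_on UNIV g)"
  proof
    assume "\<exists>L. \<forall>x y. \<bar>g x - g y\<bar> \<le> L * rdist x y"
    then obtain L where L: "\<And>x y. \<bar>g x - g y\<bar> \<le> L * rdist x y" by blast
    have "\<bar>g x - g y\<bar> \<le> \<bar>L\<bar> * \<bar>x - y\<bar>" for x y
      using L[of x y] mult_right_mono[of L "\<bar>L\<bar>" "\<bar>x - y\<bar>"] unfolding rdist_def by linarith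
    then have "\<bar>L\<bar>-lipschitz_on UNIV g" by (auto simp: lipschitz_on_def dist_real_def)
    then show "\<exists>L. L-lipschitz_on UNIV g" by blast
  qed (auto simp: lipschitz_on_def dist_real_def rdist_def)
  then show ?thesis unfolding bdd_lip_def by simp
qed

text \<open>The truncation X^(c) as a function on the line. It is bounded and Lipschitz, so
  identical distribution and independence apply to it directly.\<close>

definition clip :: "real \<Rightarrow> real \<Rightarrow> real" where "clip y t = max (- y) (min t y)"

lemma bdd_lip_clip [bdd_lip_intros]: "bdd_lip rdist (clip y)"
  by (rule bdd_lipI[where B = "\<bar>y\<bar>" and L = 1]) (auto simp: clip_def rdist_def)

lemma abs_clip_le: "0 \<le> y \<Longrightarrow> \<bar>clip y t\<bar> \<le> y"
  by (auto simp: clip_def)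

lemma abs_clip: "0 \<le> y \<Longrightarrow> \<bar>clip y t\<bar> = min \<bar>t\<bar> y"
  by (auto simp: clip_def)

lemma clip_eq: "\<bar>t\<bar> \<le> y \<Longrightarrow> clip y t = t"
  by (auto simp: clip_def)

lemma clip_minus: "0 \<le> y \<Longrightarrow> clip y (- t) = - clip y t"
  by (auto simp: clip_def)

lemma bdd_lip_fun_upd:
  assumes "bdd_lip (vdist (Suc n)) \<phi>" shows "bdd_lip rdist (\<lambda>t. \<phi> (x(n := t)))"
proof -
  obtain B where B: "0 \<le> B" "\<And>x. \<bar>\<phi> x\<bar> \<le> B" using assms(1) by (rule bdd_lip_bound) blast
  obtain L where L: "\<And>x y. \<bar>\<phi> x - \<phi> y\<bar> \<le> L * vdist (Suc n) x y" using assms(1) by (rule bdd_lip_lip) blast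
  have d: "vdist (Suc n) (x(n := s)) (x(n := t)) = rdist s t" for s t
  proof -
    have "(\<Sum>i<n. (if i = n then s - t else 0)\<^sup>2) = 0" by (intro sum.neutral) auto
    moreover have "(\<Sum>i<n. ((x(n := s)) i - (x(n := t)) i)\<^sup>2) = 0" by (intro sum.neutral) auto
    ultimately show ?thesis by (simp add: vdist_def vnorm_def L2_set_def rdist_def)
  qed
  show ?thesis using B(2) L[of "x(n := _)" "x(n := _)"] unfolding d by (intro bdd_lipI) auto
qed

lemma bdd_lip_cong:
  assumes "bdd_lip (vdist n) \<phi>" "\<And>i. i < n \<Longrightarrow> x i = y i" shows "\<phi> x = \<phi> y"
proof -
  have "vdist n x y = 0" using assms(2) by (simp add: vdist_def vnorm_def L2_set_def)
  moreover obtain L where "\<And>x y. \<bar>\<phi> x - \<phi> y\<bar> \<le> L * vdist n x y" using assms(1) by (rule bdd_lip_lip) blast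
  ultimately show ?thesis by (metis abs_le_zero_iff eq_iff_diff_eq_0 mult_zero_right)
qed

subsection \<open>Upper expectation and capacities\<close>

lemma bdd_lip_imp_C_l_Lip: assumes "bdd_lip (vdist n) \<phi>" shows "\<phi> \<in> C_l_Lip n"
proof -
  obtain L where L: "\<And>x y. \<bar>\<phi> x - \<phi> y\<bar> \<le> L * vdist n x y" using assms by (rule bdd_lip_lip) blast
  have "\<bar>\<phi> x - \<phi> y\<bar> \<le> (\<bar>L\<bar> + 1) * (1 + vnorm n x ^ 0 + vnorm n y ^ 0) * vnorm n (\<lambda>i. x i - y i)" for x y
  proof -
    have "L * vdist n x y \<le> (\<bar>L\<bar> + 1) * 3 * vdist n x y"
      by (intro mult_right_mono) (auto simp: vdist_nonneg)
    then show ?thesis using L[of x y] by (simp add: vdist_def)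
  qed
  moreover have "\<bar>L\<bar> + 1 > 0" by simp
  ultimately show ?thesis unfolding C_l_Lip_def by blast
qed

lemma Lip_coord0_C_l_Lip:
  assumes "\<And>s t. \<bar>h s - h t\<bar> \<le> \<bar>s - t\<bar>" shows "(\<lambda>x. h (x 0)) \<in> C_l_Lip 1"
proof -
  have "\<bar>h (x 0) - h (y 0)\<bar> \<le> 1 * (1 + vnorm 1 x ^ 0 + vnorm 1 y ^ 0) * vnorm 1 (\<lambda>i. x i - y i)" for x y
  proof -
    define z where "z = \<bar>x 0 - y 0\<bar>"
    have "0 \<le> z" "\<bar>h (x 0) - h (y 0)\<bar> \<le> z" using assms by (simp_all add: z_def)
    then show ?thesis by (simp add: vnorm_def L2_set_def flip: z_def)
  qed
  then show ?thesis unfolding C_l_Lip_def using zero_less_one by blast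
qed

lemma prod_decode_subset:
  obtains a b where "prod_decode ` {..<n} \<subseteq> {..<a} \<times> {..<b}"
proof -
  define a where "a = Suc (Max (insert 0 (fst ` prod_decode ` {..<n})))"
  define b where "b = Suc (Max (insert 0 (snd ` prod_decode ` {..<n})))"
  have "prod_decode ` {..<n} \<subseteq> {..<a} \<times> {..<b}"
  proof
    fix p assume "p \<in> prod_decode ` {..<n}"
    then have "fst p \<le> Max (insert 0 (fst ` prod_decode ` {..<n}))"
      "snd p \<le> Max (insert 0 (snd ` prod_decode ` {..<n}))" by (intro Max_ge; auto)+
    then show "p \<in> {..<a} \<times> {..<b}" by (cases p) (auto simp: a_def b_def)
  qed
  then show ?thesis by (rule that)
qed

lemma sum_half_powers_le: "(\<Sum>n<m. (1/2) ^ Suc n) \<le> (1::real)"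
  using sum_le_suminf[of "\<lambda>n. (1/2::real) ^ Suc n" "{..<m}"] power_half_series[THEN sums_unique]
    power_half_series[THEN sums_summable] by simp

text \<open>Every initial segment of the enumeration lies in a finite rectangle, and the sum over a
  rectangle is below the iterated series.\<close>

lemma suminf_prod_decode_le:
  fixes f :: "nat \<times> nat \<Rightarrow> ereal"
  assumes nn: "\<And>p. 0 \<le> f p"
  shows "(\<Sum>m. f (prod_decode m)) \<le> (\<Sum>a. \<Sum>b. f (a, b))"
proof (rule suminf_bound, intro allI)
  fix n
  obtain a b where sub: "prod_decode ` {..<n} \<subseteq> {..<a} \<times> {..<b}" by (rule prod_decode_subset)
  have "(\<Sum>m<n. f (prod_decode m)) = sum f (prod_decode ` {..<n})"
    by (simp add: sum.reindex[OF inj_prod_decode] comp_def)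
  also have "\<dots> \<le> sum f ({..<a} \<times> {..<b})" using sub nn by (intro sum_mono2) auto
  also have "\<dots> = (\<Sum>i<a. \<Sum>j<b. f (i, j))" by (simp add: sum.cartesian_product)
  also have "\<dots> \<le> (\<Sum>i<a. \<Sum>j. f (i, j))" using nn by (intro sum_mono suminf_upper)
  also have "\<dots> \<le> (\<Sum>i. \<Sum>j. f (i, j))" using nn by (intro suminf_upper suminf_0_le)
  finally show "(\<Sum>m<n. f (prod_decode m)) \<le> (\<Sum>a. \<Sum>b. f (a, b))" .
qed (use nn in auto)

section \<open>The sub-linear expectation on bounded elements\<close>

context sublinear_expectation_space
begin

definition Hb :: "('a \<Rightarrow> real) set" where "Hb = {X \<in> H. \<exists>B. \<forall>\<omega>\<in>space M. \<bar>X \<omega>\<bar> \<le> B}"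

text \<open>On \<open>Hb\<close> the value of \<open>E\<close> is finite (\<open>E_finite\<close>),
  so real arithmetic loses nothing there. The same holds for \<open>cap\<close>, which lies in [0,1]
  for every set.\<close>

definition expec :: "('a \<Rightarrow> real) \<Rightarrow> real" where "expec X = real_of_ereal (E X)"

definition cap :: "'a set \<Rightarrow> real" where "cap A = real_of_ereal (upper_cap M H E A)"

abbreviation cap_star :: "'a set \<Rightarrow> ereal" where "cap_star \<equiv> upper_cap_star M H E"

lemma H_const: "(\<lambda>\<omega>. c) \<in> H"
  using H_comp[of 0 "\<lambda>_ _. 0", OF _ bdd_lip_imp_C_l_Lip[OF bdd_lip_const[of "vdist 0" c]]] by simp

lemma Hb_H: "X \<in> Hb \<Longrightarrow> X \<in> H" by (simp add: Hb_def)

lemma HbI: "X \<in> H \<Longrightarrow> (\<And>\<omega>. \<omega> \<in> space M \<Longrightarrow> \<bar>X \<omega>\<bar> \<le> B) \<Longrightarrow> X \<in> Hb" by (auto simp: Hb_def)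

lemma H_Lip: "X \<in> H \<Longrightarrow> (\<And>s t. \<bar>h s - h t\<bar> \<le> \<bar>s - t\<bar>) \<Longrightarrow> (\<lambda>\<omega>. h (X \<omega>)) \<in> H"
  using H_comp[of 1 "\<lambda>_. X" "\<lambda>x. h (x 0)"] Lip_coord0_C_l_Lip[of h] by simp

lemma Hb_const: "(\<lambda>\<omega>. c) \<in> Hb" by (rule HbI[OF H_const]) auto

lemma Hb_add: assumes "X \<in> Hb" "Z \<in> Hb" shows "(\<lambda>\<omega>. X \<omega> + Z \<omega>) \<in> Hb"
proof -
  obtain B C where *: "\<forall>\<omega>\<in>space M. \<bar>X \<omega>\<bar> \<le> B" "\<forall>\<omega>\<in>space M. \<bar>Z \<omega>\<bar> \<le> C"
    using assms unfolding Hb_def by auto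
  show ?thesis
  proof (rule HbI[of _ "B + C"])
    show "(\<lambda>\<omega>. X \<omega> + Z \<omega>) \<in> H" using assms by (intro H_add Hb_H)
    show "\<bar>X \<omega> + Z \<omega>\<bar> \<le> B + C" if "\<omega> \<in> space M" for \<omega> using * that by (smt (verit))
  qed
qed

lemma Hb_scale: assumes "X \<in> Hb" shows "(\<lambda>\<omega>. c * X \<omega>) \<in> Hb"
proof -
  obtain B where *: "\<forall>\<omega>\<in>space M. \<bar>X \<omega>\<bar> \<le> B" using assms unfolding Hb_def by auto
  show ?thesis
  proof (rule HbI[of _ "\<bar>c\<bar> * B"])
    show "(\<lambda>\<omega>. c * X \<omega>) \<in> H" using assms by (intro H_scale Hb_H)
    show "\<bar>c * X \<omega>\<bar> \<le> \<bar>c\<bar> * B" if "\<omega> \<in> space M" for \<omega>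
      using * that by (auto simp: abs_mult intro!: mult_left_mono)
  qed
qed

lemma Hb_sum: "(\<And>i. i \<in> I \<Longrightarrow> X i \<in> Hb) \<Longrightarrow> (\<lambda>\<omega>. \<Sum>i\<in>I. X i \<omega>) \<in> Hb"
  by (induction I rule: infinite_finite_induct) (auto intro!: Hb_const Hb_add)

lemma E_finite: assumes "X \<in> Hb" shows "E X = ereal (expec X)"
proof -
  obtain B where B: "\<forall>\<omega>\<in>space M. \<bar>X \<omega>\<bar> \<le> B" using assms unfolding Hb_def by auto
  have "E X \<le> ereal B"
    unfolding E_const[symmetric] using B by (intro E_mono H_const Hb_H assms) (auto simp: abs_le_iff)
  moreover have "ereal (- B) \<le> E X"
    unfolding E_const[symmetric] using B by (intro E_mono H_const Hb_H assms) (auto simp: abs_le_iff minus_le_iff)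
  ultimately show ?thesis unfolding expec_def by (cases "E X") auto
qed

lemma expec_mono: "X \<in> Hb \<Longrightarrow> Z \<in> Hb \<Longrightarrow> (\<And>\<omega>. \<omega> \<in> space M \<Longrightarrow> X \<omega> \<le> Z \<omega>) \<Longrightarrow> expec X \<le> expec Z"
  using E_mono[of Z X] E_finite[of X] E_finite[of Z] Hb_H by (metis ereal_less_eq(3))

lemma expec_const [simp]: "expec (\<lambda>\<omega>. c) = c" by (simp add: expec_def E_const)

lemma expec_add_le: "X \<in> Hb \<Longrightarrow> Z \<in> Hb \<Longrightarrow> expec (\<lambda>\<omega>. X \<omega> + Z \<omega>) \<le> expec X + expec Z"
  using E_subadd[of X Z] E_finite[of X] E_finite[of Z] E_finite[OF Hb_add[of X Z]] Hb_H by simp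

lemma expec_scale: "X \<in> Hb \<Longrightarrow> 0 \<le> c \<Longrightarrow> expec (\<lambda>\<omega>. c * X \<omega>) = c * expec X"
proof (cases "c = 0")
  case False
  assume "X \<in> Hb" "0 \<le> c"
  then show ?thesis using E_scale[of X c] E_finite[of X] E_finite[OF Hb_scale[of X c]] Hb_H False by simp
qed auto

text \<open>Sub-additivity is applied twice, once with \<open>c\<close> and once with
  \<open>- c\<close>: constants are the summands that \<open>E\<close> treats linearly.\<close>

lemma expec_add_const: assumes "X \<in> Hb" shows "expec (\<lambda>\<omega>. X \<omega> + c) = expec X + c"
proof (rule antisym)
  show "expec (\<lambda>\<omega>. X \<omega> + c) \<le> expec X + c" using expec_add_le[OF assms Hb_const[of c]] by simp
  show "expec X + c \<le> expec (\<lambda>\<omega>. X \<omega> + c)"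
    using expec_add_le[OF Hb_add[OF assms Hb_const[of c]] Hb_const[of "-c"]] by simp
qed

lemma expec_sum_le: "(\<And>i. i \<in> I \<Longrightarrow> X i \<in> Hb) \<Longrightarrow> expec (\<lambda>\<omega>. \<Sum>i\<in>I. X i \<omega>) \<le> (\<Sum>i\<in>I. expec (X i))"
proof (induction I rule: infinite_finite_induct)
  case (insert i I)
  then show ?case using expec_add_le[of "X i" "\<lambda>\<omega>. \<Sum>i\<in>I. X i \<omega>"] Hb_sum[of I X] by fastforce
qed auto

section \<open>The capacity of a set\<close>

lemma upper_cap_eq: "upper_cap M H E A = ereal (cap A)" "0 \<le> cap A" "cap A \<le> 1"
proof -
  have "0 \<le> upper_cap M H E A" unfolding upper_cap_def
  proof (rule Inf_greatest, clarify)
    fix \<xi> assume "\<xi> \<in> H" "\<forall>\<omega>\<in>space M. indicator A \<omega> \<le> \<xi> \<omega>"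
    then have "E (\<lambda>\<omega>. 0) \<le> E \<xi>" by (intro E_mono H_const) (auto intro: order_trans[rotated])
    then show "0 \<le> E \<xi>" using E_const[of 0] by (simp add: zero_ereal_def)
  qed
  moreover have "upper_cap M H E A \<le> 1" unfolding upper_cap_def
    using H_const[of 1] E_const[of 1] by (intro Inf_lower) (auto simp: indicator_def intro!: exI[of _ "\<lambda>_. 1"])
  ultimately have "upper_cap M H E A = ereal (cap A) \<and> 0 \<le> cap A \<and> cap A \<le> 1"
    unfolding cap_def by (cases "upper_cap M H E A") auto
  then show "upper_cap M H E A = ereal (cap A)" "0 \<le> cap A" "cap A \<le> 1" by auto
qed

lemma cap_le:
  assumes "X \<in> Hb" "\<And>\<omega>. \<omega> \<in> space M \<Longrightarrow> indicator A \<omega> \<le> X \<omega>" shows "cap A \<le> expec X"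
proof -
  have "upper_cap M H E A \<le> E X" unfolding upper_cap_def
    using assms Hb_H by (intro Inf_lower) auto
  then show ?thesis using upper_cap_eq E_finite[OF assms(1)] by simp
qed

text \<open>A competitor in the infimum may be unbounded above. Cutting it at 1 keeps it above the
  indicator and puts it into \<open>Hb\<close>, where \<open>expec\<close> is meaningful.\<close>

lemma cap_obtain:
  assumes "cap A < e"
  obtains \<xi> where "\<xi> \<in> Hb" "\<And>\<omega>. \<omega> \<in> space M \<Longrightarrow> indicator A \<omega> \<le> \<xi> \<omega>" "expec \<xi> < e"
proof -
  have "upper_cap M H E A < ereal e" using assms upper_cap_eq by simp
  then obtain \<xi> where \<xi>: "\<xi> \<in> H" "\<forall>\<omega>\<in>space M. indicator A \<omega> \<le> \<xi> \<omega>" "E \<xi> < ereal e"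
    unfolding upper_cap_def Inf_less_iff by auto
  define Z where "Z = (\<lambda>\<omega>. min (\<xi> \<omega>) 1)"
  have ZH: "Z \<in> H" unfolding Z_def using \<xi>(1) by (rule H_Lip) (auto simp: min_def)
  have ind: "indicator A \<omega> \<le> Z \<omega>" if "\<omega> \<in> space M" for \<omega>
    using \<xi>(2) that by (auto simp: Z_def indicator_def)
  have "0 \<le> Z \<omega>" if "\<omega> \<in> space M" for \<omega> using ind[OF that] by (auto intro: order_trans[rotated])
  then have Zb: "Z \<in> Hb" by (intro HbI[OF ZH, of 1]) (auto simp: Z_def)
  have "E Z \<le> E \<xi>" using \<xi>(1) ZH by (intro E_mono) (auto simp: Z_def)
  then have "expec Z < e" using \<xi>(3) E_finite[OF Zb] by (metis ereal_less(5) order_le_less_trans less_ereal.simps(1))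
  then show ?thesis using that Zb ind by blast
qed

lemma cap_sum_obtain:
  assumes "finite F" and c: "\<And>i. i \<in> F \<Longrightarrow> 0 \<le> c i" and e: "0 < e"
  obtains X where "X \<in> Hb" "\<And>\<omega>. \<omega> \<in> space M \<Longrightarrow> (\<Sum>i\<in>F. c i * indicator (A i) \<omega>) \<le> X \<omega>"
    "expec X \<le> (\<Sum>i\<in>F. c i * cap (A i)) + e"
proof -
  \<comment> \<open>The slack is shared among the competitors in proportion to their weights; the
    summand 1 keeps the denominator positive when all weights vanish.\<close>
  define e' where "e' = e / (1 + (\<Sum>i\<in>F. c i))"
  have "0 \<le> (\<Sum>i\<in>F. c i)" using c by (intro sum_nonneg)
  then have e': "0 < e'" "e' * (\<Sum>i\<in>F. c i) \<le> e" using e by (auto simp: e'_def field_simps)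
  have "\<forall>i. \<exists>\<xi>\<in>Hb. (\<forall>\<omega>\<in>space M. indicator (A i) \<omega> \<le> \<xi> \<omega>) \<and> expec \<xi> < cap (A i) + e'"
    using cap_obtain[of _ "cap _ + e'"] e'(1) by (metis less_add_same_cancel1)
  then obtain \<xi> where \<xi>: "\<And>i. \<xi> i \<in> Hb" "\<And>i \<omega>. \<omega> \<in> space M \<Longrightarrow> indicator (A i) \<omega> \<le> \<xi> i \<omega>"
    "\<And>i. expec (\<xi> i) < cap (A i) + e'" by metis
  have "expec (\<lambda>\<omega>. \<Sum>i\<in>F. c i * \<xi> i \<omega>) \<le> (\<Sum>i\<in>F. expec (\<lambda>\<omega>. c i * \<xi> i \<omega>))"
    using \<xi>(1) by (intro expec_sum_le Hb_scale)
  also have "\<dots> = (\<Sum>i\<in>F. c i * expec (\<xi> i))" using \<xi>(1) c by (intro sum.cong expec_scale) auto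
  also have "\<dots> \<le> (\<Sum>i\<in>F. c i * (cap (A i) + e'))"
    using \<xi>(3) c by (intro sum_mono mult_left_mono) (auto intro: less_imp_le)
  also have "\<dots> = (\<Sum>i\<in>F. c i * cap (A i)) + e' * (\<Sum>i\<in>F. c i)"
    by (simp add: algebra_simps sum.distrib sum_distrib_left)
  finally have "expec (\<lambda>\<omega>. \<Sum>i\<in>F. c i * \<xi> i \<omega>) \<le> (\<Sum>i\<in>F. c i * cap (A i)) + e" using e'(2) by linarith
  then show ?thesis
    using \<xi>(1,2) c by (intro that[of "\<lambda>\<omega>. \<Sum>i\<in>F. c i * \<xi> i \<omega>"] Hb_sum Hb_scale sum_mono mult_left_mono)
qed

text \<open>Step functions need not lie in \<open>H\<close>, so \<open>expec\<close> cannot be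
  applied to the right-hand side. Near-optimal competitors of the sets replace the
  indicators.\<close>

lemma expec_le_cap_sum:
  assumes X: "X \<in> Hb" and F: "finite F" and c: "\<And>i. i \<in> F \<Longrightarrow> 0 \<le> c i"
    and le: "\<And>\<omega>. \<omega> \<in> space M \<Longrightarrow> X \<omega> \<le> d + (\<Sum>i\<in>F. c i * indicator (A i) \<omega>)"
  shows "expec X \<le> d + (\<Sum>i\<in>F. c i * cap (A i))"
proof (rule field_le_epsilon)
  fix e :: real assume "0 < e"
  then obtain Z where Z: "Z \<in> Hb" "\<And>\<omega>. \<omega> \<in> space M \<Longrightarrow> (\<Sum>i\<in>F. c i * indicator (A i) \<omega>) \<le> Z \<omega>"
    "expec Z \<le> (\<Sum>i\<in>F. c i * cap (A i)) + e"
    using cap_sum_obtain[where F = F and c = c and e = e and A = A] F c by blast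
  have "expec X \<le> expec (\<lambda>\<omega>. Z \<omega> + d)"
  proof (rule expec_mono[OF X Hb_add[OF Z(1) Hb_const]])
    show "X \<omega> \<le> Z \<omega> + d" if "\<omega> \<in> space M" for \<omega> using le[OF that] Z(2)[OF that] by linarith
  qed
  then show "expec X \<le> d + (\<Sum>i\<in>F. c i * cap (A i)) + e" using expec_add_const[OF Z(1), of d] Z(3) by linarith
qed

lemma cap_le_sum:
  assumes F: "finite F" and c: "\<And>i. i \<in> F \<Longrightarrow> 0 \<le> c i"
    and le: "\<And>\<omega>. \<omega> \<in> space M \<Longrightarrow> indicator A \<omega> \<le> (\<Sum>i\<in>F. c i * indicator (B i) \<omega> :: real)"
  shows "cap A \<le> (\<Sum>i\<in>F. c i * cap (B i))"
proof (rule field_le_epsilon)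
  fix e :: real assume "0 < e"
  then obtain Z where Z: "Z \<in> Hb" "\<And>\<omega>. \<omega> \<in> space M \<Longrightarrow> (\<Sum>i\<in>F. c i * indicator (B i) \<omega>) \<le> Z \<omega>"
    "expec Z \<le> (\<Sum>i\<in>F. c i * cap (B i)) + e"
    using cap_sum_obtain[where F = F and c = c and e = e and A = B] F c by blast
  have "cap A \<le> expec Z" using le Z(2) by (intro cap_le[OF Z(1)]) (meson order_trans)
  then show "cap A \<le> (\<Sum>i\<in>F. c i * cap (B i)) + e" using Z(3) by linarith
qed

lemma cap_mono: "A \<inter> space M \<subseteq> B \<Longrightarrow> cap A \<le> cap B"
  using cap_le_sum[of "{()}" "\<lambda>_. 1" A "\<lambda>_. B"] by (auto simp: indicator_def)

lemma cap_UN: assumes "finite I" shows "cap (\<Union>i\<in>I. A i) \<le> (\<Sum>i\<in>I. cap (A i))"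
proof -
  have "indicator (\<Union>i\<in>I. A i) \<omega> \<le> (\<Sum>i\<in>I. 1 * indicator (A i) \<omega> :: real)" for \<omega>
  proof (cases "\<omega> \<in> (\<Union>i\<in>I. A i)")
    case True
    then obtain i where "i \<in> I" "\<omega> \<in> A i" by blast
    then have "1 * indicator (A i) \<omega> \<le> (\<Sum>i\<in>I. 1 * indicator (A i) \<omega> :: real)"
      using assms by (intro member_le_sum) auto
    then show ?thesis using True \<open>\<omega> \<in> A i\<close> by (simp del: UN_iff)
  qed (auto intro!: sum_nonneg)
  then show ?thesis using cap_le_sum[OF assms, of "\<lambda>_. 1"] by simp
qed

lemma cap_Un: "cap (A \<union> B) \<le> cap A + cap B"
  using cap_UN[of "UNIV :: bool set" "\<lambda>b. if b then A else B"] by (simp add: UNIV_bool Un_commute)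

lemma cap_empty: "cap {} = 0"
  using cap_le[OF Hb_const[of 0], of "{}"] upper_cap_eq(2)[of "{}"] by simp

section \<open>The countably sub-additive extension\<close>

lemma cap_star_le:
  assumes "range B \<subseteq> sets M" "A \<subseteq> (\<Union>n. B n)" "summable (\<lambda>n. cap (B n))"
  shows "cap_star A \<le> ereal (\<Sum>n. cap (B n))"
proof -
  have "cap_star A \<le> (\<Sum>n. upper_cap M H E (B n))"
    unfolding upper_cap_star_def using assms(1,2) by (intro Inf_lower) auto
  also have "\<dots> = ereal (\<Sum>n. cap (B n))"
    unfolding upper_cap_eq by (simp add: suminf_ereal' assms(3))
  finally show ?thesis .
qed

lemma cap_star_nonneg: "0 \<le> cap_star A"
  unfolding upper_cap_star_def using upper_cap_eq by (intro Inf_greatest) (auto intro!: suminf_0_le)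

lemma cap_star_mono: "A \<subseteq> B \<Longrightarrow> cap_star A \<le> cap_star B"
  unfolding upper_cap_star_def by (rule Inf_superset_mono) blast


text \<open>The outer measure argument: covers of the sets \<open>A n\<close> with slack
  \<open>e * (1/2) ^ Suc n\<close> are merged into a single cover by the pairing function.\<close>

lemma cap_star_UN: "cap_star (\<Union>n. A n) \<le> (\<Sum>n. cap_star (A n))"
proof (cases "\<exists>n. cap_star (A n) = \<infinity>")
  case True
  then obtain n where n: "cap_star (A n) = \<infinity>" by blast
  have "(\<Sum>i<Suc n. cap_star (A i)) \<le> (\<Sum>n. cap_star (A n))"
    by (rule suminf_upper) (auto simp: cap_star_nonneg)
  moreover have "cap_star (A n) \<le> (\<Sum>i<Suc n. cap_star (A i))"
    using add_right_mono[OF sum_nonneg[of "{..<n}" "\<lambda>i. cap_star (A i)"], of "cap_star (A n)"] by (simp add: cap_star_nonneg)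
  ultimately show ?thesis using n by auto
next
  case fin: False
  show ?thesis
  proof (rule ereal_le_epsilon2)
    fix e :: real assume "0 < e"
    have "\<exists>B. range B \<subseteq> sets M \<and> A n \<subseteq> (\<Union>i. B i) \<and>
        (\<Sum>i. upper_cap M H E (B i)) \<le> cap_star (A n) + ereal (e * (1/2) ^ Suc n)" for n
    proof -
      \<comment> \<open>Strictness fails at infinity, which is why that case was split off.\<close>
      have "cap_star (A n) < cap_star (A n) + ereal (e * (1/2) ^ Suc n)"
        using fin cap_star_nonneg[of "A n"] \<open>0 < e\<close> by (cases "cap_star (A n)") auto
      then obtain S where "S \<in> {(\<Sum>n. upper_cap M H E (B n)) |B :: nat \<Rightarrow> 'a set.
              range B \<subseteq> sets M \<and> A n \<subseteq> (\<Union>n. B n)}" "S < cap_star (A n) + ereal (e * (1/2) ^ Suc n)"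
        unfolding upper_cap_star_def[of _ _ _ "A n"] Inf_less_iff by blast
      then show ?thesis by (auto intro: less_imp_le)
    qed
    then obtain B where B: "\<And>n. range (B n) \<subseteq> sets M" "\<And>n. A n \<subseteq> (\<Union>i. B n i)"
      "\<And>n. (\<Sum>i. upper_cap M H E (B n i)) \<le> cap_star (A n) + ereal (e * (1/2) ^ Suc n)" by metis
    define C where "C m = (case prod_decode m of (n, i) \<Rightarrow> B n i)" for m
    have "(\<Union>n. A n) \<subseteq> (\<Union>m. C m)"
    proof clarify
      fix x n assume "x \<in> A n"
      then obtain i where "x \<in> B n i" using B(2) by blast
      then have "x \<in> C (prod_encode (n, i))" by (simp add: C_def)
      then show "x \<in> (\<Union>m. C m)" by blast
    qed
    moreover have "range C \<subseteq> sets M" using B(1) by (auto simp: C_def split: prod.splits)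
    ultimately have "cap_star (\<Union>n. A n) \<le> (\<Sum>m. upper_cap M H E (C m))"
      unfolding upper_cap_star_def by (intro Inf_lower) auto
    also have "\<dots> = (\<Sum>m. (\<lambda>p. upper_cap M H E (B (fst p) (snd p))) (prod_decode m))"
      by (simp add: C_def split_beta)
    also have "\<dots> \<le> (\<Sum>n. (\<Sum>i. upper_cap M H E (B n i)))"
      using suminf_prod_decode_le[of "\<lambda>p. upper_cap M H E (B (fst p) (snd p))"] by (simp add: upper_cap_eq)
    also have "\<dots> \<le> (\<Sum>n. cap_star (A n) + ereal (e * (1/2) ^ Suc n))"
      using B(3) by (intro suminf_le_pos) (auto simp: upper_cap_eq intro!: suminf_0_le)
    also have "\<dots> = (\<Sum>n. cap_star (A n)) + (\<Sum>n. ereal (e * (1/2) ^ Suc n))"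
      using \<open>0 < e\<close> by (intro suminf_add_ereal) (auto simp: cap_star_nonneg)
    also have "(\<Sum>n. ereal (e * (1/2) ^ Suc n)) = ereal e"
      using sums_mult[OF power_half_series, of e, THEN sums_ereal[THEN iffD2]] by (simp add: sums_iff)
    finally show "cap_star (\<Union>n. A n) \<le> (\<Sum>n. cap_star (A n)) + ereal e" .
  qed
qed

lemma cap_star_Un: "cap_star (A \<union> B) \<le> cap_star A + cap_star B"
proof -
  define C where "C n = (if n = 0 then A else if n = 1 then B else {})" for n :: nat
  have e: "cap_star {} = 0"
    using cap_star_le[of "\<lambda>_. {}" "{}"] cap_star_nonneg[of "{}"] cap_empty by (simp add: zero_ereal_def)
  have "A \<union> B = (\<Union>n. C n)" by (auto simp: C_def split: if_splits)
  then have "cap_star (A \<union> B) \<le> (\<Sum>n. cap_star (C n))" using cap_star_UN by simp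
  also have "\<dots> = (\<Sum>n<2. cap_star (C n))" by (rule suminf_finite) (auto simp: C_def e)
  also have "\<dots> = cap_star A + cap_star B" by (simp add: C_def numeral_2_eq_2)
  finally show ?thesis .
qed


lemma cap_star_null_Un: "cap_star N = 0 \<Longrightarrow> cap_star (A \<union> N) = cap_star A"
  using cap_star_Un[of A N] cap_star_mono[of A "A \<union> N"] by (auto intro: antisym)

lemma cap_star_null_mono: "cap_star N = 0 \<Longrightarrow> A \<subseteq> N \<Longrightarrow> cap_star A = 0"
  using cap_star_mono[of A N] cap_star_nonneg[of A] by auto

lemma cap_star_null_UN: "(\<And>n::nat. cap_star (N n) = 0) \<Longrightarrow> cap_star (\<Union>n. N n) = 0"
  using cap_star_UN[of N] cap_star_nonneg[of "\<Union>n. N n"] by auto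

text \<open>A weighted Borel-Cantelli lemma. An infinite series cannot be integrated term by term
  here, so it is cut into finite blocks of weighted capacity at most \<open>(1/4) ^ k\<close>. By a
  Markov inequality the block sum reaches \<open>(1/2) ^ k\<close> with capacity at most
  \<open>(1/2) ^ k\<close>, and these capacities are summed in \<open>cap_star\<close>.\<close>

lemma cap_star_summable_indicator:
  assumes c: "\<And>i. 0 \<le> c i" and B: "\<And>i::nat. B i \<in> sets M"
    and sm: "summable (\<lambda>i. c i * cap (B i))"
  shows "cap_star {\<omega>\<in>space M. \<not> summable (\<lambda>i. c i * indicator (B i) \<omega> :: real)} = 0"
proof -
  define N where "N = {\<omega>\<in>space M. \<not> summable (\<lambda>i. c i * indicator (B i) \<omega> :: real)}"
  define f where "f i = c i * cap (B i)" for i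
  have f: "0 \<le> f i" for i using c upper_cap_eq(2) by (simp add: f_def)
  have "\<exists>g. \<forall>m\<ge>g. \<forall>n. sum f {m..<n} \<le> (1/4) ^ k" for k :: nat
  proof -
    have "0 < (1/4 :: real) ^ k" by simp
    then obtain g where g: "\<forall>m\<ge>g. \<forall>n. norm (sum f {m..<n}) < (1/4) ^ k"
      using sm[folded f_def] unfolding summable_Cauchy by blast
    have "sum f {m..<n} \<le> (1/4) ^ k" if "g \<le> m" for m n
      using g that by (smt (verit) real_norm_def)
    then show ?thesis by blast
  qed
  then obtain g where g: "\<And>k m n. g k \<le> m \<Longrightarrow> sum f {m..<n} \<le> (1/4) ^ k" by metis
  \<comment> \<open>Summing the \<open>g j\<close> makes the cut points monotone and keeps them
    above \<open>g k\<close>; the summand \<open>k\<close> makes them unbounded.\<close>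
  define I where "I k = (\<Sum>j\<le>k. g j) + k" for k
  have Ig: "g k \<le> I k" for k
    using member_le_sum[of k "{..k}" g] by (simp add: I_def)
  have I_less: "I k \<le> I (Suc k)" for k by (simp add: I_def)
  have Ik: "k \<le> I k" for k by (simp add: I_def)
  define D where "D k = {\<omega>\<in>space M. (1/2) ^ k \<le> (\<Sum>i=I k..<I (Suc k). c i * indicator (B i) \<omega> :: real)}" for k
  have Dm: "D k \<in> sets M" for k unfolding D_def using B by measurable
  have capD: "cap (D k) \<le> (1/2) ^ k" for k
  proof -
    have "cap (D k) \<le> (\<Sum>i=I k..<I (Suc k). (2 ^ k * c i) * cap (B i))"
    proof (rule cap_le_sum)
      fix \<omega> assume "\<omega> \<in> space M"
      show "indicator (D k) \<omega> \<le> (\<Sum>i=I k..<I (Suc k). 2 ^ k * c i * indicator (B i) \<omega> :: real)"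
      proof (cases "\<omega> \<in> D k")
        case True
        have "2 ^ k * (1/2) ^ k \<le> 2 ^ k * (\<Sum>i=I k..<I (Suc k). c i * indicator (B i) \<omega> :: real)"
          using True by (intro mult_left_mono) (auto simp: D_def)
        also have "\<dots> = (\<Sum>i=I k..<I (Suc k). 2 ^ k * c i * indicator (B i) \<omega>)"
          unfolding sum_distrib_left mult.assoc ..
        finally show ?thesis using True by (simp only: indicator_simps flip: power_mult_distrib) simp
      qed (auto intro!: sum_nonneg mult_nonneg_nonneg c)
    qed (auto simp: c)
    also have "\<dots> = 2 ^ k * sum f {I k..<I (Suc k)}" by (simp add: f_def sum_distrib_left mult.assoc)
    also have "\<dots> \<le> 2 ^ k * (1/4) ^ k" using g[OF Ig] by (intro mult_left_mono) auto
    also have "\<dots> = (1/2) ^ k" by (simp flip: power_mult_distrib)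
    finally show ?thesis .
  qed
  \<comment> \<open>Outside all the \<open>D (k + K)\<close> the blocks from index \<open>K\<close>
    on are bounded by a geometric series, so the whole series converges.\<close>
  have sub: "N \<subseteq> (\<Union>k. D (k + K))" for K
  proof
    fix \<omega> assume \<omega>: "\<omega> \<in> N"
    then have sp: "\<omega> \<in> space M" by (simp add: N_def)
    show "\<omega> \<in> (\<Union>k. D (k + K))"
    proof (rule ccontr)
      assume no: "\<omega> \<notin> (\<Union>k. D (k + K))"
      define h where "h i = c i * indicator (B i) \<omega>" for i
      have h: "0 \<le> h i" for i using c by (simp add: h_def)
      have blk: "sum h {I (k + K)..<I (Suc (k + K))} \<le> (1/2) ^ k" for k
      proof -
        have "\<omega> \<notin> D (k + K)" using no by blast
        then have "sum h {I (k + K)..<I (Suc (k + K))} \<le> (1/2) ^ (k + K)"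
          using sp by (simp add: D_def h_def not_le)
        also have "\<dots> \<le> (1/2) ^ k" by (intro power_decreasing) auto
        finally show ?thesis .
      qed
      have tot: "sum h {..<I (n + K)} \<le> sum h {..<I K} + (\<Sum>k<n. (1/2) ^ k)" for n
      proof (induction n)
        case (Suc n)
        have "sum h {..<I (Suc n + K)} = sum h {..<I (n + K)} + sum h {I (n + K)..<I (Suc (n + K))}"
          using I_less[of "n + K"] by (simp add: sum.atLeastLessThan_concat flip: atLeast0LessThan)
        then show ?case using Suc blk[of n] by simp
      qed simp
      have "sum h {..<n} \<le> sum h {..<I K} + 2" for n
      proof -
        have "sum h {..<n} \<le> sum h {..<I (n + K)}"
          using Ik[of "n + K"] h by (intro sum_mono2) auto
        moreover have "(\<Sum>k<n. (1/2) ^ k) \<le> (2::real)"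
          using sum_le_suminf[of "\<lambda>k. (1/2::real) ^ k" "{..<n}"] suminf_geometric[of "1/2::real"] by simp
        ultimately show ?thesis using tot[of n] by linarith
      qed
      then have "summable h" using h by (intro summableI_nonneg_bounded) auto
      then show False using \<omega> by (simp add: N_def h_def[abs_def])
    qed
  qed
  have "cap_star N \<le> ereal (2 * (1/2) ^ K)" for K
  proof -
    have s1: "summable (\<lambda>k. (1/2::real) ^ (k + K))"
      by (simp add: power_add summable_mult2)
    then have s2: "summable (\<lambda>k. cap (D (k + K)))"
      by (rule summable_comparison_test[rotated]) (auto intro!: exI[of _ 0] capD simp: upper_cap_eq(2))
    have "cap_star N \<le> ereal (\<Sum>k. cap (D (k + K)))"
      using sub Dm s2 by (intro cap_star_le) auto
    also have "(\<Sum>k. cap (D (k + K))) \<le> (\<Sum>k. (1/2) ^ (k + K))"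
      using s1 s2 capD by (intro suminf_le) auto
    also have "\<dots> = 2 * (1/2) ^ K"
      using suminf_geometric[of "1/2::real"] by (simp add: power_add suminf_mult2[symmetric])
    finally show ?thesis by simp
  qed
  moreover have "(\<lambda>K. ereal (2 * (1/2) ^ K)) \<longlonglongrightarrow> ereal (2 * 0)"
    by (intro tendsto_intros) (auto simp: LIMSEQ_power_zero)
  ultimately have "cap_star N \<le> ereal (2 * 0)" by (meson LIMSEQ_le_const)
  then show ?thesis using cap_star_nonneg[of N] by (simp add: N_def zero_ereal_def)
qed

text \<open>The case of unit weights: a summable series of zeros and ones is eventually
  zero.\<close>

lemma cap_star_borel_cantelli:
  assumes B: "\<And>i::nat. B i \<in> sets M" and sm: "summable (\<lambda>i. cap (B i))"
  shows "cap_star {\<omega>\<in>space M. \<not> (\<forall>\<^sub>F i in sequentially. \<omega> \<notin> B i)} = 0"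
proof (rule cap_star_null_mono)
  show "cap_star {\<omega>\<in>space M. \<not> summable (\<lambda>i. 1 * indicator (B i) \<omega> :: real)} = 0"
    by (rule cap_star_summable_indicator) (use B sm in auto)
  have "\<forall>\<^sub>F i in sequentially. \<omega> \<notin> B i" if "summable (\<lambda>i. 1 * indicator (B i) \<omega> :: real)" for \<omega>
  proof -
    have "\<forall>\<^sub>F i in sequentially. indicator (B i) \<omega> < (1::real)"
      using summable_LIMSEQ_zero[OF that] by (intro order_tendstoD) auto
    then show ?thesis by eventually_elim (auto simp: indicator_def split: if_splits)
  qed
  then show "{\<omega>\<in>space M. \<not> (\<forall>\<^sub>F i in sequentially. \<omega> \<notin> B i)}
    \<subseteq> {\<omega>\<in>space M. \<not> summable (\<lambda>i. 1 * indicator (B i) \<omega> :: real)}" by blast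
qed

text \<open>Regularity stands in for continuity from above. Given a cover of \<open>A\<close>,
  near-optimal competitors of its sets are subtracted from \<open>u m\<close>; the positive part of
  the difference decreases to 0 everywhere, so its upper expectation vanishes in the limit and the
  competitors must account for \<open>c\<close>.\<close>

lemma cap_star_ge_of_regular:
  assumes reg: "regular_on_bounded M H E"
    and uH: "\<And>m. u m \<in> Hb" and u01: "\<And>m \<omega>. \<omega> \<in> space M \<Longrightarrow> 0 \<le> u m \<omega> \<and> u m \<omega> \<le> 1"
    and dec: "\<And>\<omega>. \<omega> \<in> space M \<Longrightarrow> decseq (\<lambda>m. u m \<omega>)"
    and lim: "\<And>\<omega>. \<omega> \<in> space M \<Longrightarrow> \<omega> \<notin> A \<Longrightarrow> (\<lambda>m. u m \<omega>) \<longlonglongrightarrow> 0"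
    and ge: "\<And>m. c \<le> expec (u m)"
  shows "ereal c \<le> cap_star A"
  unfolding upper_cap_star_def
proof (rule Inf_greatest, clarify)
  fix B :: "nat \<Rightarrow> 'a set" assume B: "range B \<subseteq> sets M" "A \<subseteq> (\<Union>n. B n)"
  show "ereal c \<le> (\<Sum>n. upper_cap M H E (B n))"
  proof (cases "summable (\<lambda>n. cap (B n))")
    case False
    then have "(\<Sum>n. upper_cap M H E (B n)) = \<infinity>"
      using suminf_upper[of "\<lambda>n. ereal (cap (B n))"] summable_real_of_ereal[of "\<lambda>n. ereal (cap (B n))"]
      by (auto simp: upper_cap_eq)
    then show ?thesis by simp
  next
    case sm: True
    have "c \<le> (\<Sum>n. cap (B n)) + e" if "0 < e" for e
    proof -
      have "\<forall>n. \<exists>\<xi>\<in>Hb. (\<forall>\<omega>\<in>space M. indicator (B n) \<omega> \<le> \<xi> \<omega>) \<and> expec \<xi> < cap (B n) + e * (1/2) ^ Suc n"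
        using cap_obtain[of _ "cap _ + e * (1/2) ^ Suc _"] \<open>0 < e\<close>
        by (metis less_add_same_cancel1 mult_pos_pos zero_less_divide_1_iff zero_less_numeral zero_less_power)
      then obtain \<xi> where \<xi>: "\<And>n. \<xi> n \<in> Hb" "\<And>n \<omega>. \<omega> \<in> space M \<Longrightarrow> indicator (B n) \<omega> \<le> \<xi> n \<omega>"
        "\<And>n. expec (\<xi> n) < cap (B n) + e * (1/2) ^ Suc n" by metis
      have \<xi>0: "0 \<le> \<xi> n \<omega>" if "\<omega> \<in> space M" for n \<omega> using \<xi>(2)[OF that, of n] by (auto intro: order_trans[rotated])
      define X where "X m \<omega> = u m \<omega> + (-1) * (\<Sum>n<m. \<xi> n \<omega>)" for m \<omega>
      have X: "X m \<in> Hb" for m unfolding X_def using uH \<xi>(1) by (intro Hb_add Hb_scale Hb_sum)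
      define P where "P m \<omega> = max 0 (X m \<omega>)" for m \<omega>
      have P01: "\<bar>P m \<omega>\<bar> \<le> 1" if "\<omega> \<in> space M" for m \<omega>
        using u01[OF that, of m] sum_nonneg[of "{..<m}" "\<lambda>n. \<xi> n \<omega>"] \<xi>0[OF that] by (auto simp: P_def X_def)
      have PH: "P m \<in> H" for m
        unfolding P_def by (rule H_Lip[OF Hb_H[OF X]]) (auto simp: max_def)
      have P: "P m \<in> Hb" for m by (rule HbI[OF PH P01])
      have PH1: "\<forall>n. P n \<in> H \<and> bounded (P n ` space M)"
        using PH P01 by (auto simp: bounded_iff)
      have P2: "decseq (\<lambda>m. P m \<omega>) \<and> (\<lambda>m. P m \<omega>) \<longlonglongrightarrow> 0" if \<omega>: "\<omega> \<in> space M" for \<omega>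
      proof
        show "decseq (\<lambda>m. P m \<omega>)"
        proof (rule decseq_SucI)
          fix m
          have "u (Suc m) \<omega> \<le> u m \<omega>" using dec[OF \<omega>] by (simp add: decseq_Suc_iff)
          then show "P (Suc m) \<omega> \<le> P m \<omega>" using \<xi>0[OF \<omega>, of m] by (auto simp: P_def X_def max_def)
        qed
        \<comment> \<open>On \<open>A\<close> some competitor is at least 1 and, once it is
          included, absorbs \<open>u m \<omega> \<le> 1\<close>. Off \<open>A\<close> the bound by
          \<open>u m \<omega>\<close> suffices.\<close>
        show "(\<lambda>m. P m \<omega>) \<longlonglongrightarrow> 0"
        proof (cases "\<omega> \<in> A")
          case True
          then obtain n where n: "\<omega> \<in> B n" using B(2) by blast
          have "P m \<omega> = 0" if "n < m" for m
          proof -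
            have "1 \<le> \<xi> n \<omega>" using \<xi>(2)[OF \<omega>, of n] n by simp
            also have "\<dots> \<le> (\<Sum>n<m. \<xi> n \<omega>)" using that \<xi>0[OF \<omega>] by (intro member_le_sum) auto
            finally show ?thesis using u01[OF \<omega>, of m] by (simp add: P_def X_def)
          qed
          then have "\<forall>\<^sub>F m in sequentially. P m \<omega> = 0" using eventually_gt_at_top[of n] by (rule eventually_mono[rotated])
          then show ?thesis by (simp add: tendsto_eventually)
        next
          case False
          have "0 \<le> P m \<omega> \<and> P m \<omega> \<le> u m \<omega>" for m
            using u01[OF \<omega>, of m] sum_nonneg[of "{..<m}" "\<lambda>n. \<xi> n \<omega>"] \<xi>0[OF \<omega>] by (auto simp: P_def X_def)
          then show ?thesis
            by (intro tendsto_sandwich[OF _ _ tendsto_const lim[OF \<omega> False]] always_eventually allI) blast+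
        qed
      qed
      have "(\<lambda>m. E (P m)) \<longlonglongrightarrow> 0"
        using reg PH1 P2 unfolding regular_on_bounded_def by blast
      then have Plim: "(\<lambda>m. expec (P m)) \<longlonglongrightarrow> 0"
        unfolding E_finite[OF P] by (simp add: zero_ereal_def)
      have "c \<le> expec (P m) + ((\<Sum>n. cap (B n)) + e)" for m
      proof -
        have "c \<le> expec (u m)" by (rule ge)
        also have "\<dots> \<le> expec (\<lambda>\<omega>. P m \<omega> + (\<Sum>n<m. \<xi> n \<omega>))"
          using uH P \<xi>(1) by (intro expec_mono[OF uH Hb_add[OF P Hb_sum]]) (auto simp: P_def X_def)
        also have "\<dots> \<le> expec (P m) + expec (\<lambda>\<omega>. \<Sum>n<m. \<xi> n \<omega>)"
          using P \<xi>(1) by (intro expec_add_le Hb_sum)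
        also have "expec (\<lambda>\<omega>. \<Sum>n<m. \<xi> n \<omega>) \<le> (\<Sum>n<m. expec (\<xi> n))" using \<xi>(1) by (intro expec_sum_le)
        also have "\<dots> \<le> (\<Sum>n<m. cap (B n) + e * (1/2) ^ Suc n)"
          using \<xi>(3) by (intro sum_mono less_imp_le)
        also have "\<dots> = (\<Sum>n<m. cap (B n)) + e * (\<Sum>n<m. (1/2) ^ Suc n)"
          by (simp add: sum.distrib sum_distrib_left)
        also have "\<dots> \<le> (\<Sum>n. cap (B n)) + e * 1"
        proof (intro add_mono mult_left_mono)
          show "(\<Sum>n<m. cap (B n)) \<le> (\<Sum>n. cap (B n))" using sm upper_cap_eq by (intro sum_le_suminf) auto
          show "(\<Sum>n<m. (1/2) ^ Suc n) \<le> (1::real)" by (rule sum_half_powers_le)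
        qed (use \<open>0 < e\<close> in auto)
        finally show ?thesis by simp
      qed
      then have "c \<le> 0 + ((\<Sum>n. cap (B n)) + e)"
        by (intro LIMSEQ_le_const[OF tendsto_add[OF Plim tendsto_const]]) auto
      then show ?thesis by simp
    qed
    then have "c \<le> (\<Sum>n. cap (B n))" by (rule field_le_epsilon)
    then show ?thesis by (simp add: upper_cap_eq suminf_ereal' sm)
  qed
qed

lemma cap_star_space_le: "A \<subseteq> space M \<Longrightarrow> cap_star A \<le> 1"
proof -
  assume A: "A \<subseteq> space M"
  define B where "B n = (if n = 0 then space M else {})" for n :: nat
  have s: "(\<lambda>n. cap (B n)) sums (\<Sum>n<1. cap (B n))" by (rule sums_finite) (auto simp: B_def cap_empty)
  have "cap_star A \<le> ereal (\<Sum>n. cap (B n))"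
    using A s by (intro cap_star_le) (auto simp: B_def sums_iff)
  also have "(\<Sum>n. cap (B n)) = cap (space M)" using s by (simp add: B_def sums_iff)
  also have "ereal \<dots> \<le> 1" using upper_cap_eq(3) by simp
  finally show ?thesis by simp
qed

end

subsection \<open>Independence\<close>

text \<open>The constant is uniform in the inserted coordinate \<open>t\<close>, so that it survives
  the upper expectation over \<open>t\<close> in \<open>bdd_lip_E_Y_upd\<close>.\<close>

lemma bdd_lip_vdist_fun_upd_bound:
  assumes "bdd_lip (vdist (Suc n)) \<phi>"
  obtains L where "0 \<le> L" "\<And>x y t. \<bar>\<phi> (x(n := t)) - \<phi> (y(n := t))\<bar> \<le> L * vdist n x y"
proof -
  obtain L where L: "\<And>x y. \<bar>\<phi> x - \<phi> y\<bar> \<le> L * vdist (Suc n) x y" using assms by (rule bdd_lip_lip) blast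
  have d: "vdist (Suc n) (x(n := t)) (y(n := t)) = vdist n x y" for x y t
  proof -
    have "(\<Sum>i<n. ((x(n := t)) i - (y(n := t)) i)\<^sup>2) = (\<Sum>i<n. (x i - y i)\<^sup>2)" by (intro sum.cong) auto
    then show ?thesis by (simp add: vdist_def vnorm_def L2_set_def)
  qed
  have "\<bar>\<phi> (x(n := t)) - \<phi> (y(n := t))\<bar> \<le> \<bar>L\<bar> * vdist n x y" for x y t
    using L[of "x(n := t)" "y(n := t)"] mult_right_mono[OF abs_ge_self[of L] vdist_nonneg[of n x y]]
    unfolding d by linarith
  then show ?thesis using that[of "\<bar>L\<bar>"] by simp
qed

section \<open>The law of an independent, identically distributed sequence\<close>

locale iid_sequence = sublinear_expectation_space M H E
  for M :: "'a measure" and H :: "('a \<Rightarrow> real) set" and E :: "('a \<Rightarrow> real) \<Rightarrow> ereal" +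
  fixes Y :: "nat \<Rightarrow> 'a \<Rightarrow> real"
  assumes Y_H: "i \<ge> 1 \<Longrightarrow> Y i \<in> H"
    and Y_indep: "indep_seq E Y"
    and Y_ident: "ident_distr_seq E Y"
begin

text \<open>Shifts the index so that coordinates start at 0, as in the encoding of vectors:
  coordinate \<open>k\<close> is Y_{k+1}. \<open>E_path\<close> then is the law of the sequence and
  \<open>E_Y\<close> its one-dimensional marginal.\<close>

definition path :: "'a \<Rightarrow> nat \<Rightarrow> real" where "path \<omega> = (\<lambda>k. Y (Suc k) \<omega>)"

definition E_path :: "((nat \<Rightarrow> real) \<Rightarrow> real) \<Rightarrow> real" where "E_path \<phi> = expec (\<lambda>\<omega>. \<phi> (path \<omega>))"

definition E_Y :: "(real \<Rightarrow> real) \<Rightarrow> real" where "E_Y g = expec (\<lambda>\<omega>. g (Y 1 \<omega>))"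

lemma bdd_lip_path_Hb: assumes "bdd_lip (vdist n) \<phi>" shows "(\<lambda>\<omega>. \<phi> (path \<omega>)) \<in> Hb"
proof -
  obtain B where B: "\<And>x. \<bar>\<phi> x\<bar> \<le> B" using assms by (rule bdd_lip_bound) blast
  have "(\<lambda>\<omega>. \<phi> (path \<omega>)) \<in> H"
    using H_comp[of n "\<lambda>k. Y (Suc k)", OF Y_H bdd_lip_imp_C_l_Lip[OF assms]] by (simp add: path_def)
  then show ?thesis using B by (intro HbI) auto
qed

lemma bdd_lip_Y_Hb: assumes "bdd_lip rdist g" "i \<ge> 1" shows "(\<lambda>\<omega>. g (Y i \<omega>)) \<in> Hb"
proof -
  have "(\<lambda>\<omega>. (\<lambda>x. g (x (i - 1))) (path \<omega>)) \<in> Hb"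
    using assms by (intro bdd_lip_path_Hb[of i] bdd_lip_coord) auto
  then show ?thesis using assms(2) by (simp add: path_def)
qed

lemma expec_ident: assumes "bdd_lip rdist g" "i \<ge> 1" shows "expec (\<lambda>\<omega>. g (Y i \<omega>)) = E_Y g"
  using Y_ident assms unfolding ident_distr_seq_def same_distr_def expec_def E_Y_def bdd_lip_rdist_iff by metis

lemma E_Y_mono: "bdd_lip rdist g \<Longrightarrow> bdd_lip rdist h \<Longrightarrow> (\<And>t. g t \<le> h t) \<Longrightarrow> E_Y g \<le> E_Y h"
  unfolding E_Y_def by (intro expec_mono bdd_lip_Y_Hb) auto

lemma E_Y_const [simp]: "E_Y (\<lambda>_. c) = c" by (simp add: E_Y_def)

lemma E_Y_add_le: "bdd_lip rdist g \<Longrightarrow> bdd_lip rdist h \<Longrightarrow> E_Y (\<lambda>t. g t + h t) \<le> E_Y g + E_Y h"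
  unfolding E_Y_def by (intro expec_add_le bdd_lip_Y_Hb) auto

lemma E_Y_scale: "bdd_lip rdist g \<Longrightarrow> 0 \<le> c \<Longrightarrow> E_Y (\<lambda>t. c * g t) = c * E_Y g"
  unfolding E_Y_def by (intro expec_scale bdd_lip_Y_Hb) auto

lemma E_Y_add_const: "bdd_lip rdist g \<Longrightarrow> E_Y (\<lambda>t. g t + c) = E_Y g + c"
  unfolding E_Y_def by (intro expec_add_const bdd_lip_Y_Hb) auto

lemma E_Y_affine: "bdd_lip rdist g \<Longrightarrow> 0 \<le> b \<Longrightarrow> E_Y (\<lambda>t. a + b * g t) = a + b * E_Y g"
  using E_Y_add_const[OF bdd_lip_mult[OF bdd_lip_const], of g b a] E_Y_scale[of g b] by (simp add: add.commute)

lemma E_path_mono: "bdd_lip (vdist n) \<phi> \<Longrightarrow> bdd_lip (vdist n) \<psi> \<Longrightarrow> (\<And>x. \<phi> x \<le> \<psi> x) \<Longrightarrow> E_path \<phi> \<le> E_path \<psi>"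
  unfolding E_path_def by (intro expec_mono bdd_lip_path_Hb) auto

lemma E_path_const [simp]: "E_path (\<lambda>_. c) = c" by (simp add: E_path_def)

lemma E_path_add_le: "bdd_lip (vdist n) \<phi> \<Longrightarrow> bdd_lip (vdist n) \<psi> \<Longrightarrow> E_path (\<lambda>x. \<phi> x + \<psi> x) \<le> E_path \<phi> + E_path \<psi>"
  unfolding E_path_def by (intro expec_add_le bdd_lip_path_Hb) auto

lemma E_path_scale: "bdd_lip (vdist n) \<phi> \<Longrightarrow> 0 \<le> c \<Longrightarrow> E_path (\<lambda>x. c * \<phi> x) = c * E_path \<phi>"
  unfolding E_path_def by (intro expec_scale bdd_lip_path_Hb) auto

lemma E_path_add_const: "bdd_lip (vdist n) \<phi> \<Longrightarrow> E_path (\<lambda>x. \<phi> x + c) = E_path \<phi> + c"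
  unfolding E_path_def by (intro expec_add_const bdd_lip_path_Hb) auto

text \<open>Integrating out the last coordinate stays within the test functions, so that
  \<open>E_path_step\<close> can be iterated.\<close>

lemma bdd_lip_E_Y_upd:
  assumes "bdd_lip (vdist (Suc n)) \<phi>" shows "bdd_lip (vdist n) (\<lambda>x. E_Y (\<lambda>t. \<phi> (x(n := t))))"
proof -
  obtain B where B: "0 \<le> B" "\<And>x. \<bar>\<phi> x\<bar> \<le> B" using assms by (rule bdd_lip_bound) blast
  obtain L where L: "0 \<le> L" "\<And>x y t. \<bar>\<phi> (x(n := t)) - \<phi> (y(n := t))\<bar> \<le> L * vdist n x y"
    using assms by (rule bdd_lip_vdist_fun_upd_bound) blast
  have bdd_lip: "bdd_lip rdist (\<lambda>t. \<phi> (x(n := t)))" for x by (rule bdd_lip_fun_upd[OF assms])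
  have le: "E_Y (\<lambda>t. \<phi> (x(n := t))) \<le> E_Y (\<lambda>t. \<phi> (y(n := t))) + L * vdist n x y" for x y
  proof -
    have "E_Y (\<lambda>t. \<phi> (x(n := t))) \<le> E_Y (\<lambda>t. \<phi> (y(n := t)) + L * vdist n x y)"
    proof (rule E_Y_mono[OF bdd_lip])
      show "bdd_lip rdist (\<lambda>t. \<phi> (y(n := t)) + L * vdist n x y)" by (intro bdd_lip_intros bdd_lip)
      show "\<phi> (x(n := t)) \<le> \<phi> (y(n := t)) + L * vdist n x y" for t using L(2)[of x t y] by linarith
    qed
    then show ?thesis using E_Y_add_const[OF bdd_lip] by simp
  qed
  have sym: "vdist n x y = vdist n y x" for x y
    by (simp add: vdist_def vnorm_def L2_set_def power2_commute)
  show ?thesis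
  proof (rule bdd_lipI[where B = B and L = L])
    fix x y
    have "E_Y (\<lambda>t. \<phi> (x(n := t))) \<le> E_Y (\<lambda>_. B)" "E_Y (\<lambda>_. - B) \<le> E_Y (\<lambda>t. \<phi> (x(n := t)))"
      using B(2) by (intro E_Y_mono bdd_lip bdd_lip_const; auto simp: abs_le_iff minus_le_iff)+
    then show "\<bar>E_Y (\<lambda>t. \<phi> (x(n := t)))\<bar> \<le> B" by auto
    show "\<bar>E_Y (\<lambda>t. \<phi> (x(n := t))) - E_Y (\<lambda>t. \<phi> (y(n := t)))\<bar> \<le> L * vdist n x y"
      using le[of x y] le[of y x] sym[of x y] by (simp add: abs_le_iff)
  qed
qed

text \<open>Independence in the form of a Fubini rule. Only the last coordinate can be integrated
  first, since independence of Y_{n+1} relative to the past is not a symmetric relation.\<close>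

lemma E_path_step:
  assumes "bdd_lip (vdist (Suc n)) \<phi>" shows "E_path \<phi> = E_path (\<lambda>x. E_Y (\<lambda>t. \<phi> (x(n := t))))"
proof -
  have id: "E_Y (\<lambda>t. \<phi> (x(n := t))) = expec (\<lambda>\<omega>. \<phi> (x(n := Y (Suc n) \<omega>)))" for x
    using expec_ident[OF bdd_lip_fun_upd[OF assms], of "Suc n" x] by simp
  show ?thesis
  proof (cases "n = 0")
    \<comment> \<open>There is no past to be independent of; the test function depends on coordinate
      0 alone and the claim is about its marginal.\<close>
    case True
    have c: "E_Y (\<lambda>t. \<phi> (x(n := t))) = E_Y (\<lambda>t. \<phi> ((\<lambda>_. 0)(n := t)))" for x
      using True by (intro arg_cong[of _ _ E_Y] ext bdd_lip_cong[OF assms]) auto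
    have "\<phi> (path \<omega>) = \<phi> ((\<lambda>_. 0)(n := Y (Suc n) \<omega>))" for \<omega>
      using True by (intro bdd_lip_cong[OF assms]) (auto simp: path_def)
    then have "E_path \<phi> = E_Y (\<lambda>t. \<phi> ((\<lambda>_. 0)(n := t)))" unfolding E_path_def id by simp
    moreover have "E_path (\<lambda>x. E_Y (\<lambda>t. \<phi> (x(n := t)))) = E_path (\<lambda>_. E_Y (\<lambda>t. \<phi> ((\<lambda>_. 0)(n := t))))"
      by (intro arg_cong[of _ _ E_path] ext c)
    ultimately show ?thesis by simp
  next
    case False
    have v: "vconcat n (\<lambda>i. Y (Suc i) \<omega>) (\<lambda>i. Y (Suc n) \<omega>') i = ((path \<omega>)(n := Y (Suc n) \<omega>')) i"
      if "i < Suc n" for i \<omega> \<omega>'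
      using that by (auto simp: vconcat_def path_def)
    have p: "\<phi> (vconcat n (\<lambda>i. Y (Suc i) \<omega>) (\<lambda>i. Y (Suc n) \<omega>')) = \<phi> ((path \<omega>)(n := Y (Suc n) \<omega>'))" for \<omega> \<omega>'
      using v by (rule bdd_lip_cong[OF assms])
    have pp: "(path \<omega>)(n := Y (Suc n) \<omega>) = path \<omega>" for \<omega> by (auto simp: path_def)
    have "indep_rel E n (\<lambda>k. Y (Suc k)) 1 (\<lambda>k. Y (Suc n))"
      using Y_indep False unfolding indep_seq_def by (simp add: Suc_leI)
    moreover have "\<phi> \<in> C_b_Lip (n + 1)" using assms by (simp add: C_b_Lip_iff)
    ultimately have "E (\<lambda>\<omega>. \<phi> (path \<omega>)) = E (\<lambda>\<omega>. real_of_ereal (E (\<lambda>\<omega>'. \<phi> ((path \<omega>)(n := Y (Suc n) \<omega>')))))"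
      unfolding indep_rel_def by (auto simp: p pp)
    then show ?thesis unfolding E_path_def id by (simp add: expec_def)
  qed
qed

lemma E_path_indep:
  assumes A: "bdd_lip (vdist n) A" and B: "bdd_lip (vdist n) B" "\<And>x. 0 \<le> B x" and g: "bdd_lip rdist g"
  shows "E_path (\<lambda>x. A x + B x * g (x n)) = E_path (\<lambda>x. A x + B x * E_Y g)"
proof -
  have bdd_lip: "bdd_lip (vdist (Suc n)) (\<lambda>x. A x + B x * g (x n))"
    using A B g by (intro bdd_lip_intros) (auto intro: bdd_lip_vdist_mono)
  have inv: "A (x(n := t)) = A x" "B (x(n := t)) = B x" for x t
    by (intro bdd_lip_cong[OF A] bdd_lip_cong[OF B(1)]; simp)+
  have "E_path (\<lambda>x. A x + B x * g (x n)) = E_path (\<lambda>x. E_Y (\<lambda>t. A x + B x * g t))"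
    unfolding E_path_step[OF bdd_lip] by (simp add: inv)
  then show ?thesis using E_Y_affine[OF g B(2)] by simp
qed

text \<open>The block is integrated out from its last coordinate to its first. Each step preserves
  the affine form, because \<open>B\<close> is nonnegative and can be drawn out of
  \<open>E_Y\<close> by positive homogeneity.\<close>

lemma E_path_block:
  assumes A: "bdd_lip (vdist n) A" and B: "bdd_lip (vdist n) B" "\<And>x. 0 \<le> B x"
    and V: "bdd_lip (vdist (n + m)) V"
    and dep: "\<And>x y. (\<And>i. n \<le> i \<Longrightarrow> i < n + m \<Longrightarrow> x i = y i) \<Longrightarrow> V x = V y"
  shows "E_path (\<lambda>x. A x + B x * V x) = E_path (\<lambda>x. A x + B x * E_path V)"
  using V dep
proof (induction m arbitrary: V)
  case 0
  define c where "c = V (\<lambda>_. 0)"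
  have "V = (\<lambda>_. c)" unfolding c_def using 0(2) by (intro ext) auto
  then show ?case by simp
next
  case (Suc m)
  define V' where "V' x = E_Y (\<lambda>t. V (x(n + m := t)))" for x
  have blV: "bdd_lip (vdist (Suc (n + m))) V" using Suc.prems(1) by simp
  have V': "bdd_lip (vdist (n + m)) V'" unfolding V'_def by (rule bdd_lip_E_Y_upd[OF blV])
  have dep': "V' x = V' y" if "\<And>i. n \<le> i \<Longrightarrow> i < n + m \<Longrightarrow> x i = y i" for x y
    unfolding V'_def using that by (intro arg_cong[of _ _ E_Y] ext Suc.prems(2)) (auto simp: less_Suc_eq)
  have inv: "A (x(n + m := t)) = A x" "B (x(n + m := t)) = B x" for x t
    by (intro bdd_lip_cong[OF A] bdd_lip_cong[OF B(1)]; simp)+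
  have bdd_lip: "bdd_lip (vdist (Suc (n + m))) (\<lambda>x. A x + B x * V x)"
    using A B blV by (intro bdd_lip_intros) (auto intro: bdd_lip_vdist_mono)
  have "E_path (\<lambda>x. A x + B x * V x) = E_path (\<lambda>x. E_Y (\<lambda>t. A x + B x * V (x(n + m := t))))"
    unfolding E_path_step[OF bdd_lip] inv ..
  also have "\<dots> = E_path (\<lambda>x. A x + B x * V' x)"
    unfolding V'_def by (simp add: E_Y_affine[OF bdd_lip_fun_upd[OF blV] B(2)])
  also have "\<dots> = E_path (\<lambda>x. A x + B x * E_path V')" by (rule Suc.IH[OF V' dep'])
  also have "E_path V' = E_path V" unfolding V'_def by (rule E_path_step[OF blV, symmetric])
  finally show ?case .
qed

lemma E_path_prod:
  assumes g: "bdd_lip rdist g" "\<And>t. 0 \<le> g t"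
  shows "E_path (\<lambda>x. \<Prod>i<m. g (x (j + i))) = E_Y g ^ m"
proof (induction m)
  case (Suc m)
  have bP: "bdd_lip (vdist (j + m)) (\<lambda>x. \<Prod>i<m. g (x (j + i)))" using g by (intro bdd_lip_intros) auto
  have "E_path (\<lambda>x. \<Prod>i<Suc m. g (x (j + i))) = E_path (\<lambda>x. 0 + (\<Prod>i<m. g (x (j + i))) * g (x (j + m)))"
    by simp
  also have "\<dots> = E_path (\<lambda>x. 0 + (\<Prod>i<m. g (x (j + i))) * E_Y g)"
    using g by (intro E_path_indep bdd_lip_const bP prod_nonneg) auto
  also have "\<dots> = E_Y g * E_path (\<lambda>x. \<Prod>i<m. g (x (j + i)))"
  proof -
    have "0 \<le> E_Y g" using E_Y_mono[OF bdd_lip_const[of _ 0] g(1)] g(2) by simp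
    then show ?thesis using E_path_scale[OF bP, of "E_Y g"] by (simp add: mult.commute)
  qed
  finally show ?case using Suc by simp
qed simp

lemma cap_le_E_path:
  assumes "bdd_lip (vdist n) \<phi>" "\<And>\<omega>. \<omega> \<in> space M \<Longrightarrow> indicator A \<omega> \<le> \<phi> (path \<omega>)"
  shows "cap A \<le> E_path \<phi>"
  unfolding E_path_def using assms by (intro cap_le bdd_lip_path_Hb)

lemma path_measurable [measurable]: "(\<lambda>\<omega>. path \<omega> i) \<in> borel_measurable M"
  unfolding path_def by (intro H_measurable Y_H) auto

text \<open>The functional \<open>A\<close> below replaces the stopping argument of the classical maximal inequality:
  \<open>h\<close> vanishes unless the concave function \<open>min 1 (p / c)\<close> has already reached its maximum.\<close>

lemma maximal_inequality:
  assumes G: "bdd_lip rdist G" "\<And>t. 0 \<le> G t" "E_Y G \<le> 1" and c: "0 < c"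
  shows "cap {\<omega>\<in>space M. \<exists>m\<in>{1..N}. 2 * c \<le> (\<Prod>i<m. G (path \<omega> (j + i)))} \<le> 1 / c"
proof -
  define P where "P m x = (\<Prod>i<m. G (x (j + i)))" for m :: nat and x :: "nat \<Rightarrow> real"
  \<comment> \<open>A ramp that is 0 up to \<open>c\<close> and 1 from \<open>2 * c\<close> on; it
    replaces the indicator of the threshold and is the origin of the factor 2 in the
    statement.\<close>
  define h where "h p = max 0 (min 1 (p / c - 1))" for p
  define v where "v p = min 1 (p / c)" for p
  define Q where "Q m x = (\<Prod>k\<in>{1..m}. 1 - h (P k x))" for m x
  define A where "A m x = 1 - Q m x * (1 - v (P m x))" for m x
  have P0: "0 \<le> P m x" for m x unfolding P_def using G by (intro prod_nonneg) auto
  have h01: "0 \<le> h p" "h p \<le> 1" for p by (auto simp: h_def)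
  have Q01: "0 \<le> Q m x" "Q m x \<le> 1" for m x
    unfolding Q_def using h01 by (auto intro!: prod_nonneg prod_le_1)
  have blP: "bdd_lip (vdist n) (P m)" if "j + m \<le> n" for m n
    unfolding P_def using that G by (intro bdd_lip_intros) auto
  have blh: "bdd_lip (vdist n) (\<lambda>x. h (P m x))" and blv: "bdd_lip (vdist n) (\<lambda>x. v (P m x))" if "j + m \<le> n" for m n
    unfolding h_def v_def using that by (intro bdd_lip_intros blP; simp)+
  have blQ: "bdd_lip (vdist n) (Q m)" if "j + m \<le> n" for m n
    unfolding Q_def using that by (intro bdd_lip_intros blh) auto
  have blA: "bdd_lip (vdist n) (A m)" if "j + m \<le> n" for m n
    unfolding A_def using that by (intro bdd_lip_intros blQ blv)
  have step: "E_path (A (Suc m)) \<le> E_path (A m)" for m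
  proof -
    \<comment> \<open>If \<open>h p\<close> is positive then \<open>p\<close> exceeds
      \<open>c\<close>, where \<open>v p = 1\<close> and both sides vanish.\<close>
    have stop: "(1 - h p) * (1 - v p) = 1 - v p" for p
      using c by (auto simp: h_def v_def min_def max_def field_simps)
    define k where "k x t = v (P m x * G t)" for x t
    have "A (Suc m) x = 1 - Q m x + Q m x * v (P (Suc m) x)" for x
    proof -
      have "Q (Suc m) x * (1 - v (P (Suc m) x)) = Q m x * ((1 - h (P (Suc m) x)) * (1 - v (P (Suc m) x)))"
        by (simp add: Q_def mult.assoc)
      then show ?thesis unfolding stop by (simp add: A_def algebra_simps)
    qed
    then have AS: "A (Suc m) = (\<lambda>x. 1 - Q m x + Q m x * v (P (Suc m) x))" by auto
    have PS: "P (Suc m) (x(j + m := t)) = P m x * G t" for x t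
      unfolding P_def by (simp add: mult.commute)
    have PS': "P m (x(j + m := t)) = P m x" for x t unfolding P_def by simp
    have QS: "Q m (x(j + m := t)) = Q m x" for x t
      by (rule bdd_lip_cong[OF blQ[of m "j + m"]]) auto
    have "E_path (A (Suc m)) = E_path (\<lambda>x. E_Y (\<lambda>t. A (Suc m) (x(j + m := t))))"
      using E_path_step[of "j + m" "A (Suc m)"] blA[of "Suc m" "Suc (j + m)"] by simp
    also have "\<dots> \<le> E_path (A m)"
    proof (rule E_path_mono[OF bdd_lip_E_Y_upd blA])
      show "bdd_lip (vdist (Suc (j + m))) (A (Suc m))" by (rule blA) simp
      fix x
      have blG: "bdd_lip rdist (\<lambda>t. v (P m x * G t))" unfolding v_def using G by (intro bdd_lip_intros)
      have "E_Y (\<lambda>t. A (Suc m) (x(j + m := t))) = E_Y (\<lambda>t. (1 - Q m x) + Q m x * v (P m x * G t))"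
        unfolding AS PS QS ..
      also have "\<dots> = (1 - Q m x) + Q m x * E_Y (\<lambda>t. v (P m x * G t))"
        by (rule E_Y_affine[OF blG Q01(1)])
      \<comment> \<open>Jensen's inequality for a minimum of two affine functions: each of them
        bounds the expectation separately.\<close>
      also have "E_Y (\<lambda>t. v (P m x * G t)) \<le> v (P m x)"
      proof -
        have "E_Y (\<lambda>t. v (P m x * G t)) \<le> E_Y (\<lambda>t. P m x / c * G t)"
          using G by (intro E_Y_mono blG bdd_lip_intros) (auto simp: v_def)
        also have "\<dots> = P m x / c * E_Y G" using P0 c G by (intro E_Y_scale) auto
        also have "\<dots> \<le> P m x / c * 1" using P0 c G by (intro mult_left_mono) auto
        finally have "E_Y (\<lambda>t. v (P m x * G t)) \<le> P m x / c" by simp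
        moreover have "E_Y (\<lambda>t. v (P m x * G t)) \<le> E_Y (\<lambda>_. 1)"
          by (intro E_Y_mono blG bdd_lip_intros) (auto simp: v_def)
        ultimately show ?thesis by (simp add: v_def)
      qed
      then have "(1 - Q m x) + Q m x * E_Y (\<lambda>t. v (P m x * G t)) \<le> (1 - Q m x) + Q m x * v (P m x)"
        using Q01 by (intro add_left_mono mult_left_mono)
      also have "\<dots> = A m x" by (simp add: A_def algebra_simps)
      finally show "E_Y (\<lambda>t. A (Suc m) (x(j + m := t))) \<le> A m x" .
    qed simp
    finally show ?thesis .
  qed
  have "E_path (A m) \<le> 1 / c" for m
  proof (induction m)
    case 0
    have "A 0 = (\<lambda>_. v 1)" by (auto simp: A_def Q_def P_def)
    then show ?case by (simp add: v_def)
  next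
    case (Suc m) then show ?case using step[of m] by simp
  qed
  moreover have "cap {\<omega>\<in>space M. \<exists>m\<in>{1..N}. 2 * c \<le> (\<Prod>i<m. G (path \<omega> (j + i)))} \<le> E_path (A N)"
  proof (rule cap_le_E_path[OF blA[OF order_refl]])
    fix \<omega>
    have v01: "0 \<le> 1 - v (P N (path \<omega>))" "1 - v (P N (path \<omega>)) \<le> 1"
      using P0[of N "path \<omega>"] c by (auto simp: v_def)
    \<comment> \<open>One time at which the product reaches \<open>2 * c\<close> makes a factor of
      \<open>Q N\<close> zero, and this sets \<open>A N\<close> to 1 for good.\<close>
    have "Q N (path \<omega>) = 0" if "m \<in> {1..N}" "2 * c \<le> P m (path \<omega>)" for m
    proof -
      have "1 - h (P m (path \<omega>)) = 0" using that(2) c by (simp add: h_def field_simps)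
      then show ?thesis unfolding Q_def using that(1) by (intro prod_zero) auto
    qed
    then show "indicator {\<omega>\<in>space M. \<exists>m\<in>{1..N}. 2 * c \<le> (\<Prod>i<m. G (path \<omega> (j + i)))} \<omega> \<le> A N (path \<omega>)"
      using mult_le_one[OF Q01(2)[of N "path \<omega>"] v01] by (auto simp: indicator_def A_def P_def)
  qed
  ultimately show ?thesis by (meson order_trans)
qed

end

subsection \<open>Exponential inequalities\<close>

lemma exp_taylor2_bound:
  fixes u :: real
  shows "\<bar>exp u - (1 + u + u\<^sup>2 / 2)\<bar> \<le> \<bar>u\<bar> ^ 3 / 6 * exp \<bar>u\<bar>"
proof -
  obtain t where t: "\<bar>t\<bar> \<le> \<bar>u\<bar>" "exp u = (\<Sum>m<3. u ^ m / fact m) + exp t / fact 3 * u ^ 3"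
    using Maclaurin_exp_le[of u 3] by blast
  have "exp u - (1 + u + u\<^sup>2 / 2) = exp t / 6 * u ^ 3"
    unfolding t(2) by (simp add: numeral_3_eq_3 fact_numeral power2_eq_square)
  then have "\<bar>exp u - (1 + u + u\<^sup>2 / 2)\<bar> = \<bar>u\<bar> ^ 3 / 6 * exp t"
    by (simp only: abs_mult power_abs) simp
  also have "\<dots> \<le> \<bar>u\<bar> ^ 3 / 6 * exp \<bar>u\<bar>" using t(1) by (intro mult_left_mono) auto
  finally show ?thesis .
qed

lemma cube_le_exp: fixes z :: real assumes z: "0 \<le> z" shows "z ^ 3 / 6 \<le> exp z"
proof -
  obtain t where t: "exp z = (\<Sum>m<4. z ^ m / fact m) + exp t / fact 4 * z ^ 4"
    using Maclaurin_exp_le[of z 4] by blast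
  have "0 \<le> exp t / fact 4 * z ^ 4" using z by simp
  then show ?thesis unfolding t using z by (simp add: numeral_eq_Suc fact_numeral)
qed

locale lil_sequence = iid_sequence M H E Y
  for M :: "'a measure" and H :: "('a \<Rightarrow> real) set" and E :: "('a \<Rightarrow> real) \<Rightarrow> ereal"
    and Y :: "nat \<Rightarrow> 'a \<Rightarrow> real" +
  fixes \<sigma>2 :: real
  assumes mean_upper: "has_trunc_expectation E (Y 1) 0"
    and mean_lower: "has_trunc_expectation E (\<lambda>\<omega>. - Y 1 \<omega>) 0"
    and variance: "has_trunc_expectation E (\<lambda>\<omega>. (Y 1 \<omega>)\<^sup>2) (ereal \<sigma>2)"
    and choquet_finite: "choquet M H E (\<lambda>\<omega>. (Y 1 \<omega>)\<^sup>2 / llog (llog \<bar>Y 1 \<omega>\<bar>)) < \<infinity>"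
begin

text \<open>The truncated third moment E[(|Y| min y)^3] / y^3. It dominates the capacity of |Y|
  \<ge> y (\<open>cap_path_ge\<close>) and is also the third-order error in the exponential
  moments.\<close>

definition cube_tail :: "real \<Rightarrow> real" where "cube_tail y = E_Y (\<lambda>t. (\<bar>clip y t\<bar> / y) ^ 3)"

lemma bdd_lip_cube_tail: "bdd_lip rdist (\<lambda>t. (\<bar>clip y t\<bar> / y) ^ 3)"
  by (intro bdd_lip_intros)

lemma cube_tail_nonneg: "0 < y \<Longrightarrow> 0 \<le> cube_tail y"
  unfolding cube_tail_def using E_Y_mono[OF bdd_lip_const[of _ 0] bdd_lip_cube_tail[of y]] by simp

lemma E_Y_finite: "bdd_lip rdist g \<Longrightarrow> E (\<lambda>\<omega>. g (Y 1 \<omega>)) = ereal (E_Y g)"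
  unfolding E_Y_def by (intro E_finite bdd_lip_Y_Hb) auto

lemma E_Y_clip_tendsto: "((\<lambda>c. E_Y (clip c)) \<longlongrightarrow> 0) at_top"
proof -
  have "((\<lambda>c. ereal (E_Y (clip c))) \<longlongrightarrow> ereal 0) at_top"
    using mean_upper unfolding has_trunc_expectation_def trunc_def zero_ereal_def
    by (simp add: E_Y_finite[OF bdd_lip_clip, symmetric] clip_def)
  then show ?thesis by simp
qed

lemma E_Y_minus_clip_tendsto: "((\<lambda>c. E_Y (\<lambda>t. - clip c t)) \<longlongrightarrow> 0) at_top"
proof -
  have "\<forall>\<^sub>F c in at_top. E (trunc c (\<lambda>\<omega>. - Y 1 \<omega>)) = ereal (E_Y (\<lambda>t. - clip c t))"
    using eventually_ge_at_top[of 0]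
  proof eventually_elim
    case (elim c)
    have "trunc c (\<lambda>\<omega>. - Y 1 \<omega>) = (\<lambda>\<omega>. - clip c (Y 1 \<omega>))"
      using clip_minus[OF elim] by (simp add: trunc_def clip_def fun_eq_iff)
    then show ?case using E_Y_finite[OF bdd_lip_uminus[OF bdd_lip_clip], of c] by simp
  qed
  then have "((\<lambda>c. ereal (E_Y (\<lambda>t. - clip c t))) \<longlongrightarrow> ereal 0) at_top"
    using mean_lower unfolding has_trunc_expectation_def zero_ereal_def
    by (rule Lim_transform_eventually[rotated])
  then show ?thesis by simp
qed

lemma E_Y_clip2_tendsto: "((\<lambda>y. E_Y (\<lambda>t. (clip y t)\<^sup>2)) \<longlongrightarrow> \<sigma>2) at_top"
proof -
  \<comment> \<open>Truncating Y^2 at the level y^2 is the same as squaring \<open>clip y Y\<close>,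
    so the limit is taken along squares.\<close>
  have lim: "LIM y at_top. y\<^sup>2 :> (at_top :: real filter)"
    by (intro filterlim_pow_at_top filterlim_ident) auto
  have "((\<lambda>y. E (trunc (y\<^sup>2) (\<lambda>\<omega>. (Y 1 \<omega>)\<^sup>2))) \<longlongrightarrow> ereal \<sigma>2) at_top"
    using filterlim_compose[OF variance[unfolded has_trunc_expectation_def] lim] .
  moreover have "\<forall>\<^sub>F y in at_top. E (trunc (y\<^sup>2) (\<lambda>\<omega>. (Y 1 \<omega>)\<^sup>2)) = ereal (E_Y (\<lambda>t. (clip y t)\<^sup>2))"
    using eventually_ge_at_top[of 0]
  proof eventually_elim
    case (elim y)
    have "max (- y\<^sup>2) (min (t\<^sup>2) (y\<^sup>2)) = (clip y t)\<^sup>2" for t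
    proof -
      have "(clip y t)\<^sup>2 = (min \<bar>t\<bar> y)\<^sup>2" using abs_clip[OF elim, of t] by (metis power2_abs)
      moreover have "(min \<bar>t\<bar> y)\<^sup>2 = min (t\<^sup>2) (y\<^sup>2)"
        using elim abs_le_square_iff[of t y] by (auto simp: min_def)
      moreover have "max (- y\<^sup>2) (min (t\<^sup>2) (y\<^sup>2)) = min (t\<^sup>2) (y\<^sup>2)"
        by (intro max_absorb2) (simp add: min_def order_trans[OF _ zero_le_power2])
      ultimately show ?thesis by simp
    qed
    then show ?case using E_Y_finite[OF bdd_lip_power[OF bdd_lip_clip], of y 2] unfolding trunc_def by simp
  qed
  ultimately have "((\<lambda>y. ereal (E_Y (\<lambda>t. (clip y t)\<^sup>2))) \<longlongrightarrow> ereal \<sigma>2) at_top"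
    by (rule Lim_transform_eventually)
  then show ?thesis by simp
qed

lemma E_Y_clip2_le: assumes "0 \<le> y" shows "E_Y (\<lambda>t. (clip y t)\<^sup>2) \<le> \<sigma>2"
proof (rule tendsto_lowerbound[OF E_Y_clip2_tendsto])
  show "\<forall>\<^sub>F c in at_top. E_Y (\<lambda>t. (clip y t)\<^sup>2) \<le> E_Y (\<lambda>t. (clip c t)\<^sup>2)"
    using eventually_ge_at_top[of y]
  proof eventually_elim
    case (elim c)
    show ?case
    proof (intro E_Y_mono bdd_lip_intros)
      fix t
      have "\<bar>clip y t\<bar> \<le> \<bar>clip c t\<bar>" using assms elim by (simp add: abs_clip)
      then show "(clip y t)\<^sup>2 \<le> (clip c t)\<^sup>2" by (simp add: abs_le_square_iff)
    qed
  qed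
qed auto

lemma \<sigma>2_nonneg: "0 \<le> \<sigma>2"
  using E_Y_clip2_le[of 0] by (simp add: clip_def)

text \<open>The mean hypotheses speak of the limit only. For \<open>y \<le> c\<close> the functions
  \<open>clip y\<close> and \<open>clip c\<close> differ only where |Y| > y, and there by at most
  \<open>(clip c t)\<^sup>2 / y\<close>; the second moment thus bounds the cost of lowering the
  level from \<open>c\<close> to \<open>y\<close>.\<close>

lemma E_Y_clip_le:
  assumes y: "0 < y" shows "E_Y (clip y) \<le> \<sigma>2 / y" "E_Y (\<lambda>t. - clip y t) \<le> \<sigma>2 / y"
proof -
  have pw: "\<bar>clip y t - clip c t\<bar> \<le> 1 / y * (clip c t)\<^sup>2" if c: "y \<le> c" for c t
  proof (cases "\<bar>t\<bar> \<le> y")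
    case False
    define m where "m = \<bar>clip c t\<bar>"
    have m: "y \<le> m" using False y c by (simp add: m_def abs_clip)
    have "\<bar>clip y t - clip c t\<bar> = m - y"
    proof (cases "0 \<le> t")
      case True
      then have "clip y t = y" "clip c t = min t c" "y \<le> min t c" using False y c by (auto simp: clip_def)
      then show ?thesis using y by (simp add: m_def)
    next
      case neg: False
      then have "clip y t = - y" "clip c t = - min (- t) c" "y \<le> min (- t) c"
        using False y c by (auto simp: clip_def min_def max_def)
      then show ?thesis using y by (simp add: m_def)
    qed
    moreover have "y * m \<le> m\<^sup>2" using m y by (simp add: power2_eq_square)
    then have "m \<le> 1 / y * m\<^sup>2" using y by (simp add: field_simps)
    ultimately show ?thesis using y by (simp add: m_def)
  qed (use y c in \<open>simp add: clip_def\<close>)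
  have "E_Y (clip y) \<le> E_Y (clip c) + \<sigma>2 / y" "E_Y (\<lambda>t. - clip y t) \<le> E_Y (\<lambda>t. - clip c t) + \<sigma>2 / y"
    if c: "y \<le> c" for c
  proof -
    have v: "E_Y (\<lambda>t. 1 / y * (clip c t)\<^sup>2) \<le> \<sigma>2 / y"
      using E_Y_scale[OF bdd_lip_power[OF bdd_lip_clip], of "1 / y" c 2] E_Y_clip2_le[of c] y c by (simp add: field_simps)
    have "E_Y (clip y) \<le> E_Y (\<lambda>t. clip c t + 1 / y * (clip c t)\<^sup>2)"
      by (intro E_Y_mono bdd_lip_intros) (use pw[OF c] in \<open>auto simp: abs_le_iff algebra_simps\<close>)
    also have "\<dots> \<le> E_Y (clip c) + E_Y (\<lambda>t. 1 / y * (clip c t)\<^sup>2)" by (intro E_Y_add_le bdd_lip_intros)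
    finally show "E_Y (clip y) \<le> E_Y (clip c) + \<sigma>2 / y" using v by simp
    have "E_Y (\<lambda>t. - clip y t) \<le> E_Y (\<lambda>t. - clip c t + 1 / y * (clip c t)\<^sup>2)"
      by (intro E_Y_mono bdd_lip_intros) (use pw[OF c] in \<open>auto simp: abs_le_iff algebra_simps\<close>)
    also have "\<dots> \<le> E_Y (\<lambda>t. - clip c t) + E_Y (\<lambda>t. 1 / y * (clip c t)\<^sup>2)" by (intro E_Y_add_le bdd_lip_intros)
    finally show "E_Y (\<lambda>t. - clip y t) \<le> E_Y (\<lambda>t. - clip c t) + \<sigma>2 / y" using v by simp
  qed
  then have ev: "\<forall>\<^sub>F c in at_top. E_Y (clip y) \<le> E_Y (clip c) + \<sigma>2 / y"
    "\<forall>\<^sub>F c in at_top. E_Y (\<lambda>t. - clip y t) \<le> E_Y (\<lambda>t. - clip c t) + \<sigma>2 / y"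
    by (auto intro: eventually_mono[OF eventually_ge_at_top[of y]])
  have "E_Y (clip y) \<le> 0 + \<sigma>2 / y"
    by (rule tendsto_lowerbound[OF tendsto_add[OF E_Y_clip_tendsto tendsto_const] ev(1)]) simp
  then show "E_Y (clip y) \<le> \<sigma>2 / y" by simp
  have "E_Y (\<lambda>t. - clip y t) \<le> 0 + \<sigma>2 / y"
    by (rule tendsto_lowerbound[OF tendsto_add[OF E_Y_minus_clip_tendsto tendsto_const] ev(2)]) simp
  then show "E_Y (\<lambda>t. - clip y t) \<le> \<sigma>2 / y" by simp
qed

lemma E_Y_scaled_clip_le: assumes y: "0 < y" shows "E_Y (\<lambda>t. l * clip y t) \<le> \<bar>l\<bar> * (\<sigma>2 / y)"
proof (cases "0 \<le> l")
  case True
  then show ?thesis using E_Y_scale[OF bdd_lip_clip, of l y] mult_left_mono[OF E_Y_clip_le(1)[OF y], of l] by simp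
next
  case False
  then show ?thesis
    using E_Y_scale[OF bdd_lip_uminus[OF bdd_lip_clip], of "- l" y] mult_left_mono[OF E_Y_clip_le(2)[OF y], of "- l"] by simp
qed

text \<open>With z = |l| y the Taylor remainder is (z^3 / 6) exp(z) times the integrand of
  \<open>cube_tail\<close>. The bound z^3 / 6 \<le> exp(z) absorbs the polynomial factor and
  produces the exponent 2 z.\<close>

lemma mgf_remainder:
  assumes y: "0 < y"
  shows "\<bar>exp (l * clip y t) - (1 + l * clip y t + l\<^sup>2 / 2 * (clip y t)\<^sup>2)\<bar> \<le> exp (2 * \<bar>l\<bar> * y) * (\<bar>clip y t\<bar> / y) ^ 3"
proof -
  define u where "u = l * clip y t"
  define z where "z = \<bar>l\<bar> * y"
  have z: "0 \<le> z" using y by (simp add: z_def)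
  have u: "\<bar>u\<bar> = z * (\<bar>clip y t\<bar> / y)" using y by (simp add: u_def z_def abs_mult)
  have w: "\<bar>clip y t\<bar> / y \<le> 1" "0 \<le> \<bar>clip y t\<bar> / y" using abs_clip_le[of y t] y by auto
  then have uz: "\<bar>u\<bar> \<le> z" unfolding u using z by (metis mult_left_mono mult.right_neutral)
  have "\<bar>exp u - (1 + u + u\<^sup>2 / 2)\<bar> \<le> \<bar>u\<bar> ^ 3 / 6 * exp \<bar>u\<bar>" by (rule exp_taylor2_bound)
  also have "\<dots> \<le> \<bar>u\<bar> ^ 3 / 6 * exp z" using uz by (intro mult_left_mono) auto
  also have "\<dots> = (z ^ 3 / 6) * exp z * (\<bar>clip y t\<bar> / y) ^ 3"
    unfolding u power_mult_distrib by simp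
  also have "\<dots> \<le> exp z * exp z * (\<bar>clip y t\<bar> / y) ^ 3"
    using cube_le_exp[OF z] w by (intro mult_right_mono) auto
  also have "exp z * exp z = exp (2 * \<bar>l\<bar> * y)" by (simp add: z_def flip: exp_add)
  finally show ?thesis by (simp add: u_def power_mult_distrib)
qed

lemma mgf_upper:
  assumes y: "0 < y"
  shows "E_Y (\<lambda>t. exp (l * clip y t)) \<le> exp (\<bar>l\<bar> * (\<sigma>2 / y) + l\<^sup>2 / 2 * \<sigma>2 + exp (2 * \<bar>l\<bar> * y) * cube_tail y)"
proof -
  let ?C = "exp (2 * \<bar>l\<bar> * y)"
  have "E_Y (\<lambda>t. exp (l * clip y t)) \<le> E_Y (\<lambda>t. ((l * clip y t + l\<^sup>2 / 2 * (clip y t)\<^sup>2) + ?C * (\<bar>clip y t\<bar> / y) ^ 3) + 1)"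
  proof (intro E_Y_mono bdd_lip_intros)
    fix t show "exp (l * clip y t) \<le> ((l * clip y t + l\<^sup>2 / 2 * (clip y t)\<^sup>2) + ?C * (\<bar>clip y t\<bar> / y) ^ 3) + 1"
      using mgf_remainder[OF y, of l t] by linarith
  qed
  also have "\<dots> = E_Y (\<lambda>t. (l * clip y t + l\<^sup>2 / 2 * (clip y t)\<^sup>2) + ?C * (\<bar>clip y t\<bar> / y) ^ 3) + 1"
    by (intro E_Y_add_const bdd_lip_intros)
  also have "E_Y (\<lambda>t. (l * clip y t + l\<^sup>2 / 2 * (clip y t)\<^sup>2) + ?C * (\<bar>clip y t\<bar> / y) ^ 3)
      \<le> E_Y (\<lambda>t. l * clip y t + l\<^sup>2 / 2 * (clip y t)\<^sup>2) + E_Y (\<lambda>t. ?C * (\<bar>clip y t\<bar> / y) ^ 3)"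
    by (intro E_Y_add_le bdd_lip_intros)
  also have "E_Y (\<lambda>t. l * clip y t + l\<^sup>2 / 2 * (clip y t)\<^sup>2) \<le> E_Y (\<lambda>t. l * clip y t) + E_Y (\<lambda>t. l\<^sup>2 / 2 * (clip y t)\<^sup>2)"
    by (intro E_Y_add_le bdd_lip_intros)
  also have "E_Y (\<lambda>t. l\<^sup>2 / 2 * (clip y t)\<^sup>2) = l\<^sup>2 / 2 * E_Y (\<lambda>t. (clip y t)\<^sup>2)" by (intro E_Y_scale bdd_lip_intros) auto
  also have "\<dots> \<le> l\<^sup>2 / 2 * \<sigma>2" using E_Y_clip2_le y by (intro mult_left_mono) auto
  also have "E_Y (\<lambda>t. ?C * (\<bar>clip y t\<bar> / y) ^ 3) = ?C * cube_tail y" unfolding cube_tail_def by (intro E_Y_scale bdd_lip_intros) auto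
  also have "E_Y (\<lambda>t. l * clip y t) \<le> \<bar>l\<bar> * (\<sigma>2 / y)" by (rule E_Y_scaled_clip_le[OF y])
  finally have "E_Y (\<lambda>t. exp (l * clip y t)) \<le> 1 + (\<bar>l\<bar> * (\<sigma>2 / y) + l\<^sup>2 / 2 * \<sigma>2 + ?C * cube_tail y)" by simp
  also have "\<dots> \<le> exp (\<bar>l\<bar> * (\<sigma>2 / y) + l\<^sup>2 / 2 * \<sigma>2 + ?C * cube_tail y)" by (rule exp_ge_add_one_self)
  finally show ?thesis .
qed

text \<open>Sub-additivity gives only upper bounds. Therefore the quadratic expression is dominated
  pointwise by the exponential plus corrections, and the expectations of the corrections are moved
  to the other side afterwards.\<close>

lemma mgf_lower:
  assumes y: "0 < y"
  shows "1 + l\<^sup>2 / 2 * E_Y (\<lambda>t. (clip y t)\<^sup>2) - \<bar>l\<bar> * (\<sigma>2 / y) - exp (2 * \<bar>l\<bar> * y) * cube_tail y \<le> E_Y (\<lambda>t. exp (l * clip y t))"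
proof -
  let ?C = "exp (2 * \<bar>l\<bar> * y)"
  have "1 + l\<^sup>2 / 2 * E_Y (\<lambda>t. (clip y t)\<^sup>2) = E_Y (\<lambda>t. 1 + l\<^sup>2 / 2 * (clip y t)\<^sup>2)"
    by (intro E_Y_affine[symmetric] bdd_lip_intros) auto
  also have "\<dots> \<le> E_Y (\<lambda>t. (exp (l * clip y t) + (- l) * clip y t) + ?C * (\<bar>clip y t\<bar> / y) ^ 3)"
  proof (intro E_Y_mono bdd_lip_intros)
    fix t show "1 + l\<^sup>2 / 2 * (clip y t)\<^sup>2 \<le> (exp (l * clip y t) + (- l) * clip y t) + ?C * (\<bar>clip y t\<bar> / y) ^ 3"
      using mgf_remainder[OF y, of l t] by linarith
  qed
  also have "\<dots> \<le> E_Y (\<lambda>t. exp (l * clip y t) + (- l) * clip y t) + E_Y (\<lambda>t. ?C * (\<bar>clip y t\<bar> / y) ^ 3)"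
    by (intro E_Y_add_le bdd_lip_intros)
  also have "E_Y (\<lambda>t. exp (l * clip y t) + (- l) * clip y t) \<le> E_Y (\<lambda>t. exp (l * clip y t)) + E_Y (\<lambda>t. (- l) * clip y t)"
    by (intro E_Y_add_le bdd_lip_intros)
  also have "E_Y (\<lambda>t. ?C * (\<bar>clip y t\<bar> / y) ^ 3) = ?C * cube_tail y" unfolding cube_tail_def by (intro E_Y_scale bdd_lip_intros) auto
  also have "E_Y (\<lambda>t. (- l) * clip y t) \<le> \<bar>- l\<bar> * (\<sigma>2 / y)" by (rule E_Y_scaled_clip_le[OF y])
  finally show ?thesis by simp
qed

lemma E_path_coord: assumes "bdd_lip rdist g" shows "E_path (\<lambda>x. g (x k)) = E_Y g"
proof -
  have "E_path (\<lambda>x. 0 + 1 * g (x k)) = E_path (\<lambda>x. 0 + 1 * E_Y g)"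
    by (intro E_path_indep[of k] bdd_lip_const assms zero_le_one)
  then show ?thesis by simp
qed

lemma cap_path_ge: assumes "0 < y" shows "cap {\<omega>\<in>space M. y \<le> \<bar>path \<omega> k\<bar>} \<le> cube_tail y"
proof -
  have "cap {\<omega>\<in>space M. y \<le> \<bar>path \<omega> k\<bar>} \<le> E_path (\<lambda>x. (\<bar>clip y (x k)\<bar> / y) ^ 3)"
  proof (rule cap_le_E_path)
    show "bdd_lip (vdist (Suc k)) (\<lambda>x. (\<bar>clip y (x k)\<bar> / y) ^ 3)" by (intro bdd_lip_intros) auto
    show "indicator {\<omega>\<in>space M. y \<le> \<bar>path \<omega> k\<bar>} \<omega> \<le> (\<bar>clip y (path \<omega> k)\<bar> / y) ^ 3" for \<omega>
    proof (cases "y \<le> \<bar>path \<omega> k\<bar>")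
      case True
      then have "\<bar>clip y (path \<omega> k)\<bar> / y = 1" using assms by (simp add: abs_clip)
      then show ?thesis by (simp add: indicator_def)
    qed (use assms in \<open>simp add: indicator_def\<close>)
  qed
  also have "\<dots> = cube_tail y" unfolding cube_tail_def by (rule E_path_coord[OF bdd_lip_cube_tail])
  finally show ?thesis .
qed

text \<open>Dividing exp(l s clip(Y)) by the bound exp(k) on its mean gives a factor
  \<open>G\<close> with \<open>E_Y G \<le> 1\<close>, to which the maximal inequality applies. The
  sign \<open>s\<close> covers both tails, and m k is replaced by N k.\<close>

lemma cap_max_exponential:
  assumes y: "0 < y" and s: "\<bar>s\<bar> = (1::real)" and l: "0 < l"
  shows "cap {\<omega>\<in>space M. \<exists>m\<in>{1..N}. X \<le> s * (\<Sum>i<m. clip y (path \<omega> (j + i)))}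
    \<le> 2 * exp (- l * X + real N * (l * (\<sigma>2 / y) + l\<^sup>2 / 2 * \<sigma>2 + exp (2 * l * y) * cube_tail y))"
proof -
  define k where "k = l * (\<sigma>2 / y) + l\<^sup>2 / 2 * \<sigma>2 + exp (2 * l * y) * cube_tail y"
  have k: "0 \<le> k"
    unfolding k_def using y l \<sigma>2_nonneg cube_tail_nonneg[OF y]
    by (intro add_nonneg_nonneg mult_nonneg_nonneg divide_nonneg_nonneg) auto
  define G where "G t = exp (- k) * exp ((l * s) * clip y t)" for t
  \<comment> \<open>Half the exponential threshold, because the maximal inequality is stated for
    \<open>2 * c\<close>.\<close>
  define c where "c = exp (l * X - real N * k) / 2"
  have ls: "\<bar>l * s\<bar> = l" using s l by (simp add: abs_mult)
  then have ls2: "(l * s)\<^sup>2 = l\<^sup>2" by (metis power2_abs)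
  have blG: "bdd_lip rdist G" unfolding G_def by (intro bdd_lip_intros)
  have "E_Y G = exp (- k) * E_Y (\<lambda>t. exp ((l * s) * clip y t))"
    unfolding G_def by (intro E_Y_scale bdd_lip_intros) simp
  also have "\<dots> \<le> exp (- k) * exp k"
    using mgf_upper[OF y, of "l * s"] unfolding ls ls2 k_def[symmetric] by (intro mult_left_mono) auto
  finally have G1: "E_Y G \<le> 1" by (simp flip: exp_add)
  have prod: "(\<Prod>i<m. G (x (j + i))) = exp (l * (s * (\<Sum>i<m. clip y (x (j + i)))) - real m * k)" for m and x :: "nat \<Rightarrow> real"
  proof -
    have "(\<Prod>i<m. G (x (j + i))) = (\<Prod>i<m. exp ((l * s) * clip y (x (j + i)))) * exp (- k) ^ m"
      by (simp add: G_def prod.distrib mult.commute)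
    also have "\<dots> = exp ((\<Sum>i<m. (l * s) * clip y (x (j + i))) + real m * (- k))"
      by (simp only: exp_sum[OF finite_lessThan] exp_of_nat_mult exp_add)
    also have "(\<Sum>i<m. (l * s) * clip y (x (j + i))) = l * (s * (\<Sum>i<m. clip y (x (j + i))))"
      by (simp only: sum_distrib_left mult.assoc)
    finally show ?thesis by simp
  qed
  have "cap {\<omega>\<in>space M. \<exists>m\<in>{1..N}. X \<le> s * (\<Sum>i<m. clip y (path \<omega> (j + i)))}
      \<le> cap {\<omega>\<in>space M. \<exists>m\<in>{1..N}. 2 * c \<le> (\<Prod>i<m. G (path \<omega> (j + i)))}"
  proof (rule cap_mono, clarsimp)
    fix \<omega> m assume m: "Suc 0 \<le> m" "m \<le> N" "X \<le> s * (\<Sum>i<m. clip y (path \<omega> (j + i)))"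
    have "l * X \<le> l * (s * (\<Sum>i<m. clip y (path \<omega> (j + i))))" using m(3) l by simp
    moreover have "real m * k \<le> real N * k" using m(2) k by (intro mult_right_mono) auto
    ultimately have "2 * c \<le> (\<Prod>i<m. G (path \<omega> (j + i)))" unfolding prod c_def by simp
    then show "\<exists>m\<in>{Suc 0..N}. 2 * c \<le> (\<Prod>i<m. G (path \<omega> (j + i)))" using m by auto
  qed
  also have "\<dots> \<le> 1 / c" by (rule maximal_inequality[OF blG _ G1]) (simp_all add: G_def c_def)
  also have "1 / c = 2 * inverse (exp (l * X - real N * k))" unfolding c_def by (simp only: inverse_eq_divide) simp
  also have "\<dots> = 2 * exp (- (l * X - real N * k))" by (simp only: exp_minus)
  finally show ?thesis by (simp add: k_def)
qed

text \<open>A Fuk--Nagaev inequality. The tilting parameter is \<open>X / B\<close>, lowered when the third moment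
  term would become larger than one.\<close>

lemma fuk_nagaev_truncated:
  assumes \<delta>: "0 < \<delta>" "\<delta> \<le> 1/4" and X: "0 < X" and B: "0 < B" "real N * \<sigma>2 \<le> B" and s: "\<bar>s\<bar> = (1::real)"
  shows "cap {\<omega>\<in>space M. \<exists>m\<in>{1..N}. X \<le> s * (\<Sum>i<m. clip (\<delta> * X) (path \<omega> (j + i)))}
    \<le> 2 * exp (1 + 1 / \<delta>) * (exp (- X\<^sup>2 / (2 * B)) + real N * cube_tail (\<delta> * X))"
    (is "?cap \<le> _")
proof -
  define y where "y = \<delta> * X"
  define \<gamma> where "\<gamma> = real N * cube_tail y"
  have y: "0 < y" using \<delta> X by (simp add: y_def)
  have \<gamma>: "0 \<le> \<gamma>" using cube_tail_nonneg[OF y] by (simp add: \<gamma>_def)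
  have C: "1 \<le> 2 * exp (1 + 1 / \<delta>)" using \<delta> exp_ge_add_one_self[of "1 + 1 / \<delta>"]
    by (smt (verit) divide_pos_pos)
  \<comment> \<open>The bound \<open>l \<le> X / B\<close> turns the truncation bias of the mean
    into \<open>1 / \<delta>\<close>; the third-moment term contributes at most 1; the Gaussian
    exponent is left over.\<close>
  have main: "?cap \<le> 2 * exp (1 + 1 / \<delta> + (- l * X + l\<^sup>2 / 2 * B))"
    if l: "0 < l" "l \<le> X / B" "\<gamma> * exp (2 * l * y) \<le> 1" for l
  proof -
    have "?cap \<le> 2 * exp (- l * X + real N * (l * (\<sigma>2 / y) + l\<^sup>2 / 2 * \<sigma>2 + exp (2 * l * y) * cube_tail y))"
      using cap_max_exponential[OF y s l(1)] by (simp add: y_def)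
    also have "\<dots> \<le> 2 * exp (1 + 1 / \<delta> + (- l * X + l\<^sup>2 / 2 * B))"
    proof -
      have "real N * (l * (\<sigma>2 / y)) = l / y * (real N * \<sigma>2)" by simp
      also have "\<dots> \<le> (X / B) / y * B"
        using l B y X \<sigma>2_nonneg by (intro mult_mono divide_right_mono) auto
      also have "\<dots> = 1 / \<delta>" using B X by (simp add: y_def)
      finally have 1: "real N * (l * (\<sigma>2 / y)) \<le> 1 / \<delta>" .
      have 2: "real N * (l\<^sup>2 / 2 * \<sigma>2) \<le> l\<^sup>2 / 2 * B"
        using mult_left_mono[OF B(2), of "l\<^sup>2 / 2"] by (simp add: algebra_simps)
      have 3: "real N * (exp (2 * l * y) * cube_tail y) \<le> 1" using l(3) by (simp add: \<gamma>_def algebra_simps)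
      have "real N * (l * (\<sigma>2 / y) + l\<^sup>2 / 2 * \<sigma>2 + exp (2 * l * y) * cube_tail y)
        = real N * (l * (\<sigma>2 / y)) + real N * (l\<^sup>2 / 2 * \<sigma>2) + real N * (exp (2 * l * y) * cube_tail y)"
        by (simp add: algebra_simps)
      then show ?thesis using 1 2 3 by simp
    qed
    finally show ?thesis .
  qed
  show ?thesis
  proof (cases "\<gamma> * exp (2 * (X / B) * y) \<le> 1")
    case True
    have "- (X / B) * X + (X / B)\<^sup>2 / 2 * B = - X\<^sup>2 / (2 * B)"
      using B by (simp add: field_simps power2_eq_square)
    then have "?cap \<le> 2 * exp (1 + 1 / \<delta> + - X\<^sup>2 / (2 * B))"
      using main[of "X / B"] True X B by simp
    also have "\<dots> = 2 * exp (1 + 1 / \<delta>) * exp (- X\<^sup>2 / (2 * B))"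
      by (simp only: exp_add mult.assoc)
    also have "\<dots> \<le> 2 * exp (1 + 1 / \<delta>) * (exp (- X\<^sup>2 / (2 * B)) + \<gamma>)"
      using \<gamma> by (intro mult_left_mono) auto
    finally show ?thesis by (simp add: \<gamma>_def y_def)
  next
    case False
    have cap\<gamma>: "?cap \<le> 2 * exp (1 + 1 / \<delta>) * \<gamma>"
    proof (cases "1 \<le> \<gamma>")
      case True
      have "1 * 1 \<le> 2 * exp (1 + 1 / \<delta>) * \<gamma>" using C True by (intro mult_mono) auto
      then show ?thesis using upper_cap_eq(3) by (smt (verit))
    next
      case \<gamma>1: False
      have \<gamma>0: "0 < \<gamma>" using False \<gamma> by (cases "\<gamma> = 0") auto
      define L where "L = - ln \<gamma>"
      have L: "0 < L" using \<gamma>0 \<gamma>1 by (simp add: L_def)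
      have \<gamma>L: "\<gamma> = exp (- L)" using \<gamma>0 by (simp add: L_def)
      \<comment> \<open>The largest tilt that keeps the third-moment term at 1: with this
        \<open>l\<close> the product of \<open>\<gamma>\<close> and \<open>exp (2 * l * y)\<close>
        equals 1.\<close>
      define l where "l = L / (2 * y)"
      have l0: "0 < l" using L y by (simp add: l_def)
      have "1 < exp (2 * (X / B) * y - L)" using False by (simp add: \<gamma>L not_le mult.commute flip: exp_add)
      then have "L < 2 * (X / B) * y" by simp
      then have lX: "l \<le> X / B" using y by (simp add: l_def field_simps)
      have e1: "\<gamma> * exp (2 * l * y) \<le> 1" using y by (simp add: \<gamma>L l_def flip: exp_add)
      have "l\<^sup>2 / 2 * B \<le> l * X / 2"
        using mult_left_mono[OF lX, of "l * B / 2"] l0 B by (simp add: power2_eq_square field_simps)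
      then have "- l * X + l\<^sup>2 / 2 * B \<le> - (l * X / 2)" by simp
      \<comment> \<open>Here \<open>\<delta> \<le> 1/4\<close> is used: it makes the gain in the
        exponent at least \<open>L\<close>, so that the bound is a multiple of
        \<open>\<gamma>\<close>.\<close>
      also have "l * X / 2 = L * (1 / (4 * \<delta>))" using X \<delta> by (simp add: l_def y_def field_simps)
      also have "- (L * (1 / (4 * \<delta>))) \<le> - (L * 1)"
        using L \<delta> by (intro le_imp_neg_le mult_left_mono) (auto simp: field_simps)
      finally have "exp (1 + 1 / \<delta> + (- l * X + l\<^sup>2 / 2 * B)) \<le> exp (1 + 1 / \<delta> + - L)" by simp
      also have "\<dots> = exp (1 + 1 / \<delta>) * \<gamma>" unfolding \<gamma>L exp_add ..
      finally show ?thesis using main[OF l0 lX e1] by simp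
    qed
    also have "\<dots> \<le> 2 * exp (1 + 1 / \<delta>) * (exp (- X\<^sup>2 / (2 * B)) + \<gamma>)"
      by (intro mult_left_mono) auto
    finally show ?thesis by (simp add: \<gamma>_def y_def)
  qed
qed

text \<open>Either some summand reaches the truncation level, or the truncated and the original sums
  agree. The two signs contribute 2 each and the exceedances 1, whence the constant 5.\<close>

lemma fuk_nagaev:
  assumes \<delta>: "0 < \<delta>" "\<delta> \<le> 1/4" and X: "0 < X" and B: "0 < B" "real N * \<sigma>2 \<le> B"
  shows "cap {\<omega>\<in>space M. \<exists>m\<in>{1..N}. X \<le> \<bar>\<Sum>i<m. path \<omega> (j + i)\<bar>}
    \<le> 5 * exp (1 + 1 / \<delta>) * (exp (- X\<^sup>2 / (2 * B)) + real N * cube_tail (\<delta> * X))"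
proof -
  define C where "C s = {\<omega>\<in>space M. \<exists>m\<in>{1..N}. X \<le> s * (\<Sum>i<m. clip (\<delta> * X) (path \<omega> (j + i)))}" for s
  define D where "D i = {\<omega>\<in>space M. \<delta> * X \<le> \<bar>path \<omega> (j + i)\<bar>}" for i
  have y: "0 < \<delta> * X" using \<delta> X by simp
  let ?R = "exp (- X\<^sup>2 / (2 * B)) + real N * cube_tail (\<delta> * X)"
  have "cap {\<omega>\<in>space M. \<exists>m\<in>{1..N}. X \<le> \<bar>\<Sum>i<m. path \<omega> (j + i)\<bar>} \<le> cap ((C 1 \<union> C (-1)) \<union> (\<Union>i<N. D i))"
  proof (rule cap_mono, clarsimp)
    fix \<omega> m assume *: "\<omega> \<in> space M" "Suc 0 \<le> m" "m \<le> N" "X \<le> \<bar>\<Sum>i<m. path \<omega> (j + i)\<bar>"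
      "\<omega> \<notin> C (-1)" "\<forall>i\<in>{..<N}. \<omega> \<notin> D i"
    have "clip (\<delta> * X) (path \<omega> (j + i)) = path \<omega> (j + i)" if "i < m" for i
    proof (rule clip_eq)
      have "\<omega> \<notin> D i" using *(3,6) that by auto
      then show "\<bar>path \<omega> (j + i)\<bar> \<le> \<delta> * X" using *(1) by (auto simp: D_def)
    qed
    then have eq: "(\<Sum>i<m. clip (\<delta> * X) (path \<omega> (j + i))) = (\<Sum>i<m. path \<omega> (j + i))" by simp
    have C: "\<omega> \<in> C s" if "X \<le> s * (\<Sum>i<m. path \<omega> (j + i))" for s
    proof -
      have "m \<in> {1..N}" "X \<le> s * (\<Sum>i<m. clip (\<delta> * X) (path \<omega> (j + i)))"
        using *(2,3) that by (simp_all add: eq)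
      then show ?thesis using *(1) unfolding C_def by blast
    qed
    show "\<omega> \<in> C 1" using C[of 1] C[of "-1"] *(4,5) by fastforce
  qed
  also have "\<dots> \<le> (cap (C 1) + cap (C (-1))) + cap (\<Union>i<N. D i)"
    using cap_Un[of "C 1 \<union> C (-1)" "\<Union>i<N. D i"] cap_Un[of "C 1" "C (-1)"] by simp
  also have "\<dots> \<le> (2 * exp (1 + 1 / \<delta>) * ?R + 2 * exp (1 + 1 / \<delta>) * ?R) + exp (1 + 1 / \<delta>) * ?R"
  proof (intro add_mono)
    show "cap (C 1) \<le> 2 * exp (1 + 1 / \<delta>) * ?R" "cap (C (-1)) \<le> 2 * exp (1 + 1 / \<delta>) * ?R"
      unfolding C_def by (intro fuk_nagaev_truncated[OF \<delta> X B]; simp)+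
    have "cap (\<Union>i<N. D i) \<le> (\<Sum>i<N. cap (D i))" by (intro cap_UN) auto
    also have "\<dots> \<le> (\<Sum>i<N. cube_tail (\<delta> * X))" unfolding D_def by (intro sum_mono cap_path_ge y)
    also have "\<dots> \<le> 1 * ?R" by simp
    also have "\<dots> \<le> exp (1 + 1 / \<delta>) * ?R"
      using \<delta> cube_tail_nonneg[OF y] by (intro mult_right_mono) (auto simp: add_nonneg_nonneg)
    finally show "cap (\<Union>i<N. D i) \<le> exp (1 + 1 / \<delta>) * ?R" .
  qed
  also have "\<dots> = 5 * exp (1 + 1 / \<delta>) * ?R" by simp
  finally show ?thesis .
qed

end

subsection \<open>Summability from the Choquet condition\<close>

lemma llog_ge_1: "1 \<le> llog x"
  unfolding llog_def by (simp add: ln_ge_iff max.strict_coboundedI1)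

lemma llog_mono: "x \<le> y \<Longrightarrow> llog x \<le> llog y"
  unfolding llog_def by (intro ln_mono) (auto simp: max.strict_coboundedI1)

lemma llog_mult_le: assumes "1 \<le> c" shows "llog (c * x) \<le> llog x + ln c"
proof -
  have "c * x \<le> c * max (exp 1) x" using assms by (intro mult_left_mono) auto
  moreover have "1 * exp 1 \<le> c * max (exp 1) x" using assms by (intro mult_mono) auto
  ultimately have "max (exp 1) (c * x) \<le> c * max (exp 1) x" by simp
  then have "llog (c * x) \<le> ln (c * max (exp 1) x)"
    unfolding llog_def by (intro ln_mono) (auto simp: max.strict_coboundedI1)
  also have "\<dots> = ln c + ln (max (exp 1) x)"
    using assms by (intro ln_mult_pos) (auto simp: max.strict_coboundedI1)
  finally show ?thesis by (simp add: llog_def)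
qed

lemma llog_add_le: assumes "0 \<le> v" shows "llog (u + v) \<le> llog u + v"
proof -
  have 1: "(1::real) \<le> max (exp 1) u" by (simp add: le_max_iff_disj)
  have "max (exp 1) (u + v) \<le> max (exp 1) u + v" using assms by auto
  also have "\<dots> \<le> max (exp 1) u + max (exp 1) u * v" using mult_right_mono[OF 1 assms] by simp
  also have "\<dots> = max (exp 1) u * (1 + v)" by (simp add: algebra_simps)
  finally have "llog (u + v) \<le> ln (max (exp 1) u * (1 + v))"
    unfolding llog_def by (intro ln_mono) (auto simp: max.strict_coboundedI1)
  also have "\<dots> = ln (max (exp 1) u) + ln (1 + v)"
    using assms by (intro ln_mult_pos) (auto simp: max.strict_coboundedI1)
  also have "ln (1 + v) \<le> v" using assms by (rule ln_add_one_self_le_self)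
  finally show ?thesis by (simp add: llog_def)
qed

definition LL :: "real \<Rightarrow> real" where "LL x = llog (llog x)"

lemma LL_ge_1: "1 \<le> LL x" unfolding LL_def by (rule llog_ge_1)

lemma LL_pos: "0 < LL x" using LL_ge_1[of x] by linarith

lemma LL_mono: "x \<le> y \<Longrightarrow> LL x \<le> LL y" unfolding LL_def by (intro llog_mono)

text \<open>Slow variation in multiplicative form; the additive error \<open>ln c\<close> becomes a
  factor because \<open>LL\<close> is at least 1.\<close>

lemma LL_mult_le: assumes "1 \<le> c" shows "LL (c * x) \<le> (1 + ln c) * LL x"
proof -
  have "LL (c * x) \<le> llog (llog x + ln c)"
    unfolding LL_def using llog_mult_le[OF assms] by (rule llog_mono)
  also have "\<dots> \<le> LL x + ln c" unfolding LL_def using assms by (intro llog_add_le) simp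
  also have "\<dots> \<le> LL x + ln c * LL x"
    using mult_left_mono[OF LL_ge_1[of x], of "ln c"] assms by simp
  finally show ?thesis by (simp add: algebra_simps)
qed

lemma llog_le: "llog x \<le> max 1 x"
proof -
  define z where "z = max (exp 1) x / exp 1"
  have z: "1 \<le> z" unfolding z_def by simp
  have "llog x = ln (exp 1 * z)" by (simp add: llog_def z_def)
  also have "\<dots> = 1 + ln z" using z by (subst ln_mult_pos) auto
  also have "ln z \<le> z - 1" using z by (intro ln_le_minus_one) auto
  also have "z \<le> max 1 x"
  proof -
    have "max (exp 1) x \<le> exp 1 * max 1 x"
    proof (cases "0 \<le> x")
      case True
      then have "1 * x \<le> exp 1 * x" by (intro mult_right_mono) auto
      then show ?thesis by (auto simp: max_mult_distrib_left)
    next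
      case False
      then have "x \<le> exp 1" using exp_gt_zero[of "1::real"] by linarith
      then show ?thesis by (simp add: max_absorb1)
    qed
    then show ?thesis by (simp add: z_def field_simps)
  qed
  finally show ?thesis by simp
qed

lemma LL_le: "LL x \<le> max 1 x"
  unfolding LL_def using llog_le[of "llog x"] llog_le[of x] llog_ge_1[of x] by simp

lemma lil_norm_LL: "lil_norm n = sqrt (2 * real n * LL (real n))"
  by (simp add: lil_norm_def LL_def)

lemma lil_norm_sq: "(lil_norm n)\<^sup>2 = 2 * real n * LL (real n)"
  unfolding lil_norm_LL using LL_pos[of n] by (intro real_sqrt_pow2) simp

lemma lil_norm_pos: "1 \<le> n \<Longrightarrow> 0 < lil_norm n"
  unfolding lil_norm_LL using LL_pos[of n] by simp

lemma lil_norm_mono: "n \<le> m \<Longrightarrow> lil_norm n \<le> lil_norm m"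
  unfolding lil_norm_LL using LL_mono[of n m] LL_ge_1[of n]
  by (intro real_sqrt_le_mono mult_mono) auto

lemma lil_norm_le: assumes "1 \<le> n" shows "lil_norm n \<le> 2 * real n"
proof (rule power2_le_imp_le)
  have "2 * real n * LL (real n) \<le> 2 * real n * real n"
    using LL_le[of "real n"] assms by (intro mult_left_mono) auto
  also have "\<dots> \<le> (2 * real n)\<^sup>2" by (simp add: power2_eq_square)
  finally show "(lil_norm n)\<^sup>2 \<le> (2 * real n)\<^sup>2" unfolding lil_norm_sq .
qed simp

lemma lil_norm_mult_le:
  assumes "1 \<le> c" "real m \<le> c * real n"
  shows "(lil_norm m)\<^sup>2 \<le> c * (1 + ln c) * (lil_norm n)\<^sup>2"
proof -
  have "LL (real m) \<le> LL (c * real n)" by (rule LL_mono[OF assms(2)])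
  also have "\<dots> \<le> (1 + ln c) * LL (real n)" by (rule LL_mult_le[OF assms(1)])
  finally have "2 * real m * LL (real m) \<le> 2 * (c * real n) * ((1 + ln c) * LL (real n))"
    using assms LL_pos[of m] by (intro mult_mono) auto
  then show ?thesis unfolding lil_norm_sq by (simp add: algebra_simps)
qed

lemma lil_norm_nonneg: "0 \<le> lil_norm n"
  unfolding lil_norm_LL using LL_pos[of n] by simp

lemma lil_norm_double: assumes "real m \<le> 2 * real n" shows "lil_norm m \<le> 2 * lil_norm n"
proof (rule power2_le_imp_le)
  have "(lil_norm m)\<^sup>2 \<le> 2 * (1 + ln 2) * (lil_norm n)\<^sup>2"
    using assms by (intro lil_norm_mult_le) auto
  also have "\<dots> \<le> 4 * (lil_norm n)\<^sup>2"
    using ln_le_minus_one[of "2::real"] by (intro mult_right_mono) auto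
  finally show "(lil_norm m)\<^sup>2 \<le> (2 * lil_norm n)\<^sup>2" by (simp add: power_mult_distrib)
qed (simp add: lil_norm_nonneg)

text \<open>Its reciprocal bounds from below the factor by which z^2 / LL z exceeds n when z \<ge> r
  a_n (\<open>growth_lower_bound\<close>). The term r^-2 is the scaling for small r; for large r the
  growth of \<open>LL\<close> may cost a factor of order sqrt r, which leaves the power 3/2.\<close>

definition tail_weight :: "real \<Rightarrow> real" where "tail_weight r = 1 / r\<^sup>2 + 2 / (r * sqrt r)"

lemma tail_weight_pos: "0 < r \<Longrightarrow> 0 < tail_weight r"
  by (simp add: tail_weight_def add_pos_pos)

lemma tail_weight_div_le: assumes "0 < r" shows "tail_weight (r / 4 ^ i) \<le> 16 ^ i * tail_weight r"
proof -
  have s: "sqrt (4 ^ i) = (2::real) ^ i"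
    by (rule real_sqrt_unique) (auto simp: power2_eq_square simp flip: power_mult_distrib)
  have p: "(4 ^ i)\<^sup>2 = (16::real) ^ i" by (simp add: power2_eq_square flip: power_mult_distrib)
  have 1: "1 / (r / 4 ^ i)\<^sup>2 = 16 ^ i * (1 / r\<^sup>2)" by (simp add: power_divide p)
  have "2 / (r / 4 ^ i * sqrt (r / 4 ^ i)) = (4 ^ i * 2 ^ i) * (2 / (r * sqrt r))"
    by (simp add: real_sqrt_divide s)
  also have "\<dots> \<le> 16 ^ i * (2 / (r * sqrt r))"
    using assms by (intro mult_right_mono) (auto simp: power_mono simp flip: power_mult_distrib)
  finally show ?thesis unfolding tail_weight_def 1 by (simp add: algebra_simps)
qed

text \<open>The slower summand has exponent 3/2, and 4^(3/2) = 8. What matters in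
  \<open>maxset_level_bound\<close> is that 8 exceeds the level weight 4.\<close>

lemma tail_weight_mult_le: assumes "0 < r" shows "tail_weight (r * 4 ^ l) \<le> tail_weight r / 8 ^ l"
proof -
  have s: "sqrt (4 ^ l) = (2::real) ^ l"
    by (rule real_sqrt_unique) (auto simp: power2_eq_square simp flip: power_mult_distrib)
  have p: "(4 ^ l)\<^sup>2 = (16::real) ^ l" by (simp add: power2_eq_square flip: power_mult_distrib)
  have e8: "4 ^ l * 2 ^ l = (8::real) ^ l" by (simp flip: power_mult_distrib)
  have "1 / (r * 4 ^ l)\<^sup>2 = (1 / r\<^sup>2) / 16 ^ l" by (simp add: power_mult_distrib p)
  also have "\<dots> \<le> (1 / r\<^sup>2) / 8 ^ l" by (intro divide_left_mono) (auto simp: power_mono)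
  finally have 1: "1 / (r * 4 ^ l)\<^sup>2 \<le> (1 / r\<^sup>2) / 8 ^ l" .
  have "(r * 4 ^ l) * sqrt (r * 4 ^ l) = (r * sqrt r) * 8 ^ l"
    by (simp add: real_sqrt_mult s flip: e8)
  then have "2 / ((r * 4 ^ l) * sqrt (r * 4 ^ l)) = (2 / (r * sqrt r)) / 8 ^ l" by (simp only:) simp
  then show ?thesis using 1 unfolding tail_weight_def add_divide_distrib by linarith
qed

lemma one_plus_ln_le: assumes "1 \<le> r" shows "1 + ln r \<le> 2 * sqrt r"
proof -
  have "ln r = 2 * ln (sqrt r)" using assms by (simp add: ln_sqrt)
  also have "ln (sqrt r) \<le> sqrt r - 1" using assms by (intro ln_le_minus_one) auto
  finally show ?thesis by simp
qed

text \<open>Enlarging z by a factor c \<ge> 1 multiplies z^2 by c^2 and \<open>LL\<close> by at most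
  1 + ln c \<le> c^2, so only z = r a_n has to be treated. There z^2 = 2 r^2 n LL n, and a_n \<le> 2
  n makes LL a_n comparable to LL n.\<close>

lemma growth_lower_bound:
  assumes n: "1 \<le> n" and r: "0 < r" and z: "r * lil_norm n \<le> z"
  shows "real n / tail_weight r \<le> z\<^sup>2 / LL z"
proof -
  define z0 where "z0 = r * lil_norm n"
  have z0: "0 < z0" using r lil_norm_pos[OF n] by (simp add: z0_def)
  define c where "c = z / z0"
  have w: "1 / r\<^sup>2 \<le> tail_weight r" "2 / (r * sqrt r) \<le> tail_weight r" using r by (simp_all add: tail_weight_def)
  have c: "1 \<le> c" "z = c * z0" using z z0 by (auto simp: c_def z0_def)
  have c0: "0 \<le> ln c" "1 + ln c \<le> c\<^sup>2"
  proof -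
    show "0 \<le> ln c" using c by simp
    have "1 + ln c \<le> c" using ln_le_minus_one[of c] c by simp
    also have "\<dots> \<le> c\<^sup>2" using c mult_left_mono[of 1 c c] by (simp add: power2_eq_square)
    finally show "1 + ln c \<le> c\<^sup>2" .
  qed
  have an: "LL (lil_norm n) \<le> 2 * LL n"
  proof -
    have "LL (lil_norm n) \<le> LL (2 * real n)" by (intro LL_mono lil_norm_le n)
    also have "\<dots> \<le> (1 + ln 2) * LL n" by (intro LL_mult_le) simp
    also have "\<dots> \<le> 2 * LL n" using ln_le_minus_one[of "2::real"] LL_pos[of n] by (intro mult_right_mono) auto
    finally show ?thesis .
  qed
  have LLz: "LL z \<le> c\<^sup>2 * LL z0"
  proof -
    have "LL z \<le> (1 + ln c) * LL z0" unfolding c(2) by (rule LL_mult_le[OF c(1)])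
    also have "\<dots> \<le> c\<^sup>2 * LL z0" using c0 LL_pos[of z0] by (intro mult_right_mono) auto
    finally show ?thesis .
  qed
  \<comment> \<open>For \<open>r \<le> 1\<close> scaling by \<open>r\<close> does not increase
    \<open>LL\<close>; for \<open>r > 1\<close> it increases it by at most 1 + ln r \<le> 2 sqrt
    r.\<close>
  have "real n / tail_weight r \<le> z0\<^sup>2 / LL z0"
  proof (cases "r \<le> 1")
    case True
    have "LL z0 \<le> LL (lil_norm n)" unfolding z0_def using True lil_norm_pos[OF n]
      by (intro LL_mono) (simp add: mult_left_le_one_le r less_imp_le)
    then have "LL z0 \<le> 2 * LL n" using an by linarith
    then have "z0\<^sup>2 / (2 * LL n) \<le> z0\<^sup>2 / LL z0" using LL_pos by (intro divide_left_mono mult_pos_pos) auto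
    moreover have "z0\<^sup>2 / (2 * LL n) = r\<^sup>2 * real n"
      using LL_pos[of n] by (simp add: z0_def power_mult_distrib lil_norm_sq)
    moreover have "real n / tail_weight r \<le> real n / (1 / r\<^sup>2)"
      using r w tail_weight_pos[OF r] by (intro divide_left_mono) (auto intro!: mult_pos_pos divide_pos_pos)
    ultimately show ?thesis by (simp add: mult.commute)
  next
    case False
    then have "LL z0 \<le> (1 + ln r) * LL (lil_norm n)" unfolding z0_def by (intro LL_mult_le) auto
    also have "\<dots> \<le> (2 * sqrt r) * (2 * LL n)"
      using one_plus_ln_le[of r] False an LL_pos by (intro mult_mono) (auto simp: less_imp_le)
    finally have "LL z0 \<le> (2 * sqrt r) * (2 * LL n)" .
    then have "z0\<^sup>2 / ((2 * sqrt r) * (2 * LL n)) \<le> z0\<^sup>2 / LL z0"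
      using LL_pos r by (intro divide_left_mono mult_pos_pos) auto
    moreover have "z0\<^sup>2 / ((2 * sqrt r) * (2 * LL n)) = real n / (2 / (r * sqrt r))"
    proof -
      have "z0\<^sup>2 = r * (sqrt r * sqrt r) * (2 * real n * LL n)"
        using r lil_norm_sq[of n] by (simp add: z0_def power_mult_distrib power2_eq_square[of r])
      then show ?thesis using r LL_pos[of n] by (simp add: field_simps)
    qed
    moreover have "real n / tail_weight r \<le> real n / (2 / (r * sqrt r))"
      using r w tail_weight_pos[OF r] by (intro divide_left_mono) (auto intro!: mult_pos_pos divide_pos_pos)
    ultimately show ?thesis by simp
  qed
  also have "z0\<^sup>2 / LL z0 = z\<^sup>2 / (c\<^sup>2 * LL z0)" using c by (simp add: power_mult_distrib)
  also have "\<dots> \<le> z\<^sup>2 / LL z" using LLz LL_pos c by (intro divide_left_mono mult_pos_pos) auto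
  finally show ?thesis .
qed

text \<open>Layers at the levels 4^-(i+1): below 4^-i the cube is at most 64^-i. The number of
  layers stays finite, with an explicit remainder, because \<open>cap\<close> is only finitely
  sub-additive.\<close>

lemma cube_layer_bound:
  fixes z :: real
  assumes "0 \<le> z" "z \<le> 1"
  shows "z ^ 3 \<le> (1/64) ^ I + (\<Sum>i<I. (1/64) ^ i * of_bool ((1/4) ^ Suc i \<le> z))"
proof (induction I)
  case (Suc I)
  have nn: "0 \<le> (\<Sum>i<I. (1/64) ^ i * of_bool ((1/4) ^ Suc i \<le> z) :: real)" by (intro sum_nonneg) auto
  show ?case
  proof (cases "(1/4) ^ Suc I \<le> z")
    case True
    have "(1/64) ^ I \<le> (1/64) ^ Suc I + (1/64) ^ I * (1::real)" by simp
    moreover have b: "of_bool ((1/4) ^ Suc I \<le> z) = (1::real)" using True by simp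
    ultimately show ?thesis using Suc unfolding sum.lessThan_Suc b by linarith
  next
    case False
    then have "z ^ 3 \<le> ((1/4) ^ Suc I) ^ 3" using assms by (intro power_mono) auto
    also have "\<dots> = ((1/4) ^ 3) ^ Suc I" by (simp only: power_mult[symmetric] mult.commute)
    also have "\<dots> = (1/64) ^ Suc I" by (simp add: power_divide)
    finally show ?thesis using nn False by simp
  qed
qed (use assms in \<open>auto intro: power_le_one\<close>)

section \<open>Tail sums under the Choquet condition\<close>

context lil_sequence
begin

definition tail :: "real \<Rightarrow> real" where
  "tail t = cap {\<omega>\<in>space M. t \<le> (Y 1 \<omega>)\<^sup>2 / LL \<bar>Y 1 \<omega>\<bar>}"

lemma tail_nonneg: "0 \<le> tail t" unfolding tail_def by (rule upper_cap_eq)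

lemma tail_antimono: "s \<le> t \<Longrightarrow> tail t \<le> tail s"
  unfolding tail_def by (intro cap_mono) auto

lemma cap_space: "cap (space M) = 1"
proof (rule antisym[OF upper_cap_eq(3)], rule ccontr)
  assume "\<not> 1 \<le> cap (space M)"
  then obtain \<xi> where \<xi>: "\<xi> \<in> Hb" "\<And>\<omega>. \<omega> \<in> space M \<Longrightarrow> indicator (space M) \<omega> \<le> \<xi> \<omega>" "expec \<xi> < 1"
    using cap_obtain[of "space M" 1] by (metis not_le)
  have "expec (\<lambda>_. 1) \<le> expec \<xi>" using \<xi>(1,2) by (intro expec_mono Hb_const) auto
  then show False using \<xi>(3) by simp
qed

text \<open>The negative part of the Choquet expectation vanishes, since the variable is nonnegative
  and the whole space has capacity 1.\<close>

lemma tail_integrable: "(\<integral>\<^sup>+t. ennreal (tail t) * indicator {0..} t \<partial>lborel) < \<infinity>"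
proof -
  let ?X = "\<lambda>\<omega>. (Y 1 \<omega>)\<^sup>2 / llog (llog \<bar>Y 1 \<omega>\<bar>)"
  have X0: "0 \<le> ?X \<omega>" for \<omega> using LL_pos[of "\<bar>Y 1 \<omega>\<bar>"] by (simp add: LL_def)
  have "{\<omega>\<in>space M. t \<le> ?X \<omega>} = space M" if "t \<le> 0" for t using X0 that by (auto intro: order_trans)
  then have "(\<integral>\<^sup>+t\<in>{..0}. e2ennreal (1 - upper_cap M H E {\<omega>\<in>space M. t \<le> ?X \<omega>}) \<partial>lborel)
      = (\<integral>\<^sup>+t. 0 \<partial>(lborel :: real measure))"
    by (intro nn_integral_cong) (auto simp: upper_cap_eq cap_space indicator_def one_ereal_def zero_ereal_def)
  moreover have "(\<integral>\<^sup>+t\<in>{0..}. e2ennreal (upper_cap M H E {\<omega>\<in>space M. t \<le> ?X \<omega>}) \<partial>lborel)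
      = (\<integral>\<^sup>+t. ennreal (tail t) * indicator {0..} t \<partial>lborel)"
    by (intro nn_integral_cong) (simp add: upper_cap_eq tail_def LL_def)
  ultimately have "enn2ereal (\<integral>\<^sup>+t. ennreal (tail t) * indicator {0..} t \<partial>lborel) < \<infinity>"
    using choquet_finite unfolding choquet_def by (simp add: zero_ennreal.rep_eq)
  then have "(\<integral>\<^sup>+t. ennreal (tail t) * indicator {0..} t \<partial>lborel) \<noteq> top"
    by (auto simp: top_ennreal.rep_eq top_ereal_def)
  then show ?thesis by (simp add: less_top)
qed

text \<open>Comparison with the integral of the decreasing function \<open>tail\<close>: the
  intervals from s_k / \<rho> to s_k are disjoint and have length (1 - 1/\<rho>) s_k. The constant
  \<open>K\<close> does not depend on the sequence, so rescaled sequences share it.\<close>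

lemma tail_sum_bound:
  obtains K where "0 \<le> K"
    "\<And>\<rho> s m. 1 < \<rho> \<Longrightarrow> 0 < s 0 \<Longrightarrow> (\<And>k. \<rho> * s k \<le> s (Suc k)) \<Longrightarrow> (\<Sum>k<m. s k * tail (s k)) \<le> \<rho> / (\<rho> - 1) * K"
proof -
  define K where "K = enn2real (\<integral>\<^sup>+t. ennreal (tail t) * indicator {0..} t \<partial>lborel)"
  have K: "(\<integral>\<^sup>+t. ennreal (tail t) * indicator {0..} t \<partial>lborel) = ennreal K" "0 \<le> K"
    using tail_integrable by (simp_all add: K_def)
  have "(\<Sum>k<m. s k * tail (s k)) \<le> \<rho> / (\<rho> - 1) * K"
    if \<rho>: "1 < \<rho>" and s0: "0 < s 0" and s: "\<And>k. \<rho> * s k \<le> s (Suc k)" for \<rho> m and s :: "nat \<Rightarrow> real"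
  proof -
    have spos: "0 < s k" for k
    proof (induction k)
      case (Suc k)
      then have "0 < \<rho> * s k" using \<rho> by simp
      then show ?case using s[of k] by linarith
    qed (rule s0)
    have smono: "\<rho> * s i \<le> s j" if "i < j" for i j
      using that
    proof (induction j)
      case (Suc j)
      show ?case
      proof (cases "i = j")
        case False
        then have "\<rho> * s i \<le> s j" using Suc by simp
        also have "1 * s j \<le> \<rho> * s j" using \<rho> spos[of j] by (intro mult_right_mono) auto
        finally show ?thesis using s[of j] by simp
      qed (use s in simp)
    qed simp
    define A where "A k = {s k / \<rho><..s k}" for k
    have disj: "i = j" if "t \<in> A i" "t \<in> A j" for i j t
    proof (rule ccontr)
      assume "i \<noteq> j"
      then consider "i < j" | "j < i" by linarith
      then show False
      proof cases
        case 1
        then have "s i \<le> s j / \<rho>" using smono[OF 1] \<rho> by (simp add: field_simps)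
        then show ?thesis using that by (auto simp: A_def)
      next
        case 2
        then have "s j \<le> s i / \<rho>" using smono[OF 2] \<rho> by (simp add: field_simps)
        then show ?thesis using that by (auto simp: A_def)
      qed
    qed
    have pw: "(\<Sum>k<m. ennreal (tail (s k)) * indicator (A k) t) \<le> ennreal (tail t) * indicator {0..} t" for t
    proof (cases "\<exists>k<m. t \<in> A k")
      case True
      then obtain k where k: "k < m" "t \<in> A k" by blast
      have "(\<Sum>k<m. ennreal (tail (s k)) * indicator (A k) t) = (\<Sum>k\<in>{k}. ennreal (tail (s k)) * indicator (A k) t)"
        using k disj by (intro sum.mono_neutral_right) (auto simp: indicator_def)
      also have "\<dots> = ennreal (tail (s k))" using k by simp
      also have "\<dots> \<le> ennreal (tail t)" using k by (intro ennreal_leI tail_antimono) (auto simp: A_def)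
      also have "0 \<le> t" using k(2) spos[of k] \<rho> by (auto simp: A_def intro: order_trans[of _ "s k / \<rho>"])
      then have "ennreal (tail t) = ennreal (tail t) * indicator {0..} t" by simp
      finally show ?thesis .
    qed (auto simp: indicator_def intro!: sum_nonneg)
    have nn: "0 \<le> tail (s k) * (s k - s k / \<rho>)" for k
      using tail_nonneg[of "s k"] spos[of k] \<rho> by (intro mult_nonneg_nonneg) (simp_all add: field_simps)
    have "(\<Sum>k<m. ennreal (tail (s k) * (s k - s k / \<rho>))) = (\<Sum>k<m. ennreal (tail (s k)) * emeasure lborel (A k))"
    proof (intro sum.cong refl)
      fix k
      have "s k / \<rho> \<le> s k" using spos[of k] \<rho> by (simp add: field_simps)
      then show "ennreal (tail (s k) * (s k - s k / \<rho>)) = ennreal (tail (s k)) * emeasure lborel (A k)"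
        by (simp add: A_def ennreal_mult' tail_nonneg)
    qed
    also have "\<dots> = (\<integral>\<^sup>+t. (\<Sum>k<m. ennreal (tail (s k)) * indicator (A k) t) \<partial>lborel)"
      by (subst nn_integral_sum) (auto simp: A_def nn_integral_cmult_indicator)
    also have "\<dots> \<le> ennreal K" unfolding K(1)[symmetric] by (intro nn_integral_mono pw)
    finally have "ennreal (\<Sum>k<m. tail (s k) * (s k - s k / \<rho>)) \<le> ennreal K"
      using nn by (subst sum_ennreal[symmetric]) auto
    then have "(\<Sum>k<m. tail (s k) * (s k - s k / \<rho>)) \<le> K" using K(2) by simp
    also have "(\<Sum>k<m. tail (s k) * (s k - s k / \<rho>)) = (\<rho> - 1) / \<rho> * (\<Sum>k<m. s k * tail (s k))"
      using \<rho> unfolding sum_distrib_left by (intro sum.cong) (auto simp: field_simps)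
    finally show ?thesis using \<rho> by (simp add: field_simps)
  qed
  then show ?thesis using that K(2) by blast
qed

lemma cube_tail_layer_bound:
  assumes y: "0 < y"
  shows "cube_tail y \<le> (1/64) ^ I + (\<Sum>i<I. (1/64) ^ i * cap {\<omega>\<in>space M. y / 4 ^ Suc i \<le> \<bar>Y 1 \<omega>\<bar>})"
proof -
  have "cube_tail y = expec (\<lambda>\<omega>. (\<bar>clip y (Y 1 \<omega>)\<bar> / y) ^ 3)" by (simp add: cube_tail_def E_Y_def)
  also have "\<dots> \<le> (1/64) ^ I + (\<Sum>i<I. (1/64) ^ i * cap {\<omega>\<in>space M. y / 4 ^ Suc i \<le> \<bar>Y 1 \<omega>\<bar>})"
  proof (rule expec_le_cap_sum)
    show "(\<lambda>\<omega>. (\<bar>clip y (Y 1 \<omega>)\<bar> / y) ^ 3) \<in> Hb" by (rule bdd_lip_Y_Hb[OF bdd_lip_cube_tail]) simp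
    fix \<omega> assume \<omega>: "\<omega> \<in> space M"
    define z where "z = \<bar>clip y (Y 1 \<omega>)\<bar> / y"
    have z: "0 \<le> z" "z \<le> 1" "z \<le> \<bar>Y 1 \<omega>\<bar> / y"
      using y by (auto simp: z_def abs_clip divide_right_mono)
    have "z ^ 3 \<le> (1/64) ^ I + (\<Sum>i<I. (1/64) ^ i * of_bool ((1/4) ^ Suc i \<le> z))"
      by (rule cube_layer_bound[OF z(1,2)])
    also have "\<dots> \<le> (1/64) ^ I + (\<Sum>i<I. (1/64) ^ i * indicator {\<omega>\<in>space M. y / 4 ^ Suc i \<le> \<bar>Y 1 \<omega>\<bar>} \<omega>)"
    proof (intro add_left_mono sum_mono mult_left_mono)
      fix i
      have "y / 4 ^ Suc i \<le> \<bar>Y 1 \<omega>\<bar>" if "(1/4) ^ Suc i \<le> z"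
      proof -
        have "(1/4) ^ Suc i \<le> \<bar>Y 1 \<omega>\<bar> / y" using that z(3) by linarith
        then have "(1/4) ^ Suc i * y \<le> \<bar>Y 1 \<omega>\<bar>" using y by (simp only: pos_le_divide_eq)
        then show ?thesis by (simp add: power_divide)
      qed
      then show "of_bool ((1/4) ^ Suc i \<le> z) \<le> (indicator {\<omega>\<in>space M. y / 4 ^ Suc i \<le> \<bar>Y 1 \<omega>\<bar>} \<omega> :: real)"
        using \<omega> by (auto simp: indicator_def)
    qed simp
    finally show "(\<bar>clip y (Y 1 \<omega>)\<bar> / y) ^ 3 \<le>
      (1/64) ^ I + (\<Sum>i<I. (1/64) ^ i * indicator {\<omega>\<in>space M. y / 4 ^ Suc i \<le> \<bar>Y 1 \<omega>\<bar>} \<omega>)"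
      unfolding z_def .
  qed auto
  finally show ?thesis .
qed

text \<open>Layer \<open>i\<close> costs \<open>16 ^ Suc i * tail_weight r\<close> and has weight
  \<open>(1/64) ^ i\<close>, which leaves a geometric series of ratio 1/4. This is why a third
  moment is used: a square would give the weights \<open>(1/16) ^ i\<close> and no convergence. The
  dependence on \<open>r\<close> is kept explicit for use at all levels.\<close>

lemma cube_tail_sum_bound:
  fixes n :: "nat \<Rightarrow> nat"
  assumes \<rho>: "1 < \<rho>" and n0: "1 \<le> n 0" and n: "\<And>k. \<rho> * real (n k) \<le> real (n (Suc k))"
  obtains K where "0 \<le> K" "\<And>r m. 0 < r \<Longrightarrow> (\<Sum>k<m. real (n k) * cube_tail (r * lil_norm (n k))) \<le> K * tail_weight r"
proof -
  obtain K0 where K0: "0 \<le> K0"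
    "\<And>\<rho> s m. 1 < \<rho> \<Longrightarrow> 0 < s 0 \<Longrightarrow> (\<And>k. \<rho> * s k \<le> s (Suc k)) \<Longrightarrow> (\<Sum>k<m. s k * tail (s k)) \<le> \<rho> / (\<rho> - 1) * K0"
    by (rule tail_sum_bound) blast
  define K where "K = \<rho> / (\<rho> - 1) * K0"
  have K: "0 \<le> K" using K0(1) \<rho> by (simp add: K_def)
  have n1: "1 \<le> n k" for k
  proof (induction k)
    case (Suc k)
    have "1 * 1 \<le> \<rho> * real (n k)" using Suc \<rho> by (intro mult_mono) auto
    then show ?case using n[of k] by linarith
  qed (rule n0)
  have cs: "(\<Sum>k<m. real (n k) * cap {\<omega>\<in>space M. r * lil_norm (n k) \<le> \<bar>Y 1 \<omega>\<bar>}) \<le> K * tail_weight r"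
    if r: "0 < r" for r m
  proof -
    have w: "0 < tail_weight r" by (rule tail_weight_pos[OF r])
    have "(\<Sum>k<m. real (n k) * cap {\<omega>\<in>space M. r * lil_norm (n k) \<le> \<bar>Y 1 \<omega>\<bar>})
        \<le> (\<Sum>k<m. real (n k) * tail (real (n k) / tail_weight r))"
    proof (intro sum_mono mult_left_mono)
      fix k
      have "real (n k) / tail_weight r \<le> (Y 1 \<omega>)\<^sup>2 / LL \<bar>Y 1 \<omega>\<bar>" if "r * lil_norm (n k) \<le> \<bar>Y 1 \<omega>\<bar>" for \<omega>
        using growth_lower_bound[OF n1 r that] by simp
      then show "cap {\<omega>\<in>space M. r * lil_norm (n k) \<le> \<bar>Y 1 \<omega>\<bar>} \<le> tail (real (n k) / tail_weight r)"
        unfolding tail_def by (intro cap_mono) auto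
    qed simp
    also have "\<dots> = tail_weight r * (\<Sum>k<m. (real (n k) / tail_weight r) * tail (real (n k) / tail_weight r))"
      using w unfolding sum_distrib_left by (intro sum.cong) auto
    also have "\<dots> \<le> tail_weight r * (\<rho> / (\<rho> - 1) * K0)"
      using w n1[of 0] n by (intro mult_left_mono K0(2) \<rho>) (auto simp: field_simps)
    finally show ?thesis by (simp add: K_def mult.commute)
  qed
  have "(\<Sum>k<m. real (n k) * cube_tail (r * lil_norm (n k))) \<le> 64 * K * tail_weight r" if r: "0 < r" for r m
  proof (rule LIMSEQ_le_const)
    \<comment> \<open>With \<open>m\<close> fixed the number of layers tends to infinity, which
      removes the remainder.\<close>
    have "(\<lambda>I. (\<Sum>k<m. real (n k)) * (1/64) ^ I + 64 * K * tail_weight r) \<longlonglongrightarrow> (\<Sum>k<m. real (n k)) * 0 + 64 * K * tail_weight r"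
      by (intro tendsto_intros LIMSEQ_power_zero) auto
    then show "(\<lambda>I. (\<Sum>k<m. real (n k)) * (1/64) ^ I + 64 * K * tail_weight r) \<longlonglongrightarrow> 64 * K * tail_weight r" by simp
    have "(\<Sum>k<m. real (n k) * cube_tail (r * lil_norm (n k))) \<le> (\<Sum>k<m. real (n k)) * (1/64) ^ I + 64 * K * tail_weight r" for I
    proof -
      have "(\<Sum>k<m. real (n k) * cube_tail (r * lil_norm (n k))) \<le>
        (\<Sum>k<m. real (n k) * ((1/64) ^ I + (\<Sum>i<I. (1/64) ^ i * cap {\<omega>\<in>space M. (r / 4 ^ Suc i) * lil_norm (n k) \<le> \<bar>Y 1 \<omega>\<bar>})))"
        using cube_tail_layer_bound[of "r * lil_norm (n _)" I] r lil_norm_pos[OF n1]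
        by (intro sum_mono mult_left_mono) auto
      also have "\<dots> = (\<Sum>k<m. real (n k)) * (1/64) ^ I +
        (\<Sum>i<I. (1/64) ^ i * (\<Sum>k<m. real (n k) * cap {\<omega>\<in>space M. (r / 4 ^ Suc i) * lil_norm (n k) \<le> \<bar>Y 1 \<omega>\<bar>}))"
        by (simp add: distrib_left sum.distrib sum_distrib_left sum_distrib_right mult.left_commute
            sum.swap[of _ "{..<m}" "{..<I}"] del: power_Suc)
      also have "(\<Sum>i<I. (1/64) ^ i * (\<Sum>k<m. real (n k) * cap {\<omega>\<in>space M. (r / 4 ^ Suc i) * lil_norm (n k) \<le> \<bar>Y 1 \<omega>\<bar>}))
          \<le> (\<Sum>i<I. (1/64) ^ i * (K * (16 ^ Suc i * tail_weight r)))"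
      proof (intro sum_mono mult_left_mono)
        fix i
        have "(\<Sum>k<m. real (n k) * cap {\<omega>\<in>space M. (r / 4 ^ Suc i) * lil_norm (n k) \<le> \<bar>Y 1 \<omega>\<bar>}) \<le> K * tail_weight (r / 4 ^ Suc i)"
          using r by (intro cs) simp
        also have "\<dots> \<le> K * (16 ^ Suc i * tail_weight r)" by (intro mult_left_mono tail_weight_div_le r K)
        finally show "(\<Sum>k<m. real (n k) * cap {\<omega>\<in>space M. (r / 4 ^ Suc i) * lil_norm (n k) \<le> \<bar>Y 1 \<omega>\<bar>}) \<le> K * (16 ^ Suc i * tail_weight r)" .
      qed simp
      also have "\<dots> = 16 * K * tail_weight r * (\<Sum>i<I. (1/4) ^ i)"
      proof -
        have "(1/64) ^ i * (K * (16 ^ Suc i * tail_weight r)) = 16 * K * tail_weight r * (1/4) ^ i" for i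
        proof -
          have "(1/64) ^ i * 16 ^ i = (1/4 :: real) ^ i" by (simp flip: power_mult_distrib)
          moreover have "(1/64) ^ i * (K * (16 ^ Suc i * tail_weight r)) = 16 * K * tail_weight r * ((1/64) ^ i * 16 ^ i)"
            by simp
          ultimately show ?thesis by (simp only:)
        qed
        then show ?thesis by (simp only: sum_distrib_left)
      qed
      also have "(\<Sum>i<I. (1/4) ^ i) \<le> (4::real)"
        using sum_le_suminf[of "\<lambda>i. (1/4::real) ^ i" "{..<I}"] suminf_geometric[of "1/4::real"] by simp
      finally show ?thesis using K tail_weight_pos[OF r] by (simp add: mult_left_mono)
    qed
    then show "\<exists>N. \<forall>I\<ge>N. (\<Sum>k<m. real (n k) * cube_tail (r * lil_norm (n k))) \<le> (\<Sum>k<m. real (n k)) * (1/64) ^ I + 64 * K * tail_weight r"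
      by blast
  qed
  then show ?thesis using that[of "64 * K"] K by simp
qed

end

subsection \<open>The upper half of the law\<close>

lemma summable_prod_decode:
  fixes f :: "nat \<times> nat \<Rightarrow> real"
  assumes nn: "\<And>p. 0 \<le> f p" and le: "\<And>a m. (\<Sum>b<m. f (a, b)) \<le> G a" and G: "summable G"
  shows "summable (\<lambda>i. f (prod_decode i))"
proof (rule summableI_nonneg_bounded)
  fix n
  obtain a b where sub: "prod_decode ` {..<n} \<subseteq> {..<a} \<times> {..<b}" by (rule prod_decode_subset)
  have G0: "0 \<le> G a" for a using le[where m = 0 and a = a] by simp
  have "(\<Sum>m<n. f (prod_decode m)) = sum f (prod_decode ` {..<n})"
    by (simp add: sum.reindex[OF inj_prod_decode] comp_def)
  also have "\<dots> \<le> sum f ({..<a} \<times> {..<b})" using sub nn by (intro sum_mono2) auto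
  also have "\<dots> = (\<Sum>i<a. \<Sum>j<b. f (i, j))" by (simp add: sum.cartesian_product)
  also have "\<dots> \<le> (\<Sum>i<a. G i)" by (intro sum_mono le)
  also have "\<dots> \<le> suminf G" using G G0 by (intro sum_le_suminf) auto
  finally show "(\<Sum>m<n. f (prod_decode m)) \<le> suminf G" .
qed (use nn in auto)

text \<open>The majorant is the sum over the row. It turns one convergent enumerated double series
  into bounds that are uniform in the second index and summable in the first.\<close>

lemma summable_prod_decode_marginal:
  fixes f :: "nat \<times> nat \<Rightarrow> real"
  assumes nn: "\<And>p. 0 \<le> f p" and sm: "summable (\<lambda>i. f (prod_decode i))"
  obtains G where "summable G" "\<And>a b. f (a, b) \<le> G a"
proof -
  have "(\<lambda>i. f (prod_decode i)) summable_on UNIV"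
    using sm nn by (subst summable_on_UNIV_nonneg_real_iff) auto
  then have "f summable_on UNIV" using summable_on_reindex_bij_betw[OF bij_prod_decode, of f] by simp
  then have s: "(\<lambda>(a, b). f (a, b)) summable_on UNIV \<times> UNIV" by simp
  define G where "G a = infsum (\<lambda>b. f (a, b)) UNIV" for a
  have row: "(\<lambda>b. f (a, b)) summable_on UNIV" for a using summable_on_SigmaD1[OF s, of a] by simp
  have "G summable_on UNIV" unfolding G_def using summable_on_Sigma_banach[OF s] by simp
  then have "summable G"
    using summable_on_UNIV_nonneg_real_iff[of G] nn by (simp add: G_def infsum_nonneg)
  moreover have "f (a, b) \<le> G a" for a b
    using finite_sum_le_infsum[OF row, of "{b}" a] nn by (simp add: G_def)
  ultimately show ?thesis using that by blast
qed

text \<open>Along a geometric sequence LL n_k is at least ln k up to a constant, so the terms are of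
  order k^-\<theta>.\<close>

lemma exp_LL_summable:
  fixes n :: "nat \<Rightarrow> nat"
  assumes \<rho>: "1 < \<rho>" and n: "\<And>k. \<rho> ^ k \<le> real (n k)" and \<theta>: "1 < \<theta>"
  shows "summable (\<lambda>k. exp (- \<theta> * LL (real (n k))))"
proof (rule summable_comparison_test)
  show "\<exists>N. \<forall>k\<ge>N. norm (exp (- \<theta> * LL (real (n k)))) \<le> ln \<rho> powr (- \<theta>) * real k powr (- \<theta>)"
  proof (intro exI[of _ 1] allI impI)
    fix k :: nat assume k: "1 \<le> k"
    have lr: "0 < ln \<rho>" using \<rho> by simp
    have "ln \<rho> * real k = ln (\<rho> ^ k)" using \<rho> by (simp add: ln_realpow)
    also have "\<dots> \<le> ln (max (exp 1) (real (n k)))"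
      using \<rho> n[of k] by (intro ln_mono) (auto simp: max.strict_coboundedI1)
    finally have l1: "ln \<rho> * real k \<le> llog (real (n k))" by (simp add: llog_def)
    have "ln (ln \<rho> * real k) \<le> ln (max (exp 1) (llog (real (n k))))"
      using l1 lr k by (intro ln_mono) (auto simp: max.strict_coboundedI1)
    then have "\<theta> * ln (ln \<rho> * real k) \<le> \<theta> * LL (real (n k))"
      using \<theta> by (intro mult_left_mono) (auto simp: LL_def llog_def)
    then have "exp (- \<theta> * LL (real (n k))) \<le> exp (- \<theta> * ln (ln \<rho> * real k))" by simp
    also have "\<dots> = (ln \<rho> * real k) powr (- \<theta>)" using lr k by (simp add: powr_def)
    also have "\<dots> = ln \<rho> powr (- \<theta>) * real k powr (- \<theta>)" using lr by (simp add: powr_mult)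
    finally show "norm (exp (- \<theta> * LL (real (n k)))) \<le> ln \<rho> powr (- \<theta>) * real k powr (- \<theta>)" by simp
  qed
  show "summable (\<lambda>k. ln \<rho> powr (- \<theta>) * real k powr (- \<theta>))"
    using \<theta> by (intro summable_mult) (simp add: summable_real_powr_iff)
qed

lemma geometric_growth:
  fixes n :: "nat \<Rightarrow> nat"
  assumes \<rho>: "1 < \<rho>" and n0: "1 \<le> n 0" and n: "\<And>k. \<rho> * real (n k) \<le> real (n (Suc k))"
  shows "\<rho> ^ k \<le> real (n k)" "1 \<le> n k"
proof -
  show *: "\<rho> ^ k \<le> real (n k)" for k
  proof (induction k)
    case (Suc k)
    have "\<rho> * \<rho> ^ k \<le> \<rho> * real (n k)" using Suc \<rho> by (intro mult_left_mono) auto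
    then show ?case using n[of k] by simp
  qed (use n0 in simp)
  have "1 \<le> \<rho> ^ k" using \<rho> by (intro one_le_power) auto
  then show "1 \<le> n k" using *[of k] by linarith
qed

context lil_sequence
begin

definition maxset :: "real \<Rightarrow> nat \<Rightarrow> nat \<Rightarrow> 'a set" where
  "maxset X j N = {\<omega>\<in>space M. \<exists>m\<in>{1..N}. X \<le> \<bar>\<Sum>i<m. path \<omega> (j + i)\<bar>}"

lemma maxset_sets: "maxset X j N \<in> sets M"
  unfolding maxset_def by measurable

text \<open>The Fuk-Nagaev inequality at all levels C 4^l a_n at once, with a bound that does not
  depend on the starting index \<open>j\<close>. The weights 4^l measure the size of a normalised
  maximal increment and are needed for \<open>increments_dominated\<close>; the upper law uses level
  0 only.\<close>

lemma maxset_level_bound: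
  fixes n :: "nat \<Rightarrow> nat"
  assumes \<rho>: "1 < \<rho>" and n0: "1 \<le> n 0" and n: "\<And>k. \<rho> * real (n k) \<le> real (n (Suc k))"
    and C: "0 < C" "\<sigma>2 < C\<^sup>2"
  obtains v G where "\<And>j k l. cap (maxset (C * 4 ^ l * lil_norm (n k)) j (n k)) \<le> v k l"
    "\<And>k l. 0 \<le> v k l" "\<And>l m. (\<Sum>k<m. 4 ^ l * v k l) \<le> G l" "summable G"
proof -
  note g = geometric_growth[OF \<rho> n0 n]
  \<comment> \<open>Strictly below C^2, so that the exponent \<theta> exceeds 1, and positive even
    for \<open>\<sigma>2 = 0\<close>, as the variance bound in the inequality must be.\<close>
  define \<tau> where "\<tau> = (\<sigma>2 + C\<^sup>2) / 2"
  have \<tau>: "0 < \<tau>" "\<sigma>2 \<le> \<tau>" "\<tau> < C\<^sup>2" using C \<sigma>2_nonneg by (auto simp: \<tau>_def add_nonneg_pos)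
  define \<theta> where "\<theta> = C\<^sup>2 / \<tau>"
  have \<theta>: "1 < \<theta>" using \<tau> by (simp add: \<theta>_def)
  define K1 where "K1 = 5 * exp (1 + 1 / (1/4 :: real))"
  have K1: "0 \<le> K1" by (simp add: K1_def)
  define e where "e k l = exp (- \<theta> * LL (real (n k)) * 16 ^ l)" for k l :: nat
  define u where "u k l = real (n k) * cube_tail ((C / 4 * 4 ^ l) * lil_norm (n k))" for k l :: nat
  define v where "v k l = K1 * (e k l + u k l)" for k l
  have a_pos: "0 < lil_norm (n k)" for k using lil_norm_pos[OF g(2)] .
  have u0: "0 \<le> u k l" for k l unfolding u_def using C a_pos by (intro mult_nonneg_nonneg cube_tail_nonneg) auto
  have v0: "0 \<le> v k l" for k l unfolding v_def using K1 u0 by (simp add: e_def)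
  have cap: "cap (maxset (C * 4 ^ l * lil_norm (n k)) j (n k)) \<le> v k l" for j k l
  proof -
    define X where "X = C * 4 ^ l * lil_norm (n k)"
    have nk: "0 < real (n k)" using g(2)[of k] by simp
    have "cap (maxset X j (n k)) \<le> 5 * exp (1 + 1 / (1/4)) * (exp (- X\<^sup>2 / (2 * (real (n k) * \<tau>))) + real (n k) * cube_tail (1/4 * X))"
      unfolding maxset_def using C a_pos[of k] \<tau> nk by (intro fuk_nagaev) (auto simp: X_def)
    also have "- X\<^sup>2 / (2 * (real (n k) * \<tau>)) = - \<theta> * LL (real (n k)) * 16 ^ l"
    proof -
      have "(4 ^ l)\<^sup>2 = (16 :: real) ^ l" by (simp add: power2_eq_square flip: power_mult_distrib)
      then have "X\<^sup>2 = C\<^sup>2 * 16 ^ l * (2 * real (n k) * LL (real (n k)))"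
        unfolding X_def power_mult_distrib lil_norm_sq by simp
      then show ?thesis using nk \<tau> by (simp add: \<theta>_def field_simps)
    qed
    also have "1/4 * X = (C / 4 * 4 ^ l) * lil_norm (n k)" by (simp add: X_def)
    finally show ?thesis unfolding X_def v_def K1_def e_def u_def .
  qed
  have es: "summable (\<lambda>k. exp (- \<theta> * LL (real (n k))))" by (rule exp_LL_summable[OF \<rho> g(1) \<theta>])
  define T where "T = suminf (\<lambda>k. exp (- \<theta> * LL (real (n k))))"
  have T: "(\<Sum>k<m. exp (- \<theta> * LL (real (n k)))) \<le> T" for m
    unfolding T_def using es by (intro sum_le_suminf) auto
  obtain Kq where Kq: "0 \<le> Kq" "\<And>r m. 0 < r \<Longrightarrow> (\<Sum>k<m. real (n k) * cube_tail (r * lil_norm (n k))) \<le> Kq * tail_weight r"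
    using cube_tail_sum_bound[OF \<rho> n0 n] by metis
  define G where "G l = K1 * (T * (1/4) ^ l + Kq * tail_weight (C / 4) * (1/2) ^ l)" for l :: nat
  have "(\<Sum>k<m. 4 ^ l * v k l) \<le> G l" for l m
  proof -
    \<comment> \<open>As \<theta> LL n \<ge> 1, the factor 16^l can be split off additively: one
      part gives the summable series in \<open>k\<close>, the other, exp(-(16^l - 1)) \<le> 16^-l,
      beats the weight.\<close>
    have "4 ^ l * e k l \<le> exp (- \<theta> * LL (real (n k))) * (1/4) ^ l" for k
    proof -
      have p: "(1::real) \<le> 16 ^ l" by (rule one_le_power) simp
      have "1 * 1 \<le> \<theta> * LL (real (n k))" using \<theta> LL_ge_1[of "n k"] by (intro mult_mono) auto
      then have "1 * (16 ^ l - 1) \<le> \<theta> * LL (real (n k)) * (16 ^ l - 1)" using p by (intro mult_right_mono) auto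
      then have "- \<theta> * LL (real (n k)) * 16 ^ l \<le> - \<theta> * LL (real (n k)) + - (16 ^ l - 1)"
        by (simp add: algebra_simps)
      then have "e k l \<le> exp (- \<theta> * LL (real (n k))) * exp (- (16 ^ l - 1))"
        unfolding e_def exp_add[symmetric] by simp
      also have "exp (- (16 ^ l - 1)) \<le> 1 / (16 ^ l :: real)"
      proof -
        have "(16 ^ l :: real) \<le> exp (16 ^ l - 1)" using exp_ge_add_one_self[of "16 ^ l - 1 :: real"] by simp
        then have "inverse (exp (16 ^ l - 1)) \<le> inverse (16 ^ l :: real)" by (rule le_imp_inverse_le) simp
        then show ?thesis unfolding exp_minus inverse_eq_divide[of "16 ^ l"] .
      qed
      finally have "4 ^ l * e k l \<le> 4 ^ l * (exp (- \<theta> * LL (real (n k))) * (1 / 16 ^ l))"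
        by (intro mult_left_mono) auto
      also have "\<dots> = exp (- \<theta> * LL (real (n k))) * (4 ^ l / 16 ^ l)" by simp
      also have "4 ^ l / 16 ^ l = (1/4 :: real) ^ l" by (simp flip: power_divide)
      finally show ?thesis .
    qed
    then have "(\<Sum>k<m. 4 ^ l * e k l) \<le> (\<Sum>k<m. exp (- \<theta> * LL (real (n k))) * (1/4) ^ l)"
      by (intro sum_mono)
    also have "\<dots> = (\<Sum>k<m. exp (- \<theta> * LL (real (n k)))) * (1/4) ^ l"
      by (rule sum_distrib_right[symmetric])
    also have "\<dots> \<le> T * (1/4) ^ l" by (intro mult_right_mono T) simp
    finally have 1: "(\<Sum>k<m. 4 ^ l * e k l) \<le> T * (1/4) ^ l" .
    have "(\<Sum>k<m. u k l) \<le> Kq * tail_weight (C / 4 * 4 ^ l)"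
      unfolding u_def using C by (intro Kq(2)) auto
    also have "\<dots> \<le> Kq * (tail_weight (C / 4) / 8 ^ l)" using C Kq(1) by (intro mult_left_mono tail_weight_mult_le) auto
    finally have "4 ^ l * (\<Sum>k<m. u k l) \<le> 4 ^ l * (Kq * (tail_weight (C / 4) / 8 ^ l))" by (intro mult_left_mono) auto
    also have "\<dots> = Kq * tail_weight (C / 4) * (4 ^ l / 8 ^ l)" by simp
    also have "4 ^ l / 8 ^ l = (1/2 :: real) ^ l" by (simp flip: power_divide)
    finally have 2: "(\<Sum>k<m. 4 ^ l * u k l) \<le> Kq * tail_weight (C / 4) * (1/2) ^ l" by (simp add: sum_distrib_left)
    have "(\<Sum>k<m. 4 ^ l * v k l) = K1 * ((\<Sum>k<m. 4 ^ l * e k l) + (\<Sum>k<m. 4 ^ l * u k l))"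
      by (simp add: v_def sum_distrib_left sum.distrib algebra_simps)
    also have "\<dots> \<le> G l" unfolding G_def using 1 2 K1 by (intro mult_left_mono add_mono) auto
    finally show ?thesis .
  qed
  moreover have "summable G" unfolding G_def
    by (intro summable_mult summable_add summable_mult) (auto intro!: summable_mult summable_geometric)
  ultimately show ?thesis using that cap v0 by blast
qed

text \<open>Supplies the majorant for dominated convergence. Since the level bound is the same for
  every start \<open>j\<close>, the capacities weighted by 4^l and \<open>b j\<close> have a finite
  sum over starts, levels and dyadic scales; so the corresponding sum of indicators converges
  outside a null set, and its row sums yield \<open>D\<close>.\<close>

lemma increments_dominated:
  assumes b: "summable b" "\<And>j. 0 < b j"
  shows "cap_star {\<omega>\<in>space M. \<not> (\<exists>D. summable (\<lambda>j. b j * D j) \<and>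
    (\<forall>j. \<forall>m\<ge>1. \<bar>\<Sum>i<m. path \<omega> (j + i)\<bar> \<le> D j * lil_norm m))} = 0"
proof -
  define n where "n k = (2::nat) ^ k" for k
  define C where "C = sqrt \<sigma>2 + 1"
  have "(sqrt \<sigma>2)\<^sup>2 < C\<^sup>2" using \<sigma>2_nonneg by (intro power_strict_mono) (auto simp: C_def)
  then have C: "0 < C" "\<sigma>2 < C\<^sup>2"
    using \<sigma>2_nonneg by (auto simp: C_def add_nonneg_pos)
  obtain v G where v: "\<And>j k l. cap (maxset (C * 4 ^ l * lil_norm (n k)) j (n k)) \<le> v k l"
    "\<And>k l. 0 \<le> v k l" "\<And>l m. (\<Sum>k<m. 4 ^ l * v k l) \<le> G l" "summable G"
    using maxset_level_bound[of 2 n C] C by (auto simp: n_def)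
  define h where "h = (\<lambda>p. 4 ^ fst p * v (snd p) (fst p))"
  have h0: "0 \<le> h p" for p using v(2) by (simp add: h_def)
  have hs: "summable (\<lambda>i. h (prod_decode i))"
    using h0 v(3,4) by (intro summable_prod_decode[of h G]) (auto simp: h_def)
  define H where "H i = h (prod_decode i)" for i
  \<comment> \<open>The index \<open>i\<close> encodes a pair of a level \<open>l\<close> and a
    dyadic scale \<open>k\<close>; \<open>lev i\<close> is the weight 4^l of its level.\<close>
  define B where "B j i = (case prod_decode i of (l, k) \<Rightarrow> maxset (C * 4 ^ l * lil_norm (n k)) j (n k))" for j i
  define lev where "lev i = (4::real) ^ fst (prod_decode i)" for i
  have capB: "lev i * cap (B j i) \<le> H i" for i j
    using v(1) by (simp add: lev_def B_def H_def h_def split: prod.split)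
  define f where "f = (\<lambda>p. b (fst p) * lev (snd p) * cap (B (fst p) (snd p)))"
  have f0: "0 \<le> f p" for p using b(2) upper_cap_eq(2) by (simp add: f_def lev_def less_imp_le)
  have fs: "summable (\<lambda>i. f (prod_decode i))"
  proof (rule summable_prod_decode[where G = "\<lambda>j. b j * suminf H", OF f0])
    fix j m
    have "(\<Sum>i<m. f (j, i)) \<le> (\<Sum>i<m. b j * H i)"
      using capB b(2) by (intro sum_mono) (auto simp: f_def mult.assoc less_imp_le intro!: mult_left_mono)
    also have "\<dots> = b j * (\<Sum>i<m. H i)" by (simp add: sum_distrib_left)
    also have "\<dots> \<le> b j * suminf H"
      using hs h0 b(2) by (intro mult_left_mono sum_le_suminf) (auto simp: H_def less_imp_le)
    finally show "(\<Sum>i<m. f (j, i)) \<le> b j * suminf H" .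
  qed (use b in \<open>intro summable_mult2\<close>)
  define w where "w i = b (fst (prod_decode i)) * lev (snd (prod_decode i))" for i
  define A where "A i = B (fst (prod_decode i)) (snd (prod_decode i))" for i
  have null: "cap_star {\<omega>\<in>space M. \<not> summable (\<lambda>i. w i * indicator (A i) \<omega> :: real)} = 0"
  proof (rule cap_star_summable_indicator)
    show "0 \<le> w i" for i using b(2) by (simp add: w_def lev_def less_imp_le)
    show "A i \<in> sets M" for i by (simp add: A_def B_def maxset_sets split: prod.split)
    show "summable (\<lambda>i. w i * cap (A i))" using fs by (simp add: f_def w_def A_def)
  qed
  have "\<exists>D. summable (\<lambda>j. b j * D j) \<and> (\<forall>j. \<forall>m\<ge>1. \<bar>\<Sum>i<m. path \<omega> (j + i)\<bar> \<le> D j * lil_norm m)"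
    if \<omega>: "\<omega> \<in> space M" and sm: "summable (\<lambda>i. w i * indicat_real (A i) \<omega>)" for \<omega>
  proof -
    define F where "F = (\<lambda>p. b (fst p) * lev (snd p) * indicat_real (B (fst p) (snd p)) \<omega>)"
    have F0: "0 \<le> F p" for p using b(2) by (simp add: F_def lev_def less_imp_le)
    have "summable (\<lambda>i. F (prod_decode i))" using sm by (simp add: F_def w_def A_def)
    then obtain D' where D': "summable D'" "\<And>j i. F (j, i) \<le> D' j"
      using summable_prod_decode_marginal[of F] F0 by metis
    \<comment> \<open>The factor 2 pays for rounding \<open>m\<close> up to a power of two, the
      factor 4 for the gap between consecutive levels, and the summand 1 covers values below the
      lowest level.\<close>
    define D where "D j = 2 * C * (1 + 4 * (D' j / b j))" for j
    have D'0: "0 \<le> D' j" for j using F0 D'(2) order_trans by blast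
    have key: "4 ^ l \<le> D' j / b j" if "\<omega> \<in> maxset (C * 4 ^ l * lil_norm (n k)) j (n k)" for j k l
      using D'(2)[of j "prod_encode (l, k)"] that b(2)[of j] by (simp add: F_def lev_def B_def field_simps)
    have "\<bar>\<Sum>i<m. path \<omega> (j + i)\<bar> \<le> D j * lil_norm m" if m: "1 \<le> m" for j m
    proof -
      define k where "k = (LEAST k. m \<le> 2 ^ k)"
      have km: "m \<le> 2 ^ k" unfolding k_def by (rule LeastI[of _ m]) (simp add: less_imp_le)
      have k2: "real (2 ^ k) \<le> 2 * real m"
      proof (cases k)
        case (Suc k')
        then have "\<not> m \<le> 2 ^ k'" using not_less_Least[of k' "\<lambda>k. m \<le> 2 ^ k"] by (simp add: k_def)
        then have "2 ^ k \<le> 2 * m" using Suc by simp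
        then show ?thesis by (metis of_nat_le_iff of_nat_mult of_nat_numeral)
      qed (use m in simp)
      define a where "a = lil_norm (n k)"
      have a: "0 < a" unfolding a_def n_def by (rule lil_norm_pos) simp
      have am: "a \<le> 2 * lil_norm m" unfolding a_def n_def using k2 by (rule lil_norm_double)
      define z where "z = \<bar>\<Sum>i<m. path \<omega> (j + i)\<bar>"
      have "z \<le> C * (1 + 4 * (D' j / b j)) * a"
      proof (cases "z < C * a")
        case True
        have "C * 1 * a \<le> C * (1 + 4 * (D' j / b j)) * a"
          using C a D'0[of j] b(2)[of j] by (intro mult_right_mono mult_left_mono) auto
        then show ?thesis using True by simp
      next
        case False
        \<comment> \<open>The highest level reached, so that the increment lies between the levels
          \<open>l\<close> and \<open>Suc l\<close> and the event of level \<open>l\<close>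
          occurs.\<close>
        define l where "l = (LEAST l. z < C * 4 ^ Suc l * a)"
        have "\<exists>l. z < C * 4 ^ Suc l * a"
        proof -
          obtain l where "z / (C * a) < 4 ^ l" using real_arch_pow[of 4 "z / (C * a)"] by auto
          also have "(4::real) ^ l \<le> 4 ^ Suc l" by simp
          finally have "z < C * 4 ^ Suc l * a" using C a by (simp add: pos_divide_less_eq mult_ac)
          then show ?thesis by blast
        qed
        then have l1: "z < C * 4 ^ Suc l * a" unfolding l_def by (rule LeastI_ex)
        have l2: "C * 4 ^ l * a \<le> z"
        proof (cases l)
          case (Suc l')
          then have "\<not> z < C * 4 ^ Suc l' * a" using not_less_Least[of l' "\<lambda>l. z < C * 4 ^ Suc l * a"] by (simp add: l_def)
          then show ?thesis using Suc by simp
        qed (use False in simp)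
        have "\<omega> \<in> maxset (C * 4 ^ l * lil_norm (n k)) j (n k)"
          unfolding maxset_def using \<omega> l2 m km by (auto simp: z_def a_def n_def)
        then have "4 ^ l \<le> D' j / b j" by (rule key)
        then have "C * 4 ^ Suc l * a \<le> C * (1 + 4 * (D' j / b j)) * a"
          using C a by (intro mult_right_mono mult_left_mono) auto
        then show ?thesis using l1 by linarith
      qed
      also have "\<dots> \<le> C * (1 + 4 * (D' j / b j)) * (2 * lil_norm m)"
        using C am D'0[of j] b(2)[of j] by (intro mult_left_mono) auto
      also have "\<dots> = D j * lil_norm m" by (simp add: D_def)
      finally show ?thesis unfolding z_def .
    qed
    moreover have "summable (\<lambda>j. b j * D j)"
    proof -
      have eq: "(\<lambda>j. b j * D j) = (\<lambda>j. 2 * C * (b j + 4 * D' j))"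
      proof
        fix j show "b j * D j = 2 * C * (b j + 4 * D' j)" using b(2)[of j] by (simp add: D_def field_simps)
      qed
      show ?thesis unfolding eq using b(1) D'(1) by (intro summable_mult summable_add)
    qed
    ultimately show ?thesis by blast
  qed
  then show ?thesis by (intro cap_star_null_mono[OF null]) blast
qed

text \<open>A dyadic block of indices contributes at most n_k \<open>cube_tail\<close>(e a_{n_k}),
  which is summable; Borel-Cantelli does the rest.\<close>

lemma path_negligible:
  assumes e: "0 < e"
  shows "cap_star {\<omega>\<in>space M. \<not> (\<forall>\<^sub>F n in sequentially. \<bar>path \<omega> n\<bar> < e * lil_norm n)} = 0"
proof -
  define n where "n k = (2::nat) ^ k" for k
  obtain K where K: "0 \<le> K" "\<And>r m. 0 < r \<Longrightarrow> (\<Sum>k<m. real (n k) * cube_tail (r * lil_norm (n k))) \<le> K * tail_weight r"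
    using cube_tail_sum_bound[of 2 n] by (auto simp: n_def)
  have a: "0 < lil_norm (n k)" for k by (rule lil_norm_pos) (simp add: n_def)
  have sm: "summable (\<lambda>k. real (n k) * cube_tail (e * lil_norm (n k)))"
    using K(2)[OF e] a e by (intro summableI_nonneg_bounded) (auto intro!: mult_nonneg_nonneg cube_tail_nonneg)
  define B where "B k = (\<Union>i\<in>{n k..<n (Suc k)}. {\<omega>\<in>space M. e * lil_norm (n k) \<le> \<bar>path \<omega> i\<bar>})" for k
  have capB: "cap (B k) \<le> real (n k) * cube_tail (e * lil_norm (n k))" for k
  proof -
    have "cap (B k) \<le> (\<Sum>i\<in>{n k..<n (Suc k)}. cap {\<omega>\<in>space M. e * lil_norm (n k) \<le> \<bar>path \<omega> i\<bar>})"
      unfolding B_def by (intro cap_UN) auto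
    also have "\<dots> \<le> (\<Sum>i\<in>{n k..<n (Suc k)}. cube_tail (e * lil_norm (n k)))"
      using a e by (intro sum_mono cap_path_ge) auto
    also have "\<dots> = real (n k) * cube_tail (e * lil_norm (n k))" by (simp add: n_def)
    finally show ?thesis .
  qed
  have null: "cap_star {\<omega>\<in>space M. \<not> (\<forall>\<^sub>F k in sequentially. \<omega> \<notin> B k)} = 0"
  proof (rule cap_star_borel_cantelli)
    show "B k \<in> sets M" for k unfolding B_def by measurable
    show "summable (\<lambda>k. cap (B k))"
      by (rule summable_comparison_test'[OF sm]) (use capB upper_cap_eq(2) in auto)
  qed
  have "\<forall>\<^sub>F n in sequentially. \<bar>path \<omega> n\<bar> < e * lil_norm n"
    if \<omega>: "\<omega> \<in> space M" and ev: "\<forall>\<^sub>F k in sequentially. \<omega> \<notin> B k" for \<omega>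
  proof -
    obtain k0 where k0: "\<And>k. k0 \<le> k \<Longrightarrow> \<omega> \<notin> B k" using ev by (auto simp: eventually_sequentially)
    have "\<bar>path \<omega> i\<bar> < e * lil_norm i" if i: "2 ^ k0 \<le> i" for i
    proof -
      have "1 \<le> i" using i order_trans[of 1 "2 ^ k0" i] by simp
      then obtain k where k: "2 ^ k \<le> i" "i < 2 ^ Suc k"
        using ex_power_ivl1[of 2 i] by auto
      have "(2::nat) ^ k0 < 2 ^ Suc k" using i k(2) by linarith
      then have "k0 < Suc k" by (rule power_less_imp_less_exp[rotated]) simp
      then have "k0 \<le> k" by simp
      then have "\<omega> \<notin> B k" by (rule k0)
      then have "\<bar>path \<omega> i\<bar> < e * lil_norm (n k)" using \<omega> k by (force simp: B_def n_def)
      also have "\<dots> \<le> e * lil_norm i" using e k(1) by (intro mult_left_mono lil_norm_mono) (auto simp: n_def)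
      finally show ?thesis .
    qed
    then show ?thesis by (auto simp: eventually_sequentially)
  qed
  then show ?thesis by (intro cap_star_null_mono[OF null]) blast
qed

text \<open>The maximal inequality along a geometric sequence with ratio near 1, then interpolation.
  The level is \<open>C\<close> along the subsequence, and the room between \<open>C\<close> and
  \<open>sqrt \<sigma>2 + e\<close> pays for the growth of the norm by at most the factor
  \<open>c\<close> between consecutive terms.\<close>

lemma partial_sums_upper:
  assumes e: "0 < e"
  shows "cap_star {\<omega>\<in>space M. \<not> (\<forall>\<^sub>F n in sequentially. \<bar>\<Sum>i<n. path \<omega> i\<bar> \<le> (sqrt \<sigma>2 + e) * lil_norm n)} = 0"
proof -
  define C where "C = sqrt \<sigma>2 + e / 2"
  have "(sqrt \<sigma>2)\<^sup>2 < C\<^sup>2" using \<sigma>2_nonneg e by (intro power_strict_mono) (auto simp: C_def)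
  then have C: "0 < C" "\<sigma>2 < C\<^sup>2"
    using \<sigma>2_nonneg e by (auto simp: C_def add_nonneg_pos)
  define c where "c = (sqrt \<sigma>2 + e) / C"
  have c: "1 < c" "C * c = sqrt \<sigma>2 + e" using C e by (auto simp: c_def field_simps) (auto simp: C_def)
  define \<rho> where "\<rho> = (1 + c) / 2"
  have \<rho>: "1 < \<rho>" "\<rho> < c" using c by (auto simp: \<rho>_def)
  \<comment> \<open>From \<open>N0\<close> on the error 1 made by rounding up is at most (c -
    \<rho>) n, so that consecutive terms differ by a factor between \<rho> and c.\<close>
  define N0 where "N0 = nat \<lceil>1 / (c - \<rho>)\<rceil> + 1"
  define n where "n = rec_nat N0 (\<lambda>_ m. nat \<lceil>\<rho> * real m\<rceil>)"
  have n0: "n 0 = N0" and nS: "n (Suc k) = nat \<lceil>\<rho> * real (n k)\<rceil>" for k by (simp_all add: n_def)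
  have nlow: "\<rho> * real (n k) \<le> real (n (Suc k))" for k unfolding nS by linarith
  have N01: "1 \<le> n 0" by (simp add: n0 N0_def)
  note g = geometric_growth[OF \<rho>(1) N01 nlow]
  have mono: "n k < n (Suc k)" for k
  proof -
    have "1 * real (n k) < \<rho> * real (n k)" using \<rho> g(2)[of k] by (intro mult_strict_right_mono) auto
    then show ?thesis using nlow[of k] by linarith
  qed
  then have sm: "strict_mono n" by (rule strict_mono_Suc_iff[THEN iffD2, rule_format])
  have nup: "real (n (Suc k)) \<le> c * real (n k)" for k
  proof -
    have "N0 \<le> n k" using sm n0 by (metis le0 strict_mono_less_eq)
    then have "1 / (c - \<rho>) \<le> real (n k)" unfolding N0_def by linarith
    then have "1 \<le> (c - \<rho>) * real (n k)" using \<rho> by (simp add: field_simps)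
    moreover have "0 \<le> \<rho> * real (n k)" using \<rho> by simp
    then have "real (n (Suc k)) \<le> \<rho> * real (n k) + 1" unfolding nS by linarith
    ultimately show ?thesis by (simp add: algebra_simps)
  qed
  \<comment> \<open>Squares gain at most c (1 + ln c) \<le> c^2, since ln c \<le> c - 1.\<close>
  have aup: "lil_norm (n (Suc k)) \<le> c * lil_norm (n k)" for k
  proof (rule power2_le_imp_le)
    have "(lil_norm (n (Suc k)))\<^sup>2 \<le> c * (1 + ln c) * (lil_norm (n k))\<^sup>2"
      using c nup by (intro lil_norm_mult_le) auto
    also have "\<dots> \<le> c * c * (lil_norm (n k))\<^sup>2"
      using c ln_le_minus_one[of c] by (intro mult_right_mono mult_left_mono) auto
    finally show "(lil_norm (n (Suc k)))\<^sup>2 \<le> (c * lil_norm (n k))\<^sup>2" by (simp add: power2_eq_square mult_ac)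
    show "0 \<le> c * lil_norm (n k)" using c lil_norm_pos[OF g(2)[of k]] by simp
  qed
  obtain v G where v: "\<And>j k l. cap (maxset (C * 4 ^ l * lil_norm (n k)) j (n k)) \<le> v k l"
    "\<And>k l. 0 \<le> v k l" "\<And>l m. (\<Sum>k<m. 4 ^ l * v k l) \<le> G l" "summable G"
    by (rule maxset_level_bound[OF \<rho>(1) N01 nlow C]) blast
  define B where "B k = maxset (C * lil_norm (n k)) 0 (n k)" for k
  have sv: "summable (\<lambda>k. v k 0)"
    using v(2) v(3)[of 0] by (intro summableI_nonneg_bounded[where x = "G 0"]) auto
  have null: "cap_star {\<omega>\<in>space M. \<not> (\<forall>\<^sub>F k in sequentially. \<omega> \<notin> B k)} = 0"
  proof (rule cap_star_borel_cantelli)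
    show "B k \<in> sets M" for k unfolding B_def by (rule maxset_sets)
    show "summable (\<lambda>k. cap (B k))"
      by (rule summable_comparison_test'[OF sv]) (use v(1)[of 0] upper_cap_eq(2) in \<open>auto simp: B_def\<close>)
  qed
  have "\<forall>\<^sub>F n in sequentially. \<bar>\<Sum>i<n. path \<omega> i\<bar> \<le> (sqrt \<sigma>2 + e) * lil_norm n"
    if \<omega>: "\<omega> \<in> space M" and ev: "\<forall>\<^sub>F k in sequentially. \<omega> \<notin> B k" for \<omega>
  proof -
    obtain k0 where k0: "\<And>k. k0 \<le> k \<Longrightarrow> \<omega> \<notin> B k" using ev by (auto simp: eventually_sequentially)
    have "\<bar>\<Sum>i<m. path \<omega> i\<bar> \<le> (sqrt \<sigma>2 + e) * lil_norm m" if m: "n k0 \<le> m" for m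
    proof -
      define k1 where "k1 = (LEAST k. m < n k)"
      have "m < n (Suc m)" using strict_mono_imp_increasing[OF sm, of "Suc m"] by simp
      then have m1: "m < n k1" unfolding k1_def by (rule LeastI)
      have "k0 < k1" using m m1 strict_mono_less_eq[OF sm, of k1 k0] by (simp add: not_le[symmetric])
      then obtain k where k: "k1 = Suc k" "k0 \<le> k" by (cases k1) auto
      have mk: "n k \<le> m" using not_less_Least[of k "\<lambda>k. m < n k"] k(1) by (simp add: k1_def)
      have mem: "m \<in> {1..n (Suc k)}" using m1 k(1) g(2)[of k] mk by auto
      have "\<omega> \<notin> B (Suc k)" using k(2) by (intro k0) simp
      then have "\<not> C * lil_norm (n (Suc k)) \<le> \<bar>\<Sum>i<m. path \<omega> (0 + i)\<bar>"
        using \<omega> mem unfolding B_def maxset_def by blast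
      then have "\<bar>\<Sum>i<m. path \<omega> i\<bar> < C * lil_norm (n (Suc k))"
        by simp
      also have "\<dots> \<le> C * (c * lil_norm (n k))" using C aup by (intro mult_left_mono) auto
      also have "\<dots> \<le> C * (c * lil_norm m)" using C c mk by (intro mult_left_mono lil_norm_mono) auto
      finally show ?thesis using c(2) by (simp add: mult.assoc[symmetric])
    qed
    then show ?thesis by (auto simp: eventually_sequentially)
  qed
  then show ?thesis by (intro cap_star_null_mono[OF null]) blast
qed

end

subsection \<open>Reduction of the linear process to partial sums\<close>

lemma dominated_infsum_tendsto_0:
  fixes f :: "nat \<Rightarrow> 'b \<Rightarrow> real"
  assumes w: "w summable_on UNIV" and fw: "\<And>n j. \<bar>f n j\<bar> \<le> w j" and lim: "\<And>j. (\<lambda>n. f n j) \<longlonglongrightarrow> 0"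
  shows "(\<lambda>n. infsum (f n) UNIV) \<longlonglongrightarrow> 0"
proof (rule tendstoI)
  fix e :: real assume e: "0 < e"
  have w0: "0 \<le> w j" for j using fw[of 0 j] by linarith
  have fs: "f n summable_on UNIV" for n
    by (rule abs_summable_summable, rule summable_on_comparison_test[OF w]) (use fw in auto)
  have "(w has_sum infsum w UNIV) UNIV" using w by (rule has_sum_infsum)
  then have "\<forall>\<^sub>F F in finite_subsets_at_top UNIV. dist (sum w F) (infsum w UNIV) < e / 2"
    unfolding has_sum_def using e by (intro tendstoD) auto
  then obtain F where F: "finite F" "dist (sum w F) (infsum w UNIV) < e / 2"
    by (metis (no_types, lifting) eventually_finite_subsets_at_top subset_UNIV order_refl)
  have "(\<lambda>n. \<Sum>j\<in>F. f n j) \<longlonglongrightarrow> (\<Sum>j\<in>F. 0)" by (intro tendsto_sum lim)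
  then have "\<forall>\<^sub>F n in sequentially. dist (\<Sum>j\<in>F. f n j) 0 < e / 2" using e by (intro tendstoD) auto
  then show "\<forall>\<^sub>F n in sequentially. dist (infsum (f n) UNIV) 0 < e"
  proof eventually_elim
    case (elim n)
    have split: "infsum g UNIV = sum g F + infsum g (- F)" if "g summable_on UNIV" for g :: "'b \<Rightarrow> real"
    proof -
      have "infsum g (F \<union> - F) = infsum g F + infsum g (- F)"
        using that F(1) by (intro infsum_Un_disjoint) (auto intro: summable_on_subset_banach)
      then show ?thesis using F(1) by (simp add: Compl_partition)
    qed
    have "\<bar>infsum (f n) (- F)\<bar> \<le> infsum w (- F)"
      using norm_infsum_le[OF has_sum_infsum has_sum_infsum, of "f n" "- F" w] fs w fw
      by (auto intro: summable_on_subset_banach)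
    then show ?case using elim F(2) split[OF fs[of n]] split[OF w] by (auto simp: dist_real_def)
  qed
qed

lemma lil_norm_at_top: "filterlim lil_norm at_top sequentially"
proof (rule filterlim_at_top_mono)
  show "filterlim (\<lambda>n. sqrt (real n)) at_top sequentially"
    by (intro filterlim_compose[OF sqrt_at_top] filterlim_real_sequentially)
  have "real n \<le> 2 * real n * LL (real n)" for n
    using mult_left_mono[OF LL_ge_1[of "real n"], of "2 * real n"] by simp
  then show "\<forall>\<^sub>F n in sequentially. sqrt (real n) \<le> lil_norm n"
    by (intro always_eventually allI) (simp add: lil_norm_LL)
qed

context
  fixes p :: "nat \<Rightarrow> real"
  assumes negl: "(\<lambda>n. p n / lil_norm n) \<longlonglongrightarrow> 0"
begin

lemma shifted_negligible: "(\<lambda>n. p (n + i) / lil_norm n) \<longlonglongrightarrow> 0"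
proof (rule Lim_null_comparison)
  show "(\<lambda>n. 2 * \<bar>p (n + i) / lil_norm (n + i)\<bar>) \<longlonglongrightarrow> 0"
    using tendsto_mult_right_zero[OF tendsto_rabs_zero[OF LIMSEQ_ignore_initial_segment[OF negl, of i]], of 2] .
  show "\<forall>\<^sub>F n in sequentially. norm (p (n + i) / lil_norm n) \<le> 2 * \<bar>p (n + i) / lil_norm (n + i)\<bar>"
    using eventually_ge_at_top[of "i + 1"]
  proof eventually_elim
    case (elim n)
    then have a: "0 < lil_norm n" "0 < lil_norm (n + i)" by (auto intro: lil_norm_pos)
    have "\<bar>p (n + i)\<bar> * lil_norm (n + i) \<le> \<bar>p (n + i)\<bar> * (2 * lil_norm n)"
      using elim by (intro mult_left_mono lil_norm_double) auto
    then show ?case using a by (simp add: field_simps)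
  qed
qed

lemma increment_negligible: "(\<lambda>n. ((\<Sum>i<n + k. p i) - (\<Sum>i<n. p i)) / lil_norm n) \<longlonglongrightarrow> 0"
proof -
  have "(\<Sum>i<n + k. p i) - (\<Sum>i<n. p i) = (\<Sum>i<k. p (n + i))" for n
    by (induction k) auto
  moreover have "(\<lambda>n. \<Sum>i<k. p (n + i) / lil_norm n) \<longlonglongrightarrow> (\<Sum>i<k. 0)"
    by (intro tendsto_sum shifted_negligible)
  ultimately show ?thesis by (simp add: sum_divide_distrib)
qed

text \<open>The weight with index j multiplies the block that starts at \<open>m = nat (- j)\<close>
  and has length \<open>n - nat j\<close>. One of the two numbers is always 0, so a block is either
  shifted or shortened, never both.\<close>

lemma shifted_block_negligible:
  "(\<lambda>n. ((\<Sum>i<n - k. p (m + i)) - (\<Sum>i<n. p i)) / lil_norm n) \<longlonglongrightarrow> 0" if "k = 0 \<or> m = 0"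
  using that
proof
  assume k: "k = 0"
  have eq: "(\<Sum>i<n. p (m + i)) = (\<Sum>i<n + m. p i) - (\<Sum>i<m. p i)" for n
    by (induction n) (auto simp: add.commute)
  have "(\<lambda>n. ((\<Sum>i<n + m. p i) - (\<Sum>i<n. p i)) / lil_norm n - (\<Sum>i<m. p i) / lil_norm n) \<longlonglongrightarrow> 0 - 0"
    by (intro tendsto_diff increment_negligible real_tendsto_divide_at_top[OF tendsto_const] lil_norm_at_top)
  moreover have "((\<Sum>i<n - k. p (m + i)) - (\<Sum>i<n. p i)) / lil_norm n
      = ((\<Sum>i<n + m. p i) - (\<Sum>i<n. p i)) / lil_norm n - (\<Sum>i<m. p i) / lil_norm n" for n
    unfolding k minus_nat.diff_0 eq by (simp add: diff_divide_distrib)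
  ultimately show ?thesis by simp
next
  assume m: "m = 0"
  have "(\<lambda>n. ((\<Sum>i<n. p i) - (\<Sum>i<n + k. p i)) / lil_norm (n + k)) \<longlonglongrightarrow> 0"
  proof (rule Lim_null_comparison)
    show "(\<lambda>n. \<bar>((\<Sum>i<n + k. p i) - (\<Sum>i<n. p i)) / lil_norm n\<bar>) \<longlonglongrightarrow> 0"
      by (intro tendsto_rabs_zero increment_negligible)
    show "\<forall>\<^sub>F n in sequentially. norm (((\<Sum>i<n. p i) - (\<Sum>i<n + k. p i)) / lil_norm (n + k))
      \<le> \<bar>((\<Sum>i<n + k. p i) - (\<Sum>i<n. p i)) / lil_norm n\<bar>"
      using eventually_ge_at_top[of 1]
    proof eventually_elim
      case (elim n)
      have "0 < lil_norm n" "lil_norm n \<le> lil_norm (n + k)"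
        using elim by (auto intro: lil_norm_pos lil_norm_mono)
      then show ?case by (auto simp: abs_minus_commute intro!: divide_left_mono mult_pos_pos)
    qed
  qed
  then show ?thesis using m by - (rule LIMSEQ_offset[of _ k], simp)
qed

end

text \<open>Interchanging the sums, \<open>process_sum\<close> is the \<open>\<beta>\<close>-mixture of the block sums
  \<open>\<Sum>i<n - nat j. Y (Suc (nat (- j) + i)) \<omega>\<close>; each differs from the partial sum of \<open>Y\<close> by
  \<open>o(lil_norm n)\<close>, and the majorant \<open>D\<close> makes this uniform.\<close>

lemma process_sum_asymptotic:
  fixes \<beta> :: "int \<Rightarrow> real" and Y :: "nat \<Rightarrow> 'a \<Rightarrow> real" and \<omega> :: 'a
  defines "p \<equiv> \<lambda>k. Y (Suc k) \<omega>"
  assumes \<beta>: "(\<lambda>j. \<bar>\<beta> j\<bar>) summable_on UNIV"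
    and D: "summable (\<lambda>j. (\<bar>\<beta> (- int j)\<bar> + (1/2) ^ j) * D j)"
      "\<And>j m. 1 \<le> m \<Longrightarrow> \<bar>\<Sum>i<m. p (j + i)\<bar> \<le> D j * lil_norm m"
    and negl: "(\<lambda>n. p n / lil_norm n) \<longlonglongrightarrow> 0"
  shows "(\<lambda>n. process_sum \<beta> Y n \<omega> / lil_norm n - (\<Sum>\<^sub>\<infinity>j. \<beta> j) * ((\<Sum>i<n. p i) / lil_norm n)) \<longlonglongrightarrow> 0"
proof -
  \<comment> \<open>For positive \<open>j\<close> the block starts at coordinate 0, hence the
    majorant is the constant \<open>D 0\<close> there.\<close>
  define W where "W j = D (nat (- j))" for j :: int
  define \<Delta> where "\<Delta> n j = (\<Sum>i<n - nat j. p (nat (- j) + i))" for n :: nat and j :: int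
  \<comment> \<open>Extended by 0 so that all series run over the same index set; it is the
    increment of \<open>\<Delta>\<close> from time t - 1 to t.\<close>
  define U where "U t j = (if j \<le> int t - 1 then Y (nat (int t - j)) \<omega> else 0)" for t :: nat and j :: int
  have D0: "0 \<le> D j" for j
  proof -
    have "0 \<le> \<bar>\<Sum>i<1. p (j + i)\<bar>" by simp
    also have "\<dots> \<le> D j * lil_norm 1" by (rule D(2)) simp
    finally show ?thesis using lil_norm_pos[of 1] by (simp add: zero_le_mult_iff)
  qed
  have W0: "0 \<le> W j" for j by (simp add: W_def D0)
  have \<Delta>_le: "\<bar>\<Delta> n j\<bar> \<le> W j * lil_norm n" for n j
  proof (cases "n - nat j = 0")
    case True
    then show ?thesis using W0[of j] lil_norm_nonneg[of n] by (simp add: \<Delta>_def)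
  next
    case False
    then have "\<bar>\<Delta> n j\<bar> \<le> W j * lil_norm (n - nat j)" unfolding \<Delta>_def W_def by (intro D(2)) simp
    also have "\<dots> \<le> W j * lil_norm n" by (intro mult_left_mono lil_norm_mono W0) simp
    finally show ?thesis .
  qed
  have step: "\<Delta> (Suc n) j = \<Delta> n j + U (Suc n) j" for n j
  proof (cases "nat j \<le> n")
    case True
    have "nat (int (Suc n) - j) = Suc (nat (- j) + (n - nat j))" using True by linarith
    moreover have "j \<le> int (Suc n) - 1" using True by linarith
    ultimately show ?thesis using True by (simp add: \<Delta>_def U_def Suc_diff_le p_def)
  next
    case False
    then have "\<not> j \<le> int (Suc n) - 1" by linarith
    then show ?thesis using False by (simp add: \<Delta>_def U_def)
  qed
  have w: "(\<lambda>j. \<bar>\<beta> j\<bar> * W j) summable_on UNIV"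
  proof -
    have "(\<lambda>j. \<bar>\<beta> j\<bar> * W j) summable_on {..0}"
    proof -
      have bij: "bij_betw (\<lambda>m. - int m) UNIV {..0}"
        by (rule bij_betwI[where g = "\<lambda>j. nat (- j)"]) auto
      have "summable (\<lambda>m. \<bar>\<beta> (- int m)\<bar> * D m)"
      proof (rule summable_comparison_test'[OF D(1)])
        fix m
        show "norm (\<bar>\<beta> (- int m)\<bar> * D m) \<le> (\<bar>\<beta> (- int m)\<bar> + (1/2) ^ m) * D m"
          using D0[of m] by (simp add: abs_mult mult_right_mono)
      qed
      then have "(\<lambda>m. \<bar>\<beta> (- int m)\<bar> * W (- int m)) summable_on UNIV"
        using D0 by (subst summable_on_UNIV_nonneg_real_iff) (auto simp: W_def)
      then show ?thesis using summable_on_reindex_bij_betw[OF bij, of "\<lambda>j. \<bar>\<beta> j\<bar> * W j"] by simp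
    qed
    moreover have "(\<lambda>j. \<bar>\<beta> j\<bar> * W j) summable_on {1..}"
    proof -
      have "(\<lambda>j. \<bar>\<beta> j\<bar> * D 0) summable_on {1..}"
        using \<beta> by (intro summable_on_cmult_left summable_on_subset_banach[OF \<beta>]) auto
      then show ?thesis by (rule summable_on_cong[THEN iffD1, rotated]) (simp add: W_def)
    qed
    ultimately have "(\<lambda>j. \<bar>\<beta> j\<bar> * W j) summable_on ({..0} \<union> {1..})"
      by (intro summable_on_Un_disjoint) auto
    moreover have "{..0} \<union> {1..} = (UNIV :: int set)" by auto
    ultimately show ?thesis by simp
  qed
  have s\<Delta>: "(\<lambda>j. \<beta> j * \<Delta> n j) summable_on UNIV" for n
  proof (rule abs_summable_summable, rule summable_on_comparison_test)
    show "(\<lambda>j. \<bar>\<beta> j\<bar> * W j * lil_norm n) summable_on UNIV" by (rule summable_on_cmult_left[OF w])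
    show "norm (\<beta> j * \<Delta> n j) \<le> \<bar>\<beta> j\<bar> * W j * lil_norm n" for j
      using mult_left_mono[OF \<Delta>_le[of n j], of "\<bar>\<beta> j\<bar>"] by (simp add: abs_mult mult.assoc)
  qed auto
  \<comment> \<open>The series that defines X_t converges as the difference of two dominated
    series.\<close>
  have sU: "(\<lambda>j. \<beta> j * U (Suc n) j) summable_on UNIV" for n
  proof -
    have "(\<lambda>j. \<beta> j * U (Suc n) j) = (\<lambda>j. \<beta> j * \<Delta> (Suc n) j - \<beta> j * \<Delta> n j)"
      by (simp add: step algebra_simps)
    then show ?thesis using summable_on_add[OF s\<Delta>[of "Suc n"] summable_on_uminus[THEN iffD2, OF s\<Delta>[of n]]] by simp
  qed
  have lin: "linear_process \<beta> Y t \<omega> = infsum (\<lambda>j. \<beta> j * U t j) UNIV" for t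
    unfolding linear_process_def by (rule infsum_cong_neutral) (auto simp: U_def)
  \<comment> \<open>The sums are interchanged by induction on \<open>n\<close>, which adds two
    convergent series at a time.\<close>
  have T: "process_sum \<beta> Y n \<omega> = infsum (\<lambda>j. \<beta> j * \<Delta> n j) UNIV" for n
  proof (induction n)
    case 0
    then show ?case by (simp add: process_sum_def \<Delta>_def)
  next
    case (Suc n)
    have "process_sum \<beta> Y (Suc n) \<omega> = infsum (\<lambda>j. \<beta> j * \<Delta> n j) UNIV + infsum (\<lambda>j. \<beta> j * U (Suc n) j) UNIV"
      using Suc by (simp add: process_sum_def lin)
    also have "\<dots> = infsum (\<lambda>j. \<beta> j * \<Delta> n j + \<beta> j * U (Suc n) j) UNIV"
      by (rule infsum_add[symmetric, OF s\<Delta> sU])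
    finally show ?case by (simp add: step algebra_simps)
  qed
  \<comment> \<open>Each block is compared with the block of index 0, which is the partial sum
    itself.\<close>
  define f where "f n j = \<beta> j * ((\<Delta> n j - \<Delta> n 0) / lil_norm n)" for n j
  have "(\<lambda>n. infsum (f n) UNIV) \<longlonglongrightarrow> 0"
  proof (rule dominated_infsum_tendsto_0)
    show "(\<lambda>j. \<bar>\<beta> j\<bar> * W j + \<bar>\<beta> j\<bar> * D 0) summable_on UNIV"
      by (intro summable_on_add w summable_on_cmult_left \<beta>)
    fix n j
    have dl: "\<bar>\<Delta> n j - \<Delta> n 0\<bar> \<le> (W j + D 0) * lil_norm n"
      using \<Delta>_le[of n j] \<Delta>_le[of n 0] by (simp add: W_def algebra_simps)
    have "\<bar>(\<Delta> n j - \<Delta> n 0) / lil_norm n\<bar> \<le> W j + D 0"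
    proof (cases "lil_norm n = 0")
      case False
      then have "0 < lil_norm n" using lil_norm_nonneg[of n] by simp
      then show ?thesis using dl by (simp add: pos_divide_le_eq)
    qed (use W0 D0 in \<open>simp add: add_nonneg_nonneg\<close>)
    then have "\<bar>\<beta> j\<bar> * \<bar>(\<Delta> n j - \<Delta> n 0) / lil_norm n\<bar> \<le> \<bar>\<beta> j\<bar> * (W j + D 0)" by (intro mult_left_mono) auto
    then show "\<bar>f n j\<bar> \<le> \<bar>\<beta> j\<bar> * W j + \<bar>\<beta> j\<bar> * D 0" by (simp only: f_def abs_mult distrib_left)
  next
    fix j
    have "nat j = 0 \<or> nat (- j) = 0" by linarith
    then have "(\<lambda>n. (\<Delta> n j - \<Delta> n 0) / lil_norm n) \<longlonglongrightarrow> 0"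
      using shifted_block_negligible[OF negl, of "nat j" "nat (- j)"] by (simp add: \<Delta>_def)
    then show "(\<lambda>n. f n j) \<longlonglongrightarrow> 0" unfolding f_def by (rule tendsto_mult_right_zero)
  qed
  moreover have "infsum (f n) UNIV = process_sum \<beta> Y n \<omega> / lil_norm n - (\<Sum>\<^sub>\<infinity>j. \<beta> j) * ((\<Sum>i<n. p i) / lil_norm n)" for n
  proof -
    have s\<beta>: "\<beta> summable_on UNIV" by (rule abs_summable_summable) (use \<beta> in simp)
    have "f n = (\<lambda>j. \<beta> j * \<Delta> n j / lil_norm n - \<beta> j * (\<Delta> n 0 / lil_norm n))"
      by (auto simp: f_def diff_divide_distrib algebra_simps)
    then have fn: "f n = (\<lambda>j. \<beta> j * \<Delta> n j * inverse (lil_norm n) + \<beta> j * (- (\<Delta> n 0 / lil_norm n)))"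
      by (simp add: divide_inverse)
    have "infsum (f n) UNIV = infsum (\<lambda>j. \<beta> j * \<Delta> n j * inverse (lil_norm n)) UNIV
        + infsum (\<lambda>j. \<beta> j * (- (\<Delta> n 0 / lil_norm n))) UNIV"
      unfolding fn by (rule infsum_add[OF summable_on_cmult_left[OF s\<Delta>] summable_on_cmult_left[OF s\<beta>]])
    also have "\<dots> = process_sum \<beta> Y n \<omega> / lil_norm n - (\<Sum>\<^sub>\<infinity>j. \<beta> j) * (\<Delta> n 0 / lil_norm n)"
      unfolding infsum_cmult_left' T by (simp add: divide_inverse)
    also have "\<Delta> n 0 = (\<Sum>i<n. p i)" by (simp add: \<Delta>_def)
    finally show ?thesis .
  qed
  ultimately show ?thesis by simp
qed

context lil_sequence
begin

text \<open>A single exceptional set has to serve every error \<open>e\<close>. Therefore errors of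
  the form 1 / (k + 1) are treated one by one and their null sets united, which relies on countable
  sub-additivity of \<open>cap_star\<close>.\<close>

lemma almost_sure_reduction:
  fixes \<beta> :: "int \<Rightarrow> real"
  assumes \<beta>: "(\<lambda>j. \<bar>\<beta> j\<bar>) summable_on UNIV"
  obtains N where "cap_star N = 0"
    "\<And>\<omega>. \<omega> \<in> space M \<Longrightarrow> \<omega> \<notin> N \<Longrightarrow> (\<lambda>n. path \<omega> n / lil_norm n) \<longlonglongrightarrow> 0"
    "\<And>\<omega> e. \<omega> \<in> space M \<Longrightarrow> \<omega> \<notin> N \<Longrightarrow> 0 < e \<Longrightarrow>
      \<forall>\<^sub>F n in sequentially. \<bar>\<Sum>i<n. path \<omega> i\<bar> \<le> (sqrt \<sigma>2 + e) * lil_norm n"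
    "\<And>\<omega>. \<omega> \<in> space M \<Longrightarrow> \<omega> \<notin> N \<Longrightarrow>
      (\<lambda>n. process_sum \<beta> Y n \<omega> / lil_norm n - (\<Sum>\<^sub>\<infinity>j. \<beta> j) * ((\<Sum>i<n. path \<omega> i) / lil_norm n)) \<longlonglongrightarrow> 0"
proof -
  \<comment> \<open>The summand \<open>(1/2) ^ j\<close> keeps the weights positive where \<beta>
    vanishes, as \<open>increments_dominated\<close> divides by them.\<close>
  define b where "b j = \<bar>\<beta> (- int j)\<bar> + (1/2) ^ j" for j
  have bs: "summable b"
  proof -
    have "(\<lambda>j. \<bar>\<beta> j\<bar>) summable_on range (\<lambda>m. - int m)" by (rule summable_on_subset_banach[OF \<beta>]) simp
    then have "(\<lambda>m. \<bar>\<beta> (- int m)\<bar>) summable_on UNIV"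
      by (subst (asm) summable_on_reindex) (auto simp: inj_on_def o_def)
    then have "summable (\<lambda>m. \<bar>\<beta> (- int m)\<bar>)" by (subst (asm) summable_on_UNIV_nonneg_real_iff) auto
    then show ?thesis unfolding b_def by (intro summable_add summable_geometric) auto
  qed
  have b0: "0 < b j" for j unfolding b_def by (intro add_nonneg_pos) auto
  define N1 where "N1 = {\<omega>\<in>space M. \<not> (\<exists>D. summable (\<lambda>j. b j * D j) \<and>
    (\<forall>j. \<forall>m\<ge>1. \<bar>\<Sum>i<m. path \<omega> (j + i)\<bar> \<le> D j * lil_norm m))}"
  define N2 where "N2 k = {\<omega>\<in>space M. \<not> (\<forall>\<^sub>F n in sequentially. \<bar>path \<omega> n\<bar> < (1 / real (Suc k)) * lil_norm n)}" for k
  define N3 where "N3 k = {\<omega>\<in>space M. \<not> (\<forall>\<^sub>F n in sequentially. \<bar>\<Sum>i<n. path \<omega> i\<bar> \<le> (sqrt \<sigma>2 + 1 / real (Suc k)) * lil_norm n)}" for k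
  define N where "N = N1 \<union> (\<Union>k. N2 k) \<union> (\<Union>k. N3 k)"
  have "cap_star N1 = 0" unfolding N1_def by (rule increments_dominated[OF bs b0])
  moreover have "cap_star (\<Union>k. N2 k) = 0" unfolding N2_def by (intro cap_star_null_UN path_negligible) simp
  moreover have "cap_star (\<Union>k. N3 k) = 0" unfolding N3_def by (intro cap_star_null_UN partial_sums_upper) simp
  ultimately have N: "cap_star N = 0" unfolding N_def by (simp add: cap_star_null_Un)
  have negl: "(\<lambda>n. path \<omega> n / lil_norm n) \<longlonglongrightarrow> 0" if \<omega>: "\<omega> \<in> space M" "\<omega> \<notin> N" for \<omega>
  proof (rule tendstoI)
    fix e :: real assume "0 < e"
    then obtain k where k: "1 / real (Suc k) < e" using nat_approx_posE by blast
    have "\<forall>\<^sub>F n in sequentially. \<bar>path \<omega> n\<bar> < (1 / real (Suc k)) * lil_norm n" using \<omega> by (auto simp: N_def N2_def)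
    then show "\<forall>\<^sub>F n in sequentially. dist (path \<omega> n / lil_norm n) 0 < e"
      using eventually_ge_at_top[of 1]
    proof eventually_elim
      case (elim n)
      have "0 < lil_norm n" using elim(2) by (rule lil_norm_pos)
      then have "\<bar>path \<omega> n\<bar> / lil_norm n < 1 / real (Suc k)" using elim(1) by (simp only: pos_divide_less_eq)
      then show ?case using k \<open>0 < lil_norm n\<close> by (simp add: abs_divide)
    qed
  qed
  have up: "\<forall>\<^sub>F n in sequentially. \<bar>\<Sum>i<n. path \<omega> i\<bar> \<le> (sqrt \<sigma>2 + e) * lil_norm n"
    if \<omega>: "\<omega> \<in> space M" "\<omega> \<notin> N" and e: "0 < e" for \<omega> e
  proof -
    obtain k where k: "1 / real (Suc k) < e" using nat_approx_posE[OF e] by blast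
    have "\<forall>\<^sub>F n in sequentially. \<bar>\<Sum>i<n. path \<omega> i\<bar> \<le> (sqrt \<sigma>2 + 1 / real (Suc k)) * lil_norm n"
      using \<omega> by (auto simp: N_def N3_def)
    then show ?thesis
    proof eventually_elim
      case (elim n)
      also have "(sqrt \<sigma>2 + 1 / real (Suc k)) * lil_norm n \<le> (sqrt \<sigma>2 + e) * lil_norm n"
        using k by (intro mult_right_mono lil_norm_nonneg) simp
      finally show ?case .
    qed
  qed
  have red: "(\<lambda>n. process_sum \<beta> Y n \<omega> / lil_norm n - (\<Sum>\<^sub>\<infinity>j. \<beta> j) * ((\<Sum>i<n. path \<omega> i) / lil_norm n)) \<longlonglongrightarrow> 0"
    if \<omega>: "\<omega> \<in> space M" "\<omega> \<notin> N" for \<omega>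
  proof -
    obtain D where D: "summable (\<lambda>j. b j * D j)"
      "\<And>j m. 1 \<le> m \<Longrightarrow> \<bar>\<Sum>i<m. path \<omega> (j + i)\<bar> \<le> D j * lil_norm m"
      using \<omega> by (auto simp: N_def N1_def)
    show ?thesis
      using process_sum_asymptotic[OF \<beta>, of D Y \<omega>] D negl[OF \<omega>] by (simp add: b_def path_def)
  qed
  show ?thesis by (rule that[OF N negl up red])
qed

end

subsection \<open>The lower half of the law\<close>

lemma LL_at_top: "filterlim (\<lambda>n. LL (real n)) at_top sequentially"
proof (rule filterlim_at_top_mono)
  show "filterlim (\<lambda>n. ln (ln (real n))) at_top sequentially"
    by (rule filterlim_compose[OF ln_at_top filterlim_compose[OF ln_at_top filterlim_real_sequentially]])
  show "\<forall>\<^sub>F n in sequentially. ln (ln (real n)) \<le> LL (real n)"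
    using eventually_ge_at_top[of 3]
  proof eventually_elim
    case (elim n)
    have "ln (exp 1) < ln (real n)" using e_less_272 elim by (intro ln_less_cancel_iff[THEN iffD2]) auto
    then have "1 < ln (real n)" by simp
    moreover have "ln (real n) \<le> llog (real n)" unfolding llog_def using elim by (intro ln_mono) auto
    ultimately have "ln (ln (real n)) \<le> ln (max (exp 1) (llog (real n)))" by (intro ln_mono) auto
    then show ?case by (simp add: LL_def llog_def)
  qed
qed

lemma LL_le_sqrt: assumes "1 \<le> x" shows "LL x \<le> 2 * sqrt x"
proof -
  have "LL x \<le> llog x" unfolding LL_def using llog_le[of "llog x"] llog_ge_1[of x] by simp
  also have "llog x \<le> 1 + ln x"
  proof -
    have "max (exp 1) x \<le> exp 1 * x"
      using assms mult_left_mono[OF assms, of "exp 1"] mult_right_mono[of 1 "exp 1" x] by simp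
    then have "llog x \<le> ln (exp 1 * x)" unfolding llog_def by (intro ln_mono) (auto simp: max.strict_coboundedI1)
    also have "\<dots> = 1 + ln x" using assms by (subst ln_mult_pos) auto
    finally show ?thesis .
  qed
  also have "\<dots> \<le> 2 * sqrt x" by (rule one_plus_ln_le[OF assms])
  finally show ?thesis .
qed

text \<open>The pointwise form of a change of measure. Under the weight exp(L), where L has size
  about \<Lambda>, the event that L lies outside the window is bounded by Chernoff estimates; the
  total exponents 1 + \<epsilon> and 1 - \<epsilon> are the optimal tilts for the two ends.\<close>

lemma tilt_pointwise:
  fixes L f \<epsilon> \<Lambda> :: real
  assumes \<epsilon>: "0 < \<epsilon>" and f: "0 \<le> f" "(1 - \<epsilon>) * \<Lambda> \<le> L \<Longrightarrow> L \<le> (1 + \<epsilon>) * \<Lambda> \<Longrightarrow> 1 \<le> f"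
  shows "exp L \<le> (exp ((1 + \<epsilon>) * \<Lambda>) * f + exp (- (\<epsilon> * (1 + \<epsilon>) * \<Lambda>)) * exp ((1 + \<epsilon>) * L)) + exp (\<epsilon> * (1 - \<epsilon>) * \<Lambda>) * exp ((1 - \<epsilon>) * L)"
proof -
  have nn: "0 \<le> exp ((1 + \<epsilon>) * \<Lambda>) * f" "0 \<le> exp (- (\<epsilon> * (1 + \<epsilon>) * \<Lambda>)) * exp ((1 + \<epsilon>) * L)"
    "0 \<le> exp (\<epsilon> * (1 - \<epsilon>) * \<Lambda>) * exp ((1 - \<epsilon>) * L)" using f(1) by auto
  consider "L < (1 - \<epsilon>) * \<Lambda>" | "(1 + \<epsilon>) * \<Lambda> < L" | "(1 - \<epsilon>) * \<Lambda> \<le> L" "L \<le> (1 + \<epsilon>) * \<Lambda>" by linarith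
  then show ?thesis
  proof cases
    case 1
    then have "\<epsilon> * L \<le> \<epsilon> * ((1 - \<epsilon>) * \<Lambda>)" using \<epsilon> by (intro mult_left_mono) auto
    then have "L \<le> \<epsilon> * (1 - \<epsilon>) * \<Lambda> + (1 - \<epsilon>) * L" by (simp add: algebra_simps)
    then have "exp L \<le> exp (\<epsilon> * (1 - \<epsilon>) * \<Lambda>) * exp ((1 - \<epsilon>) * L)" by (simp flip: exp_add)
    then show ?thesis using nn by linarith
  next
    case 2
    then have "\<epsilon> * ((1 + \<epsilon>) * \<Lambda>) \<le> \<epsilon> * L" using \<epsilon> by (intro mult_left_mono) auto
    then have "L \<le> - (\<epsilon> * (1 + \<epsilon>) * \<Lambda>) + (1 + \<epsilon>) * L" by (simp add: algebra_simps)
    then have "exp L \<le> exp (- (\<epsilon> * (1 + \<epsilon>) * \<Lambda>)) * exp ((1 + \<epsilon>) * L)" by (simp flip: exp_add)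
    then show ?thesis using nn by linarith
  next
    case 3
    then have "exp L * 1 \<le> exp ((1 + \<epsilon>) * \<Lambda>) * f" using f(2) by (intro mult_mono) auto
    then show ?thesis using nn by linarith
  qed
qed

lemma power_one_plus_ge:
  fixes z \<eta> :: real
  assumes "0 \<le> z" "z \<le> \<eta>" "\<eta> \<le> 1"
  shows "exp ((1 - \<eta>) * (real N * z)) \<le> (1 + z) ^ N"
proof -
  have "z * (1 - \<eta>) \<le> z * (1 - z)" using assms by (intro mult_left_mono) auto
  also have "\<dots> = z - z\<^sup>2" by (simp add: algebra_simps power2_eq_square)
  also have "\<dots> \<le> ln (1 + z)" using assms by (intro ln_one_plus_pos_lower_bound) auto
  finally have "real N * (z * (1 - \<eta>)) \<le> real N * ln (1 + z)" by (intro mult_left_mono) auto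
  then have "exp ((1 - \<eta>) * (real N * z)) \<le> exp (real N * ln (1 + z))" by (simp add: mult_ac)
  also have "\<dots> = (1 + z) ^ N" using assms by (simp add: exp_of_nat_mult)
  finally show ?thesis .
qed

text \<open>Factorials: the ratio k + 2 of consecutive ends tends to infinity, so that the past of a
  block is negligible, while LL of the ends grows only like ln k, so that the hitting bounds have a
  divergent sum.\<close>

definition block_end :: "nat \<Rightarrow> nat" where "block_end k = fact (Suc k)"

lemma block_end_Suc: "block_end (Suc k) = (k + 2) * block_end k" by (simp add: block_end_def)

lemma block_end_ge_1: "1 \<le> block_end k" unfolding block_end_def by (rule fact_ge_1)

lemma block_end_ge: "k < block_end k" unfolding block_end_def using fact_ge_self[of "Suc k"] by linarith

lemma block_end_mono: "k \<le> k' \<Longrightarrow> block_end k \<le> block_end k'" unfolding block_end_def by (intro fact_mono) simp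

lemma block_end_at_top: "filterlim block_end at_top sequentially"
  by (rule filterlim_at_top_mono[OF filterlim_ident]) (auto intro: always_eventually less_imp_le block_end_ge)

section \<open>The upper expectation of hitting a window in one block\<close>

context lil_sequence
begin

definition clipped_sum :: "real \<Rightarrow> nat \<Rightarrow> nat \<Rightarrow> (nat \<Rightarrow> real) \<Rightarrow> real" where
  "clipped_sum y j N x = (\<Sum>i<N. clip y (x (j + i)))"

lemma bdd_lip_clipped_sum [bdd_lip_intros]: "j + N \<le> n \<Longrightarrow> bdd_lip (vdist n) (clipped_sum y j N)"
  unfolding clipped_sum_def by (intro bdd_lip_intros) auto

lemma E_path_exp_clipped_sum: "E_path (\<lambda>x. exp (l * clipped_sum y j N x)) = E_Y (\<lambda>t. exp (l * clip y t)) ^ N"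
proof -
  have "E_path (\<lambda>x. \<Prod>i<N. exp (l * clip y (x (j + i)))) = E_Y (\<lambda>t. exp (l * clip y t)) ^ N"
    by (rule E_path_prod) (auto intro!: bdd_lip_intros)
  moreover have "exp (l * clipped_sum y j N x) = (\<Prod>i<N. exp (l * clip y (x (j + i))))" for x
    by (simp add: clipped_sum_def sum_distrib_left exp_sum)
  ultimately show ?thesis by simp
qed

text \<open>Put L = l \<open>clipped_sum\<close>. The upper expectation of exp(L) is about
  exp(\<Lambda>/2), while both Chernoff terms are only of order exp((1 - \<epsilon>^2) \<Lambda>/2);
  so the window term must carry the expectation. Dividing by exp((1 + \<epsilon>) \<Lambda>) leaves
  about exp(-(1/2 + \<epsilon>) \<Lambda>), and a second \<epsilon> \<Lambda> pays for the remaining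
  errors.\<close>

lemma tilted_window_bound:
  fixes f :: "(nat \<Rightarrow> real) \<Rightarrow> real"
  defines "v \<equiv> \<lambda>y. E_Y (\<lambda>t. (clip y t)\<^sup>2)"
  assumes \<epsilon>: "0 < \<epsilon>" "\<epsilon> \<le> 1" and \<sigma>: "0 < \<sigma>2" and y: "0 < y" and N: "1 \<le> N"
    and \<Lambda>: "\<Lambda> = l\<^sup>2 * real N * \<sigma>2" and c: "c = real N * (\<bar>l\<bar> * (\<sigma>2 / y))"
    and good: "real N * (exp (2 * \<bar>(1 + \<epsilon>) * l\<bar> * y) * cube_tail y) \<le> 1"
    and var: "(1 - \<epsilon>\<^sup>2 / 4) * \<sigma>2 \<le> v y"
    and small: "\<Lambda> / (2 * real N) \<le> \<epsilon>\<^sup>2 / 4" and large: "12 * c + 16 \<le> \<epsilon>\<^sup>2 * \<Lambda>"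
    and f: "bdd_lip (vdist (j + N)) f" "\<And>x. 0 \<le> f x"
      "\<And>x. (1 - \<epsilon>) * \<Lambda> \<le> l * clipped_sum y j N x \<Longrightarrow> l * clipped_sum y j N x \<le> (1 + \<epsilon>) * \<Lambda> \<Longrightarrow> 1 \<le> f x"
  shows "exp (- (1/2 + 2 * \<epsilon>) * \<Lambda>) \<le> E_path f"
proof -
  define A where "A \<mu> = E_path (\<lambda>x. exp (\<mu> * (l * clipped_sum y j N x)))" for \<mu>
  have c0: "0 \<le> c" unfolding c using y \<sigma> by simp
  have \<Lambda>0: "0 \<le> \<Lambda>" unfolding \<Lambda> using \<sigma> by simp
  have q0: "0 \<le> cube_tail y" by (rule cube_tail_nonneg[OF y])
  have Aeq: "A \<mu> = E_Y (\<lambda>t. exp ((\<mu> * l) * clip y t)) ^ N" for \<mu>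
    unfolding A_def mult.assoc[symmetric] by (rule E_path_exp_clipped_sum)
  have eY0: "0 \<le> E_Y (\<lambda>t. exp (\<mu> * clip y t))" for \<mu>
  proof -
    have "bdd_lip rdist (\<lambda>t. exp (\<mu> * clip y t))" by (intro bdd_lip_intros)
    then show ?thesis using E_Y_mono[OF bdd_lip_const[of _ 0]] by fastforce
  qed
  \<comment> \<open>The hypothesis \<open>good\<close> is stated for the largest tilt and thus
    covers every \<mu>; the linear term gives \<mu> c, and \<mu> \<le> 2.\<close>
  have upper: "A \<mu> \<le> exp (2 * c + 1 + \<mu>\<^sup>2 / 2 * \<Lambda>)" if \<mu>: "0 \<le> \<mu>" "\<mu> \<le> 1 + \<epsilon>" for \<mu>
  proof -
    have "A \<mu> \<le> exp (\<bar>\<mu> * l\<bar> * (\<sigma>2 / y) + (\<mu> * l)\<^sup>2 / 2 * \<sigma>2 + exp (2 * \<bar>\<mu> * l\<bar> * y) * cube_tail y) ^ N"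
      unfolding Aeq by (intro power_mono mgf_upper y eY0)
    also have "\<dots> = exp (real N * (\<bar>\<mu> * l\<bar> * (\<sigma>2 / y) + (\<mu> * l)\<^sup>2 / 2 * \<sigma>2 + exp (2 * \<bar>\<mu> * l\<bar> * y) * cube_tail y))"
      by (rule exp_of_nat_mult[symmetric])
    also have "\<dots> \<le> exp (2 * c + 1 + \<mu>\<^sup>2 / 2 * \<Lambda>)"
    proof -
      have 1: "real N * (\<bar>\<mu> * l\<bar> * (\<sigma>2 / y)) \<le> 2 * c"
      proof -
        have "real N * (\<bar>\<mu> * l\<bar> * (\<sigma>2 / y)) = \<mu> * c" using \<mu> by (simp add: c abs_mult)
        also have "\<dots> \<le> 2 * c" using \<mu> \<epsilon> c0 by (intro mult_right_mono) auto
        finally show ?thesis .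
      qed
      have 2: "real N * ((\<mu> * l)\<^sup>2 / 2 * \<sigma>2) = \<mu>\<^sup>2 / 2 * \<Lambda>" by (simp add: \<Lambda> power_mult_distrib)
      have "\<bar>\<mu> * l\<bar> \<le> \<bar>(1 + \<epsilon>) * l\<bar>" using \<mu> \<epsilon> by (simp add: abs_mult mult_right_mono)
      then have "exp (2 * \<bar>\<mu> * l\<bar> * y) \<le> exp (2 * \<bar>(1 + \<epsilon>) * l\<bar> * y)" using y by simp
      then have "real N * (exp (2 * \<bar>\<mu> * l\<bar> * y) * cube_tail y) \<le> real N * (exp (2 * \<bar>(1 + \<epsilon>) * l\<bar> * y) * cube_tail y)"
        using q0 by (intro mult_left_mono mult_right_mono) auto
      then have 3: "real N * (exp (2 * \<bar>\<mu> * l\<bar> * y) * cube_tail y) \<le> 1" using good by linarith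
      show ?thesis using 1 2 3 unfolding distrib_left by simp
    qed
    finally show ?thesis .
  qed
  define \<eta> where "\<eta> = \<epsilon>\<^sup>2 / 4"
  have e2: "\<epsilon>\<^sup>2 \<le> \<epsilon>" "\<epsilon>\<^sup>2 \<le> 1" using \<epsilon> by (auto simp: power2_eq_square mult_left_le mult_le_one)
  have \<eta>: "0 < \<eta>" "\<eta> \<le> 1/4" using \<epsilon> e2 by (auto simp: \<eta>_def)
  \<comment> \<open>The variance bound and the passage from (1 + z)^N to an exponential each lose a
    factor 1 - \<eta>, together at most 2 \<eta>.\<close>
  have lower: "exp ((1 - 2 * \<eta>) * (\<Lambda> / 2) - (c + 1)) \<le> A 1"
  proof -
    define z where "z = l\<^sup>2 / 2 * ((1 - \<eta>) * \<sigma>2) - \<bar>l\<bar> * (\<sigma>2 / y) - exp (2 * \<bar>(1 + \<epsilon>) * l\<bar> * y) * cube_tail y"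
    have Nz: "real N * z = (1 - \<eta>) * (\<Lambda> / 2) - c - real N * (exp (2 * \<bar>(1 + \<epsilon>) * l\<bar> * y) * cube_tail y)"
      by (simp add: z_def \<Lambda> c algebra_simps)
    then have Nz2: "(1 - \<eta>) * (\<Lambda> / 2) - (c + 1) \<le> real N * z" using good by linarith
    have "3 * (c + 1) \<le> 3/8 * (\<epsilon>\<^sup>2 * \<Lambda>)" using large c0 by simp
    also have "\<epsilon>\<^sup>2 * \<Lambda> \<le> 1 * \<Lambda>" using e2 \<Lambda>0 by (intro mult_right_mono) auto
    also have "3/8 * (1 * \<Lambda>) \<le> (1 - \<eta>) * (\<Lambda> / 2)"
      using mult_right_mono[of "3/4" "1 - \<eta>" "\<Lambda> / 2"] \<eta> \<Lambda>0 by simp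
    finally have "0 \<le> real N * z" using Nz2 c0 by simp
    then have z0: "0 \<le> z" using N by (simp add: zero_le_mult_iff)
    have "0 \<le> \<bar>l\<bar> * (\<sigma>2 / y)" "0 \<le> exp (2 * \<bar>(1 + \<epsilon>) * l\<bar> * y) * cube_tail y" using y \<sigma> q0 by simp_all
    then have "z \<le> l\<^sup>2 / 2 * ((1 - \<eta>) * \<sigma>2)" unfolding z_def by linarith
    also have "\<dots> \<le> l\<^sup>2 / 2 * (1 * \<sigma>2)" using \<eta> \<sigma> by (intro mult_left_mono mult_right_mono) auto
    also have "\<dots> = \<Lambda> / (2 * real N)" using N by (simp add: \<Lambda>)
    \<comment> \<open>The point of the hypothesis \<open>small\<close>: the quadratic error in ln(1
      + z) is at most \<eta> z.\<close>
    finally have z1: "z \<le> \<eta>" using small by (simp add: \<eta>_def)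
    have "(1 - 2 * \<eta>) * (\<Lambda> / 2) - (c + 1) \<le> (1 - \<eta>) * ((1 - \<eta>) * (\<Lambda> / 2) - (c + 1))"
    proof -
      have 1: "(1 - 2 * \<eta>) * (\<Lambda> / 2) \<le> (1 - \<eta>) * (1 - \<eta>) * (\<Lambda> / 2)"
        using \<Lambda>0 by (intro mult_right_mono) (auto simp: algebra_simps)
      have 2: "(1 - \<eta>) * (c + 1) \<le> c + 1" using \<eta> c0 mult_right_mono[of "1 - \<eta>" 1 "c + 1"] by simp
      show ?thesis using diff_mono[OF 1 2]
        by (simp only: right_diff_distrib[of "1 - \<eta>" "(1 - \<eta>) * (\<Lambda> / 2)" "c + 1"] mult.assoc)
    qed
    also have "\<dots> \<le> (1 - \<eta>) * (real N * z)" using Nz2 \<eta> by (intro mult_left_mono) auto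
    finally have "exp ((1 - 2 * \<eta>) * (\<Lambda> / 2) - (c + 1)) \<le> exp ((1 - \<eta>) * (real N * z))" by simp
    also have "\<dots> \<le> (1 + z) ^ N" using z0 z1 \<eta> by (intro power_one_plus_ge) auto
    also have "\<dots> \<le> E_Y (\<lambda>t. exp ((1 * l) * clip y t)) ^ N"
    proof (rule power_mono)
      have "l\<^sup>2 / 2 * ((1 - \<eta>) * \<sigma>2) \<le> l\<^sup>2 / 2 * E_Y (\<lambda>t. (clip y t)\<^sup>2)"
        using var by (intro mult_left_mono) (auto simp: v_def \<eta>_def)
      moreover have "\<bar>l\<bar> \<le> \<bar>(1 + \<epsilon>) * l\<bar>"
        using \<epsilon> mult_right_mono[of 1 "1 + \<epsilon>" "\<bar>l\<bar>"] by (simp add: abs_mult)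
      then have "exp (2 * \<bar>l\<bar> * y) * cube_tail y \<le> exp (2 * \<bar>(1 + \<epsilon>) * l\<bar> * y) * cube_tail y"
        using y q0 by (intro mult_right_mono) auto
      ultimately show "1 + z \<le> E_Y (\<lambda>t. exp ((1 * l) * clip y t))"
        using mgf_lower[OF y, of l] by (simp add: z_def)
    qed (use z0 in simp)
    finally show ?thesis unfolding Aeq .
  qed
  \<comment> \<open>The common bound of both Chernoff terms: the exponents -\<epsilon>(1 +
    \<epsilon>) + (1 + \<epsilon>)^2/2 and \<epsilon>(1 - \<epsilon>) + (1 - \<epsilon>)^2/2 are
    both (1 - \<epsilon>^2)/2.\<close>
  define r where "r = exp (2 * c + 1 + (1 - \<epsilon>\<^sup>2) / 2 * \<Lambda>)"
  have bA: "bdd_lip (vdist (j + N)) (\<lambda>x. exp (\<mu> * (l * clipped_sum y j N x)))" for \<mu> by (intro bdd_lip_intros) auto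
  have "A 1 \<le> E_path (\<lambda>x. (exp ((1 + \<epsilon>) * \<Lambda>) * f x + exp (- (\<epsilon> * (1 + \<epsilon>) * \<Lambda>)) * exp ((1 + \<epsilon>) * (l * clipped_sum y j N x)))
      + exp (\<epsilon> * (1 - \<epsilon>) * \<Lambda>) * exp ((1 - \<epsilon>) * (l * clipped_sum y j N x)))"
    unfolding A_def
  proof (rule E_path_mono[OF bA])
    show "bdd_lip (vdist (j + N)) (\<lambda>x. (exp ((1 + \<epsilon>) * \<Lambda>) * f x + exp (- (\<epsilon> * (1 + \<epsilon>) * \<Lambda>)) * exp ((1 + \<epsilon>) * (l * clipped_sum y j N x)))
      + exp (\<epsilon> * (1 - \<epsilon>) * \<Lambda>) * exp ((1 - \<epsilon>) * (l * clipped_sum y j N x)))"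
      by (intro bdd_lip_add bdd_lip_mult bdd_lip_const f(1) bA)
    show "exp (1 * (l * clipped_sum y j N x)) \<le> (exp ((1 + \<epsilon>) * \<Lambda>) * f x + exp (- (\<epsilon> * (1 + \<epsilon>) * \<Lambda>)) * exp ((1 + \<epsilon>) * (l * clipped_sum y j N x)))
      + exp (\<epsilon> * (1 - \<epsilon>) * \<Lambda>) * exp ((1 - \<epsilon>) * (l * clipped_sum y j N x))" for x
      unfolding mult_1 by (rule tilt_pointwise[OF \<epsilon>(1) f(2) f(3)])
  qed
  also have "\<dots> \<le> E_path (\<lambda>x. exp ((1 + \<epsilon>) * \<Lambda>) * f x + exp (- (\<epsilon> * (1 + \<epsilon>) * \<Lambda>)) * exp ((1 + \<epsilon>) * (l * clipped_sum y j N x)))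
      + E_path (\<lambda>x. exp (\<epsilon> * (1 - \<epsilon>) * \<Lambda>) * exp ((1 - \<epsilon>) * (l * clipped_sum y j N x)))"
    by (intro E_path_add_le[where n = "j + N"] bdd_lip_add bdd_lip_mult bdd_lip_const f(1) bA)
  also have "E_path (\<lambda>x. exp ((1 + \<epsilon>) * \<Lambda>) * f x + exp (- (\<epsilon> * (1 + \<epsilon>) * \<Lambda>)) * exp ((1 + \<epsilon>) * (l * clipped_sum y j N x)))
    \<le> E_path (\<lambda>x. exp ((1 + \<epsilon>) * \<Lambda>) * f x) + E_path (\<lambda>x. exp (- (\<epsilon> * (1 + \<epsilon>) * \<Lambda>)) * exp ((1 + \<epsilon>) * (l * clipped_sum y j N x)))"
    by (intro E_path_add_le[where n = "j + N"] bdd_lip_add bdd_lip_mult bdd_lip_const f(1) bA)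
  also have "E_path (\<lambda>x. exp ((1 + \<epsilon>) * \<Lambda>) * f x) = exp ((1 + \<epsilon>) * \<Lambda>) * E_path f"
    by (rule E_path_scale[OF f(1)]) simp
  also have "E_path (\<lambda>x. exp (- (\<epsilon> * (1 + \<epsilon>) * \<Lambda>)) * exp ((1 + \<epsilon>) * (l * clipped_sum y j N x))) = exp (- (\<epsilon> * (1 + \<epsilon>) * \<Lambda>)) * A (1 + \<epsilon>)"
    unfolding A_def by (rule E_path_scale[OF bA]) simp
  also have "E_path (\<lambda>x. exp (\<epsilon> * (1 - \<epsilon>) * \<Lambda>) * exp ((1 - \<epsilon>) * (l * clipped_sum y j N x))) = exp (\<epsilon> * (1 - \<epsilon>) * \<Lambda>) * A (1 - \<epsilon>)"
    unfolding A_def by (rule E_path_scale[OF bA]) simp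
  also have "exp (- (\<epsilon> * (1 + \<epsilon>) * \<Lambda>)) * A (1 + \<epsilon>) \<le> r"
  proof -
    have "exp (- (\<epsilon> * (1 + \<epsilon>) * \<Lambda>)) * A (1 + \<epsilon>) \<le> exp (- (\<epsilon> * (1 + \<epsilon>) * \<Lambda>)) * exp (2 * c + 1 + (1 + \<epsilon>)\<^sup>2 / 2 * \<Lambda>)"
      using \<epsilon> by (intro mult_left_mono upper) auto
    also have "\<dots> = r"
      unfolding r_def exp_add[symmetric] by (simp add: power2_eq_square field_simps)
    finally show ?thesis .
  qed
  also have "exp (\<epsilon> * (1 - \<epsilon>) * \<Lambda>) * A (1 - \<epsilon>) \<le> r"
  proof -
    have "exp (\<epsilon> * (1 - \<epsilon>) * \<Lambda>) * A (1 - \<epsilon>) \<le> exp (\<epsilon> * (1 - \<epsilon>) * \<Lambda>) * exp (2 * c + 1 + (1 - \<epsilon>)\<^sup>2 / 2 * \<Lambda>)"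
      using \<epsilon> by (intro mult_left_mono upper) auto
    also have "\<dots> = r"
      unfolding r_def exp_add[symmetric] by (simp add: power2_eq_square field_simps)
    finally show ?thesis .
  qed
  finally have main: "A 1 \<le> exp ((1 + \<epsilon>) * \<Lambda>) * E_path f + r + r" by simp
  define L where "L = (1 - 2 * \<eta>) * (\<Lambda> / 2) - (c + 1)"
  have e4: "4 \<le> exp (2::real)" using exp_lower_Taylor_quadratic[of "2::real"] by simp
  have "4 * r \<le> exp 2 * r" using e4 by (intro mult_right_mono) (auto simp: r_def)
  also have "\<dots> = exp (2 + (2 * c + 1 + (1 - \<epsilon>\<^sup>2) / 2 * \<Lambda>))" unfolding r_def by (rule exp_add[symmetric])
  also have "\<dots> \<le> exp L"
  proof -
    \<comment> \<open>The exponent of \<open>r\<close> lies below \<open>L\<close> by \<epsilon>^2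
      \<Lambda>/4 - 3 c - 2; \<open>large\<close> makes this at least 2, and exp(2) \<ge> 4 lets two
      copies of \<open>r\<close> take at most half of exp(L).\<close>
    have "3 * c + 4 \<le> \<epsilon>\<^sup>2 * \<Lambda> / 4" using large by simp
    then have "2 + (2 * c + 1 + (1 - \<epsilon>\<^sup>2) / 2 * \<Lambda>) \<le> L" by (simp add: L_def \<eta>_def field_simps)
    then show ?thesis by simp
  qed
  finally have r4: "4 * r \<le> exp L" .
  have "exp L / 2 \<le> exp ((1 + \<epsilon>) * \<Lambda>) * E_path f" using main lower r4 unfolding L_def[symmetric] by simp
  moreover have "exp ((1 + \<epsilon>) * \<Lambda>) * exp (- (1/2 + 2 * \<epsilon>) * \<Lambda>) \<le> exp L / 2"
  proof -
    have "exp ((1 + \<epsilon>) * \<Lambda>) * exp (- (1/2 + 2 * \<epsilon>) * \<Lambda>) = exp ((1/2 - \<epsilon>) * \<Lambda>)"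
      by (simp add: algebra_simps flip: exp_add)
    also have "(1/2 - \<epsilon>) * \<Lambda> \<le> L - 1"
    proof -
      have "\<epsilon>\<^sup>2 * \<Lambda> \<le> \<epsilon> * \<Lambda>" using e2 \<Lambda>0 by (intro mult_right_mono)
      then have "c + 2 \<le> \<epsilon> * \<Lambda> - \<epsilon>\<^sup>2 * \<Lambda> / 4" using large c0 by linarith
      then show ?thesis by (simp add: L_def \<eta>_def field_simps)
    qed
    then have "exp ((1/2 - \<epsilon>) * \<Lambda>) \<le> exp (L - 1)" by simp
    also have "exp (L - 1) \<le> exp L / 2"
      unfolding exp_diff using exp_ge_add_one_self[of "1::real"] by (intro divide_left_mono) auto
    finally show ?thesis .
  qed
  ultimately have "exp ((1 + \<epsilon>) * \<Lambda>) * exp (- (1/2 + 2 * \<epsilon>) * \<Lambda>) \<le> exp ((1 + \<epsilon>) * \<Lambda>) * E_path f" by linarith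
  then show ?thesis by simp
qed


text \<open>A Lipschitz stand-in for the indicator that the block sum is close to z: it is 1 up to
  relative error \<epsilon> and 0 from relative error 2 \<epsilon> on. Dividing by z makes it work
  for targets of either sign.\<close>

definition window :: "real \<Rightarrow> real \<Rightarrow> real \<Rightarrow> nat \<Rightarrow> nat \<Rightarrow> (nat \<Rightarrow> real) \<Rightarrow> real" where
  "window z \<epsilon> y j N x = max 0 (min 1 (2 - \<bar>clipped_sum y j N x / z - 1\<bar> / \<epsilon>))"

lemma bdd_lip_window [bdd_lip_intros]: "j + N \<le> n \<Longrightarrow> bdd_lip (vdist n) (window z \<epsilon> y j N)"
  unfolding window_def by (intro bdd_lip_intros)

lemma window_range: "0 \<le> window z \<epsilon> y j N x" "window z \<epsilon> y j N x \<le> 1"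
  by (auto simp: window_def)

lemma window_nonzeroD: "0 < \<epsilon> \<Longrightarrow> window z \<epsilon> y j N x \<noteq> 0 \<Longrightarrow> \<bar>clipped_sum y j N x / z - 1\<bar> < 2 * \<epsilon>"
  by (auto simp: window_def max_def min_def field_simps split: if_splits)

lemma window_cong: "(\<And>i. j \<le> i \<Longrightarrow> i < j + N \<Longrightarrow> x i = x' i) \<Longrightarrow> window z \<epsilon> y j N x = window z \<epsilon> y j N x'"
  by (simp add: window_def clipped_sum_def)

text \<open>The tilt is chosen so that its centre is the target: \<Lambda> = 2 (x^2/\<sigma>2)
  \<kappa> LL n, which gives about exp(-(x^2/\<sigma>2) LL n). If the third moment is too large for
  the tilt, the claim holds because of the \<open>cube_tail\<close> summand, which is summable over
  the blocks and so does no harm later.\<close>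

lemma window_lower_bound:
  assumes x: "x \<noteq> 0" and \<epsilon>: "0 < \<epsilon>" "\<epsilon> \<le> 1" and \<sigma>: "0 < \<sigma>2" and \<theta>: "x\<^sup>2 / \<sigma>2 * (1 + 4 * \<epsilon>)\<^sup>2 \<le> \<theta>" "1/4 \<le> \<theta>"
  shows "\<exists>\<delta>>0. \<forall>\<^sub>F k in sequentially. exp (- \<theta> * LL (real (block_end (Suc k))))
    \<le> E_path (window (x * lil_norm (block_end (Suc k))) \<epsilon> (\<delta> * lil_norm (block_end (Suc k))) (block_end k) (block_end (Suc k) - block_end k))
      + real (block_end (Suc k)) * cube_tail (\<delta> * lil_norm (block_end (Suc k)))"
proof -
  \<comment> \<open>This makes the exponent in the third-moment term (1 + \<epsilon>) \<kappa> LL n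
    / 16, at most LL n / 4; hence the requirement \<open>1/4 \<le> \<theta>\<close>.\<close>
  define \<delta> where "\<delta> = \<sigma>2 / (64 * \<bar>x\<bar>)"
  have \<delta>: "0 < \<delta>" using \<sigma> x by (simp add: \<delta>_def)
  have block_end_lim: "filterlim (\<lambda>k. block_end (Suc k)) at_top sequentially"
    by (rule filterlim_compose[OF block_end_at_top filterlim_Suc])
  have LLlim: "filterlim (\<lambda>k. LL (real (block_end (Suc k)))) at_top sequentially"
    by (rule filterlim_compose[OF LL_at_top block_end_lim])
  have alim: "filterlim (\<lambda>k. \<delta> * lil_norm (block_end (Suc k))) at_top sequentially"
    using filterlim_tendsto_pos_mult_at_top[OF tendsto_const \<delta> filterlim_compose[OF lil_norm_at_top block_end_lim]] .
  have ev1: "\<forall>\<^sub>F k in sequentially. (1 - \<epsilon>\<^sup>2 / 4) * \<sigma>2 < E_Y (\<lambda>t. (clip (\<delta> * lil_norm (block_end (Suc k))) t)\<^sup>2)"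
  proof (rule order_tendstoD(1)[OF filterlim_compose[OF E_Y_clip2_tendsto alim]])
    show "(1 - \<epsilon>\<^sup>2 / 4) * \<sigma>2 < \<sigma>2" using \<epsilon> \<sigma> by (simp add: algebra_simps)
  qed
  define R where "R = x\<^sup>2 / \<sigma>2"
  have R: "0 < R" using x \<sigma> by (simp add: R_def)
  have ev2: "\<forall>\<^sub>F k in sequentially. 8 * R / sqrt (real (block_end (Suc k))) < \<epsilon>\<^sup>2 / 4"
  proof (rule order_tendstoD(2)[OF real_tendsto_divide_at_top[OF tendsto_const]])
    show "filterlim (\<lambda>k. sqrt (real (block_end (Suc k)))) at_top sequentially"
      by (rule filterlim_compose[OF sqrt_at_top filterlim_compose[OF filterlim_real_sequentially block_end_lim]])
  qed (use \<epsilon> in simp)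
  have ev3: "\<forall>\<^sub>F k in sequentially. (12 * 64 * R + 16) / (\<epsilon>\<^sup>2 * 2 * R) \<le> LL (real (block_end (Suc k)))"
    using LLlim unfolding filterlim_at_top by blast
  have ev4: "\<forall>\<^sub>F k in sequentially. 1 / (4 * \<epsilon>) \<le> real (k + 1)"
    by (rule eventually_mono[OF eventually_ge_at_top[of "nat \<lceil>1 / (4 * \<epsilon>)\<rceil>"]]) linarith
  have "\<forall>\<^sub>F k in sequentially. exp (- \<theta> * LL (real (block_end (Suc k))))
    \<le> E_path (window (x * lil_norm (block_end (Suc k))) \<epsilon> (\<delta> * lil_norm (block_end (Suc k))) (block_end k) (block_end (Suc k) - block_end k))
      + real (block_end (Suc k)) * cube_tail (\<delta> * lil_norm (block_end (Suc k)))"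
    using ev1 ev2 ev3 ev4
  proof eventually_elim
    case (elim k)
    define n where "n = block_end (Suc k)"
    define N where "N = block_end (Suc k) - block_end k"
    define a where "a = lil_norm n"
    define y where "y = \<delta> * a"
    \<comment> \<open>The tilt x a / (N \<sigma>2) shifts the block sum of variance N \<sigma>2 to
      the target x a.\<close>
    define l where "l = x * a / (real N * \<sigma>2)"
    \<comment> \<open>The ratio n / N: the norm belongs to the end of the block, while the block
      omits its past. It tends to 1.\<close>
    define \<kappa> where "\<kappa> = real (k + 2) / real (k + 1)"
    have n1: "1 \<le> n" unfolding n_def by (rule block_end_ge_1)
    have a: "0 < a" unfolding a_def by (rule lil_norm_pos[OF n1])
    have y: "0 < y" using a \<delta> by (simp add: y_def)
    have N_eq: "N = (k + 1) * block_end k" by (simp add: N_def block_end_Suc algebra_simps)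
    have N1: "1 \<le> N" unfolding N_eq using block_end_ge_1[of k] by simp
    have n\<kappa>: "real n = \<kappa> * real N" unfolding N_eq n_def block_end_Suc of_nat_mult \<kappa>_def by (simp del: of_nat_add)
    have \<kappa>: "1 \<le> \<kappa>" "\<kappa> \<le> 2" "\<kappa> \<le> 1 + 4 * \<epsilon>"
    proof -
      have "\<kappa> = 1 + 1 / real (k + 1)" by (simp add: \<kappa>_def field_simps)
      moreover have "1 / real (k + 1) \<le> 4 * \<epsilon>" using elim(4) \<epsilon> by (simp add: field_simps)
      moreover have "1 / real (k + 1) \<le> 1" "0 \<le> 1 / real (k + 1)" by simp_all
      ultimately show "1 \<le> \<kappa>" "\<kappa> \<le> 2" "\<kappa> \<le> 1 + 4 * \<epsilon>" by linarith+
    qed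
    define \<Lambda> where "\<Lambda> = l\<^sup>2 * real N * \<sigma>2"
    have a2: "a\<^sup>2 = 2 * (\<kappa> * real N) * LL n" unfolding a_def lil_norm_sq n\<kappa>[symmetric] ..
    have \<Lambda>eq: "\<Lambda> = 2 * R * \<kappa> * LL n"
      using N1 \<sigma> unfolding \<Lambda>_def l_def R_def power_divide power_mult_distrib a2
      by (simp add: field_simps power2_eq_square)
    have \<Lambda>x: "l * (x * a) = \<Lambda>" using N1 \<sigma> by (simp add: \<Lambda>_def l_def field_simps power2_eq_square)
    have \<Lambda>0: "0 < \<Lambda>" unfolding \<Lambda>eq using R \<kappa> LL_pos[of n] by simp
    define c where "c = real N * (\<bar>l\<bar> * (\<sigma>2 / y))"
    have c: "c = 64 * R"
    proof -
      have "c = \<bar>x\<bar> * a / y" unfolding c_def l_def using N1 \<sigma> a by (simp add: abs_mult)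
      also have "\<dots> = 64 * (\<bar>x\<bar> * \<bar>x\<bar>) / \<sigma>2" using a x \<sigma> by (simp add: y_def \<delta>_def)
      also have "\<dots> = 64 * R" by (simp add: R_def power2_eq_square)
      finally show ?thesis .
    qed
    let ?w = "window (x * a) \<epsilon> y (block_end k) N"
    have qn: "0 \<le> real n * cube_tail y" using cube_tail_nonneg[OF y] by simp
    have EN0: "0 \<le> E_path ?w"
      using E_path_mono[OF bdd_lip_const[of _ 0] bdd_lip_window[OF order_refl]] window_range(1) by fastforce
    have "exp (- \<theta> * LL n) \<le> E_path ?w + real n * cube_tail y"
    proof (cases "real N * (exp (2 * \<bar>(1 + \<epsilon>) * l\<bar> * y) * cube_tail y) \<le> 1")
      case True
      have "exp (- (1/2 + 2 * \<epsilon>) * \<Lambda>) \<le> E_path ?w"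
      proof (rule tilted_window_bound[OF \<epsilon> \<sigma> y N1 \<Lambda>_def c_def True])
        show "(1 - \<epsilon>\<^sup>2 / 4) * \<sigma>2 \<le> E_Y (\<lambda>t. (clip y t)\<^sup>2)" using elim(1) by (simp add: y_def a_def n_def)
        have "\<Lambda> / (2 * real N) = \<kappa> * \<Lambda> / (2 * real n)" unfolding n\<kappa> using \<kappa> N1 by simp
        also have "\<dots> = R * (\<kappa> * \<kappa>) * (LL n / n)" by (simp add: \<Lambda>eq)
        also have "\<dots> \<le> R * (2 * 2) * (2 * sqrt n / n)"
          using R \<kappa> LL_le_sqrt[of n] n1 LL_pos[of n]
          by (intro mult_mono divide_right_mono) (auto intro: less_imp_le)
        also have "\<dots> = 8 * R / sqrt n" using n1 by (simp add: field_simps)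
        also have "\<dots> \<le> \<epsilon>\<^sup>2 / 4" using elim(2) by (simp add: n_def)
        finally show "\<Lambda> / (2 * real N) \<le> \<epsilon>\<^sup>2 / 4" .
        have "12 * c + 16 \<le> LL n * (\<epsilon>\<^sup>2 * 2 * R)"
          using elim(3) R \<epsilon> unfolding c by (simp add: pos_divide_le_eq n_def)
        also have "\<dots> = \<epsilon>\<^sup>2 * (2 * R * 1 * LL n)" by simp
        also have "\<dots> \<le> \<epsilon>\<^sup>2 * \<Lambda>" unfolding \<Lambda>eq using R \<kappa> LL_pos[of n]
          by (intro mult_left_mono mult_right_mono) auto
        finally show "12 * c + 16 \<le> \<epsilon>\<^sup>2 * \<Lambda>" .
        show "bdd_lip (vdist (block_end k + N)) ?w" by (intro bdd_lip_window) simp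
        show "0 \<le> ?w z" for z by (rule window_range)
        fix z assume z: "(1 - \<epsilon>) * \<Lambda> \<le> l * clipped_sum y (block_end k) N z" "l * clipped_sum y (block_end k) N z \<le> (1 + \<epsilon>) * \<Lambda>"
        have eq: "clipped_sum y (block_end k) N z / (x * a) = l * clipped_sum y (block_end k) N z / \<Lambda>"
        proof -
          have "l \<noteq> 0" using \<Lambda>0 \<Lambda>x by auto
          then show ?thesis unfolding \<Lambda>x[symmetric] by simp
        qed
        have "l * clipped_sum y (block_end k) N z / \<Lambda> \<le> 1 + \<epsilon>" "1 - \<epsilon> \<le> l * clipped_sum y (block_end k) N z / \<Lambda>"
          using z \<Lambda>0 by (simp_all add: pos_divide_le_eq pos_le_divide_eq)
        then have "\<bar>clipped_sum y (block_end k) N z / (x * a) - 1\<bar> \<le> \<epsilon>" unfolding eq by linarith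
        then have "\<bar>clipped_sum y (block_end k) N z / (x * a) - 1\<bar> / \<epsilon> \<le> 1" using \<epsilon> by simp
        then show "1 \<le> ?w z" by (simp add: window_def)
      qed
      moreover have "exp (- \<theta> * LL n) \<le> exp (- (1/2 + 2 * \<epsilon>) * \<Lambda>)"
      proof -
        have "(1/2 + 2 * \<epsilon>) * \<Lambda> = R * ((1 + 4 * \<epsilon>) * \<kappa>) * LL n" by (simp add: \<Lambda>eq field_simps)
        also have "\<dots> \<le> R * ((1 + 4 * \<epsilon>) * (1 + 4 * \<epsilon>)) * LL n"
          using R \<epsilon> \<kappa> LL_pos[of n] by (intro mult_right_mono mult_left_mono) auto
        also have "\<dots> \<le> \<theta> * LL n"
          using \<theta>(1) LL_pos[of n] by (intro mult_right_mono) (auto simp: R_def power2_eq_square)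
        finally show ?thesis unfolding exp_le_cancel_iff mult_minus_left by (rule le_imp_neg_le)
      qed
      ultimately show ?thesis using qn by linarith
    next
      \<comment> \<open>The third-moment term exceeds 1, so n \<open>cube_tail\<close> is at least
        exp(-u), and u \<le> \<theta> LL n.\<close>
      case False
      define u where "u = 2 * \<bar>(1 + \<epsilon>) * l\<bar> * y"
      have "u = (1 + \<epsilon>) * (2 * (\<bar>l\<bar> * y))" using \<epsilon> by (simp add: u_def abs_mult)
      also have "\<bar>l\<bar> * y = \<Lambda> / (64 * R)"
      proof -
        have "\<bar>l\<bar> * y * (64 * R) = \<bar>l\<bar> * y * (real N * (\<bar>l\<bar> * (\<sigma>2 / y)))" using c unfolding c_def by simp
        also have "\<dots> = \<bar>l\<bar> * \<bar>l\<bar> * real N * \<sigma>2" using y by simp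
        also have "\<dots> = \<Lambda>" by (simp add: \<Lambda>_def power2_eq_square)
        finally show ?thesis using R by (simp add: field_simps)
      qed
      also have "(1 + \<epsilon>) * (2 * (\<Lambda> / (64 * R))) = (1 + \<epsilon>) * \<kappa> * LL n / 16" using R by (simp add: \<Lambda>eq)
      also have "\<dots> \<le> 2 * 2 * LL n / 16"
        using \<epsilon> \<kappa> LL_pos[of n] by (intro divide_right_mono mult_right_mono mult_mono) auto
      also have "\<dots> \<le> \<theta> * LL n" using mult_right_mono[OF \<theta>(2), of "LL n"] LL_pos[of n] by simp
      finally have u: "u \<le> \<theta> * LL n" .
      have "1 < real N * cube_tail y * exp u" using False by (simp add: u_def mult_ac)
      also have "\<dots> \<le> real n * cube_tail y * exp (\<theta> * LL n)"
        using u cube_tail_nonneg[OF y] block_end_mono[of k "Suc k"] by (intro mult_mono) (auto simp: N_def n_def)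
      finally have "exp (- \<theta> * LL n) \<le> real n * cube_tail y" by (simp add: exp_minus field_simps)
      then show ?thesis using EN0 by linarith
    qed
    then show ?case by (simp add: n_def N_def y_def a_def)
  qed
  then show ?thesis using \<delta> by blast
qed

end

text \<open>From m! \<le> m^m, LL(m!) is at most L + ln L with L = ln m. The excess ln L \<le> 2
  sqrt L is eventually below (1 - \<theta>) L, so the terms dominate the harmonic series.\<close>

lemma exp_LL_fact_not_summable:
  assumes \<theta>: "0 \<le> \<theta>" "\<theta> < 1"
  shows "\<not> summable (\<lambda>k. exp (- \<theta> * LL (real (block_end (Suc k)))))"
proof
  assume sm: "summable (\<lambda>k. exp (- \<theta> * LL (real (block_end (Suc k)))))"
  have lim: "filterlim (\<lambda>k. sqrt (ln (real (k + 2)))) at_top sequentially"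
    by (intro filterlim_compose[OF sqrt_at_top] filterlim_compose[OF ln_at_top]
        filterlim_compose[OF filterlim_real_sequentially] filterlim_add_const_nat_at_top)
  have "\<forall>\<^sub>F k in sequentially. 2 / (1 - \<theta>) \<le> sqrt (ln (real (k + 2)))"
    using lim unfolding filterlim_at_top by blast
  then have "\<forall>\<^sub>F k in sequentially. norm (1 / real (k + 2)) \<le> exp (- \<theta> * LL (real (block_end (Suc k))))"
    using eventually_ge_at_top[of 1]
  proof eventually_elim
    case (elim k)
    define m where "m = k + 2"
    have m3: "3 \<le> m" using elim(2) by (simp add: m_def)
    define L where "L = ln (real m)"
    have e3: "exp 1 < (3::real)" using e_less_272 by simp
    have L1: "1 \<le> L" using m3 e3 by (simp add: L_def ln_ge_iff)
    have "block_end (Suc k) = fact m" by (simp only: block_end_def m_def numeral_2_eq_2 add_Suc_right add_0_right)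
    then have "real (block_end (Suc k)) \<le> real (m ^ m)" using fact_le_power[of m, where 'a = real] by (simp only: of_nat_fact)
    then have "llog (real (block_end (Suc k))) \<le> llog (real (m ^ m))" by (rule llog_mono)
    also have "\<dots> = real m * L"
    proof -
      have "real 3 \<le> real m ^ 1" using m3 by simp
      also have "\<dots> \<le> real m ^ m" using m3 by (intro power_increasing) auto
      finally have "exp 1 \<le> real (m ^ m)" using e3 by simp
      then show ?thesis using m3 by (simp add: llog_def L_def ln_realpow)
    qed
    finally have "LL (real (block_end (Suc k))) \<le> llog (real m * L)" unfolding LL_def by (rule llog_mono)
    also have "llog (real m * L) = L + ln L"
    proof -
      have "3 * 1 \<le> real m * L" using m3 L1 by (intro mult_mono) auto
      then have "max (exp 1) (real m * L) = real m * L" using e3 by simp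
      then show ?thesis using m3 L1 by (simp add: llog_def L_def[symmetric] ln_mult_pos)
    qed
    also have "ln L \<le> 2 * sqrt L" using one_plus_ln_le[OF L1] by simp
    finally have LLm: "LL (real (block_end (Suc k))) \<le> L + 2 * sqrt L" by simp
    have "2 \<le> (1 - \<theta>) * sqrt L" using elim(1) \<theta> by (simp add: m_def L_def field_simps)
    then have "2 * sqrt L \<le> (1 - \<theta>) * sqrt L * sqrt L" using L1 by (intro mult_right_mono) auto
    then have s: "2 * sqrt L \<le> (1 - \<theta>) * L" using L1 by (simp add: mult.assoc)
    have "\<theta> * LL (real (block_end (Suc k))) \<le> \<theta> * (L + 2 * sqrt L)" using \<theta> LLm by (intro mult_left_mono) auto
    also have "\<dots> \<le> \<theta> * L + 1 * (2 * sqrt L)" using \<theta> L1 mult_right_mono[of \<theta> 1 "2 * sqrt L"] by (simp add: distrib_left)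
    also have "\<dots> \<le> L" using s by (simp add: algebra_simps)
    finally have "exp (- L) \<le> exp (- \<theta> * LL (real (block_end (Suc k))))" by simp
    moreover have "norm (1 / real m) = exp (- L)" using m3 by (simp add: L_def exp_minus divide_inverse)
    ultimately show ?case unfolding m_def[symmetric] by (simp only:)
  qed
  then have "summable (\<lambda>k. 1 / real (k + 2))"
    using sm by (rule summable_comparison_test_ev)
  then have "summable (\<lambda>n. inverse (real n))"
    using summable_iff_shift[of "\<lambda>n. inverse (real n)" 2] by (simp add: divide_inverse)
  then show False using not_summable_harmonic[where 'a = real] by simp
qed

lemma cluster_set_iff:
  "l \<in> cluster_set s \<longleftrightarrow> (\<forall>e>0. \<forall>m. \<exists>n\<ge>m. \<bar>s n - l\<bar> < e)"
proof
  assume "l \<in> cluster_set s"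
  then obtain r where r: "strict_mono r" "(s \<circ> r) \<longlonglongrightarrow> l" by (auto simp: cluster_set_def)
  show "\<forall>e>0. \<forall>m. \<exists>n\<ge>m. \<bar>s n - l\<bar> < e"
  proof (intro allI impI)
    fix e :: real and m assume "0 < e"
    then have "\<forall>\<^sub>F i in sequentially. dist ((s \<circ> r) i) l < e" using r(2) by (intro tendstoD)
    then have "\<forall>\<^sub>F i in sequentially. dist ((s \<circ> r) i) l < e \<and> m \<le> i"
      using eventually_ge_at_top[of m] by (rule eventually_conj)
    then obtain i where i: "dist ((s \<circ> r) i) l < e" "m \<le> i"
      by (metis (no_types, lifting) eventually_sequentially order_refl)
    have "m \<le> r i" using i(2) strict_mono_imp_increasing[OF r(1), of i] by linarith
    then show "\<exists>n\<ge>m. \<bar>s n - l\<bar> < e" using i(1) by (auto simp: dist_real_def)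
  qed
next
  assume H: "\<forall>e>0. \<forall>m. \<exists>n\<ge>m. \<bar>s n - l\<bar> < e"
  have "\<exists>r. \<forall>i. \<bar>s (r i) - l\<bar> < 1 / real (Suc i) \<and> r i < r (Suc i)"
  proof (rule dependent_nat_choice)
    show "\<exists>n. \<bar>s n - l\<bar> < 1 / real (Suc 0)" using H[rule_format, of "1 / real (Suc 0)" 0] by auto
    show "\<exists>n'. \<bar>s n' - l\<bar> < 1 / real (Suc (Suc i)) \<and> n < n'" for n i
      using H[rule_format, of "1 / real (Suc (Suc i))" "Suc n"] by (auto simp: Suc_le_eq)
  qed
  then obtain r where r: "\<And>i. \<bar>s (r i) - l\<bar> < 1 / real (Suc i)" "\<And>i. r i < r (Suc i)" by blast
  have "(\<lambda>i. s (r i) - l) \<longlonglongrightarrow> 0"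
  proof (rule Lim_null_comparison)
    show "\<forall>\<^sub>F i in sequentially. norm (s (r i) - l) \<le> 1 / real (Suc i)"
      using r(1) by (intro always_eventually allI) (simp add: less_imp_le)
    show "(\<lambda>i. 1 / real (Suc i)) \<longlonglongrightarrow> 0" using LIMSEQ_inverse_real_of_nat by (simp add: divide_inverse)
  qed
  then have "(s \<circ> r) \<longlonglongrightarrow> l" by (simp add: LIM_zero_iff o_def)
  moreover have "strict_mono r" using r(2) by (simp add: strict_mono_Suc_iff)
  ultimately show "l \<in> cluster_set s" unfolding cluster_set_def by blast
qed

section \<open>Products of windows over successive blocks\<close>

context lil_sequence
begin

definition window_at :: "real \<Rightarrow> real \<Rightarrow> real \<Rightarrow> nat \<Rightarrow> (nat \<Rightarrow> real) \<Rightarrow> real" where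
  "window_at x \<epsilon> \<delta> k = window (x * lil_norm (block_end (Suc k))) \<epsilon> (\<delta> * lil_norm (block_end (Suc k))) (block_end k) (block_end (Suc k) - block_end k)"

lemma bdd_lip_window_at: "block_end (Suc k) \<le> n \<Longrightarrow> bdd_lip (vdist n) (window_at x \<epsilon> \<delta> k)"
  unfolding window_at_def using block_end_mono[of k "Suc k"] by (intro bdd_lip_window) simp

lemma window_at_range: "0 \<le> window_at x \<epsilon> \<delta> k z" "window_at x \<epsilon> \<delta> k z \<le> 1"
  unfolding window_at_def by (rule window_range)+

lemma window_at_cong: "(\<And>i. block_end k \<le> i \<Longrightarrow> i < block_end (Suc k) \<Longrightarrow> z i = z' i) \<Longrightarrow> window_at x \<epsilon> \<delta> k z = window_at x \<epsilon> \<delta> k z'"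
  unfolding window_at_def using block_end_mono[of k "Suc k"] by (intro window_cong) auto

lemma E_path_window_at_range: "0 \<le> E_path (window_at x \<epsilon> \<delta> k)" "E_path (window_at x \<epsilon> \<delta> k) \<le> 1"
  using E_path_mono[OF bdd_lip_const[of _ 0] bdd_lip_window_at[OF order_refl], of x \<epsilon> \<delta> k]
    E_path_mono[OF bdd_lip_window_at[OF order_refl] bdd_lip_const[of _ 1], of x \<epsilon> \<delta> k] window_at_range by fastforce+

text \<open>The Lipschitz counterpart of the event that no block from \<open>K\<close> to
  \<open>K' - 1\<close> hits its window.\<close>

definition miss :: "real \<Rightarrow> real \<Rightarrow> real \<Rightarrow> nat \<Rightarrow> nat \<Rightarrow> (nat \<Rightarrow> real) \<Rightarrow> real" where
  "miss x \<epsilon> \<delta> K K' z = (\<Prod>k\<in>{K..<K'}. 1 - window_at x \<epsilon> \<delta> k z)"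

lemma bdd_lip_miss: "block_end K' \<le> n \<Longrightarrow> bdd_lip (vdist n) (miss x \<epsilon> \<delta> K K')"
  unfolding miss_def
  by (intro bdd_lip_intros bdd_lip_window_at) (auto intro: order_trans[OF block_end_mono] simp: Suc_le_eq)

lemma miss_range: "0 \<le> miss x \<epsilon> \<delta> K K' z" "miss x \<epsilon> \<delta> K K' z \<le> 1"
  unfolding miss_def using window_at_range by (auto intro!: prod_nonneg prod_le_1)

lemma miss_cong:
  assumes "\<And>i. block_end K \<le> i \<Longrightarrow> i < block_end K' \<Longrightarrow> z i = z' i" shows "miss x \<epsilon> \<delta> K K' z = miss x \<epsilon> \<delta> K K' z'"
  unfolding miss_def
proof (intro prod.cong refl arg_cong[of _ _ "\<lambda>t. 1 - t"] window_at_cong assms)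
  fix k i assume "k \<in> {K..<K'}" "block_end k \<le> i" "i < block_end (Suc k)"
  then show "block_end K \<le> i" "i < block_end K'" using block_end_mono[of K k] block_end_mono[of "Suc k" K'] by auto
qed

text \<open>An equality, although \<open>E\<close> does not commute with complements: 1 - P (1 - w)
  = (1 - P) + P w is affine in the last window w with nonnegative coefficient P. Replacing w by its
  mean p gives (1 - p)(1 - P) + p, whose upper expectation is again explicit.\<close>

lemma E_path_hit:
  "E_path (\<lambda>z. 1 - miss x \<epsilon> \<delta> K (K + m) z) = 1 - (\<Prod>k\<in>{K..<K + m}. 1 - E_path (window_at x \<epsilon> \<delta> k))"
proof (induction m)
  case 0
  then show ?case by (simp add: miss_def)
next
  case (Suc m)
  define p where "p = E_path (window_at x \<epsilon> \<delta> (K + m))"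
  have p: "0 \<le> p" "p \<le> 1" unfolding p_def by (rule E_path_window_at_range)+
  let ?P = "miss x \<epsilon> \<delta> K (K + m)"
  have bP: "bdd_lip (vdist (block_end (K + m))) ?P" by (rule bdd_lip_miss) simp
  have le: "block_end (K + m) \<le> block_end (Suc (K + m))" by (rule block_end_mono) simp
  have "E_path (\<lambda>z. 1 - miss x \<epsilon> \<delta> K (K + Suc m) z) = E_path (\<lambda>z. (1 - ?P z) + ?P z * window_at x \<epsilon> \<delta> (K + m) z)"
    by (simp add: miss_def algebra_simps)
  also have "\<dots> = E_path (\<lambda>z. (1 - ?P z) + ?P z * p)"
    unfolding p_def
  proof (rule E_path_block[where m = "block_end (Suc (K + m)) - block_end (K + m)"])
    show "bdd_lip (vdist (block_end (K + m))) (\<lambda>z. 1 - ?P z)" by (intro bdd_lip_intros bP)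
    show "bdd_lip (vdist (block_end (K + m) + (block_end (Suc (K + m)) - block_end (K + m)))) (window_at x \<epsilon> \<delta> (K + m))"
      using le by (intro bdd_lip_window_at) simp
    show "window_at x \<epsilon> \<delta> (K + m) z = window_at x \<epsilon> \<delta> (K + m) z'"
      if "\<And>i. block_end (K + m) \<le> i \<Longrightarrow> i < block_end (K + m) + (block_end (Suc (K + m)) - block_end (K + m)) \<Longrightarrow> z i = z' i" for z z'
      using that le by (intro window_at_cong) simp
  qed (auto intro: bP miss_range)
  also have "\<dots> = E_path (\<lambda>z. (1 - p) * (1 - ?P z) + p)" by (simp add: algebra_simps)
  also have "\<dots> = (1 - p) * E_path (\<lambda>z. 1 - ?P z) + p"
  proof -
    have b1: "bdd_lip (vdist (block_end (K + m))) (\<lambda>z. 1 - ?P z)" by (intro bdd_lip_intros bP)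
    have "E_path (\<lambda>z. (1 - p) * (1 - ?P z) + p) = E_path (\<lambda>z. (1 - p) * (1 - ?P z)) + p"
      by (rule E_path_add_const[OF bdd_lip_mult[OF bdd_lip_const b1]])
    then show ?thesis using E_path_scale[OF b1, of "1 - p"] p by simp
  qed
  finally show ?case unfolding Suc by (simp add: p_def algebra_simps)
qed

lemma E_path_mult_hit:
  assumes U: "bdd_lip (vdist (block_end K)) U" "\<And>z. 0 \<le> U z" and K: "K \<le> K'"
  shows "E_path (\<lambda>z. U z * (1 - miss x \<epsilon> \<delta> K K' z)) = E_path U * E_path (\<lambda>z. 1 - miss x \<epsilon> \<delta> K K' z)"
proof -
  let ?V = "\<lambda>z. 1 - miss x \<epsilon> \<delta> K K' z"
  have le: "block_end K \<le> block_end K'" by (rule block_end_mono[OF K])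
  have bV: "bdd_lip (vdist (block_end K')) ?V" by (intro bdd_lip_intros bdd_lip_miss) simp
  have "E_path (\<lambda>z. 0 + U z * ?V z) = E_path (\<lambda>z. 0 + U z * E_path ?V)"
  proof (rule E_path_block[OF bdd_lip_const U, where m = "block_end K' - block_end K"])
    show "bdd_lip (vdist (block_end K + (block_end K' - block_end K))) ?V" using bV le by simp
    show "?V z = ?V z'" if "\<And>i. block_end K \<le> i \<Longrightarrow> i < block_end K + (block_end K' - block_end K) \<Longrightarrow> z i = z' i" for z z'
      using miss_cong[of K K' z z'] that le by simp
  qed
  moreover have "0 \<le> E_path ?V" using E_path_mono[OF bdd_lip_const[of _ 0] bV] miss_range(2) by fastforce
  ultimately show ?thesis using E_path_scale[OF U(1), of "E_path ?V"] by (simp add: mult.commute)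
qed

text \<open>A second Borel-Cantelli lemma. The lower bounds exp(-\<theta> LL n) have a divergent sum
  and the \<open>cube_tail\<close> terms a convergent one, so the window expectations diverge and
  the product of the miss factors tends to 0.\<close>

lemma hitting_group:
  assumes x: "x \<noteq> 0" and \<epsilon>: "0 < \<epsilon>" "\<epsilon> \<le> 1" and \<sigma>: "0 < \<sigma>2" and v: "x\<^sup>2 / \<sigma>2 * (1 + 4 * \<epsilon>)\<^sup>2 < 1"
  obtains \<delta> where "0 < \<delta>" "\<And>K \<tau>. 0 < \<tau> \<Longrightarrow> \<exists>K'>K. 1 - \<tau> \<le> E_path (\<lambda>z. 1 - miss x \<epsilon> \<delta> K K' z)"
proof -
  define \<theta> where "\<theta> = max (1/4) (x\<^sup>2 / \<sigma>2 * (1 + 4 * \<epsilon>)\<^sup>2)"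
  have \<theta>: "1/4 \<le> \<theta>" "x\<^sup>2 / \<sigma>2 * (1 + 4 * \<epsilon>)\<^sup>2 \<le> \<theta>" "\<theta> < 1" using v by (auto simp: \<theta>_def)
  obtain \<delta> where \<delta>: "0 < \<delta>" "\<forall>\<^sub>F k in sequentially. exp (- \<theta> * LL (real (block_end (Suc k))))
    \<le> E_path (window_at x \<epsilon> \<delta> k) + real (block_end (Suc k)) * cube_tail (\<delta> * lil_norm (block_end (Suc k)))"
    using window_lower_bound[OF x \<epsilon> \<sigma> \<theta>(2,1)] unfolding window_at_def by blast
  obtain C where C: "0 \<le> C" "\<And>r m. 0 < r \<Longrightarrow> (\<Sum>k<m. real (block_end (Suc k)) * cube_tail (r * lil_norm (block_end (Suc k)))) \<le> C * tail_weight r"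
  proof (rule cube_tail_sum_bound[of 2 "\<lambda>k. block_end (Suc k)"])
    show "2 * real (block_end (Suc k)) \<le> real (block_end (Suc (Suc k)))" for k
      unfolding block_end_Suc[of "Suc k"] of_nat_mult by (intro mult_right_mono) auto
  qed (use block_end_ge_1 in auto)
  have uq: "summable (\<lambda>k. real (block_end (Suc k)) * cube_tail (\<delta> * lil_norm (block_end (Suc k))))"
    using C(2)[OF \<delta>(1)] \<delta>(1) lil_norm_pos[OF block_end_ge_1]
    by (intro summableI_nonneg_bounded) (auto intro!: mult_nonneg_nonneg cube_tail_nonneg)
  define p where "p k = E_path (window_at x \<epsilon> \<delta> k)" for k
  have p: "0 \<le> p k" "p k \<le> 1" for k unfolding p_def by (rule E_path_window_at_range)+
  have ns: "\<not> summable p"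
  proof
    assume "summable p"
    then have "summable (\<lambda>k. p k + real (block_end (Suc k)) * cube_tail (\<delta> * lil_norm (block_end (Suc k))))" using uq by (rule summable_add)
    then have "summable (\<lambda>k. exp (- \<theta> * LL (real (block_end (Suc k)))))"
      by (rule summable_comparison_test_ev[rotated]) (use \<delta>(2) in \<open>simp add: p_def\<close>)
    then show False using exp_LL_fact_not_summable[of \<theta>] \<theta> by simp
  qed
  have "\<exists>K'>K. 1 - \<tau> \<le> E_path (\<lambda>z. 1 - miss x \<epsilon> \<delta> K K' z)" if \<tau>: "0 < \<tau>" for K \<tau>
  proof -
    \<comment> \<open>The first terms in \<open>b\<close> force \<open>K'\<close> beyond
      \<open>K\<close>; \<open>\<bar>ln \<tau>\<bar>\<close> is what the remaining blocks must
      contribute.\<close>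
    define b where "b = (\<Sum>k<Suc K. p k) + \<bar>ln \<tau>\<bar>"
    have "\<exists>m. b < (\<Sum>k<m. p k)"
    proof (rule ccontr)
      assume "\<not> ?thesis"
      then have "summable p" using p by (intro summableI_nonneg_bounded[where x = b]) (auto simp: not_less)
      then show False using ns by simp
    qed
    then obtain K' where K': "b < (\<Sum>k<K'. p k)" by blast
    have "K < K'"
    proof (rule ccontr)
      assume "\<not> K < K'"
      then have "(\<Sum>k<K'. p k) \<le> (\<Sum>k<Suc K. p k)" using p by (intro sum_mono2) auto
      then show False using K' by (simp add: b_def)
    qed
    have "(\<Sum>k<K'. p k) = (\<Sum>k<K. p k) + (\<Sum>k\<in>{K..<K'}. p k)"
      using \<open>K < K'\<close> by (simp add: sum.atLeastLessThan_concat flip: atLeast0LessThan)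
    then have big: "\<bar>ln \<tau>\<bar> \<le> (\<Sum>k\<in>{K..<K'}. p k)" using K' p(1)[of K] by (simp add: b_def)
    have "(\<Prod>k\<in>{K..<K'}. 1 - p k) \<le> (\<Prod>k\<in>{K..<K'}. exp (- p k))"
      using p exp_ge_add_one_self[of "- p _"] by (intro prod_mono) auto
    also have "\<dots> = exp (- (\<Sum>k\<in>{K..<K'}. p k))" by (simp add: exp_sum sum_negf[symmetric])
    also have "\<dots> \<le> exp (ln \<tau>)" using big by simp
    also have "\<dots> = \<tau>" using \<tau> by simp
    finally have "1 - \<tau> \<le> E_path (\<lambda>z. 1 - miss x \<epsilon> \<delta> K K' z)"
      using E_path_hit[of x \<epsilon> \<delta> K "K' - K"] \<open>K < K'\<close> by (simp add: p_def)
    then show ?thesis using \<open>K < K'\<close> by blast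
  qed
  then show ?thesis using that \<delta>(1) by blast
qed

text \<open>Target \<open>g\<close> receives its own group of blocks, long enough to be hit up to
  \<eta> / 2^(g+1). Independence multiplies the group expectations, so every finite product stays
  above 1 - \<eta>, and regularity passes to the infinite product.\<close>

lemma all_targets_hit:
  fixes x \<epsilon> :: "nat \<Rightarrow> real"
  assumes reg: "regular_on_bounded M H E" and \<sigma>: "0 < \<sigma>2" and \<eta>: "0 < \<eta>"
    and tg: "\<And>g. x g \<noteq> 0" "\<And>g. 0 < \<epsilon> g" "\<And>g. \<epsilon> g \<le> 1" "\<And>g. (x g)\<^sup>2 / \<sigma>2 * (1 + 4 * \<epsilon> g)\<^sup>2 < 1"
  obtains d :: "real \<Rightarrow> real \<Rightarrow> real" where "\<And>g. 0 < d (x g) (\<epsilon> g)"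
    "ereal (1 - \<eta>) \<le> cap_star {\<omega>\<in>space M. \<forall>g. \<exists>k\<ge>g. window_at (x g) (\<epsilon> g) (d (x g) (\<epsilon> g)) k (path \<omega>) \<noteq> 0}"
proof -
  define ok where "ok x \<epsilon> \<delta> \<longleftrightarrow> 0 < \<delta> \<and> (\<forall>K \<tau>. 0 < \<tau> \<longrightarrow> (\<exists>K'>K. 1 - \<tau> \<le> E_path (\<lambda>z. 1 - miss x \<epsilon> \<delta> K K' z)))" for x \<epsilon> \<delta>
  have ok_ex: "\<exists>\<delta>. ok (x g) (\<epsilon> g) \<delta>" for g
    by (rule hitting_group[OF tg(1)[of g] tg(2)[of g] tg(3)[of g] \<sigma> tg(4)[of g]]) (auto simp: ok_def)
  \<comment> \<open>Chosen as a function of the target values and not of \<open>g\<close>: when a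
    target recurs in the list, all its occurrences must use the same truncation level.\<close>
  define d where "d x \<epsilon> = (SOME \<delta>. ok x \<epsilon> \<delta>)" for x \<epsilon>
  define \<delta> where "\<delta> g = d (x g) (\<epsilon> g)" for g
  have "ok (x g) (\<epsilon> g) (\<delta> g)" for g unfolding \<delta>_def d_def by (rule someI_ex[OF ok_ex])
  then have \<delta>: "\<And>g. 0 < \<delta> g"
    "\<And>g K \<tau>. 0 < \<tau> \<Longrightarrow> \<exists>K'>K. 1 - \<tau> \<le> E_path (\<lambda>z. 1 - miss (x g) (\<epsilon> g) (\<delta> g) K K' z)"
    unfolding ok_def by blast+
  define \<tau> where "\<tau> g = \<eta> * (1/2) ^ Suc g" for g
  have \<tau>: "0 < \<tau> g" for g using \<eta> by (simp add: \<tau>_def)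
  obtain nxt where nxt: "\<And>g K. K < nxt g K" "\<And>g K. 1 - \<tau> g \<le> E_path (\<lambda>z. 1 - miss (x g) (\<epsilon> g) (\<delta> g) K (nxt g K) z)"
  proof -
    define good where "good g K K' \<longleftrightarrow> K < K' \<and> 1 - \<tau> g \<le> E_path (\<lambda>z. 1 - miss (x g) (\<epsilon> g) (\<delta> g) K K' z)" for g K K'
    have "\<forall>g K. \<exists>K'. good g K K'" using \<delta>(2)[OF \<tau>] unfolding good_def by blast
    then obtain nxt where "\<And>g K. good g K (nxt g K)" by metis
    then show ?thesis using that[of nxt] unfolding good_def by blast
  qed
  define K where "K = rec_nat 0 nxt"
  have KS: "K (Suc g) = nxt g (K g)" for g by (simp add: K_def)
  have Klt: "K g < K (Suc g)" for g unfolding KS by (rule nxt)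
  have Kge: "g \<le> K g" for g
  proof (induction g)
    case (Suc g) then show ?case using Klt[of g] by linarith
  qed simp
  \<comment> \<open>Positive only if some window of the group \<open>g\<close> is nonzero.\<close>
  define h where "h g z = 1 - miss (x g) (\<epsilon> g) (\<delta> g) (K g) (K (Suc g)) z" for g z
  have h01: "0 \<le> h g z" "h g z \<le> 1" for g z unfolding h_def using miss_range[of "x g" "\<epsilon> g" "\<delta> g"] by auto
  define U where "U m z = (\<Prod>g<m. h g z)" for m z
  have U01: "0 \<le> U m z" "U m z \<le> 1" for m z unfolding U_def using h01 by (auto intro!: prod_nonneg prod_le_1)
  have bh: "bdd_lip (vdist (block_end (K (Suc g)))) (h g)" for g unfolding h_def by (intro bdd_lip_intros bdd_lip_miss) simp
  have bU: "bdd_lip (vdist (block_end (K m))) (U m)" for m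
  proof (induction m)
    case 0 show ?case unfolding U_def by (simp add: bdd_lip_const)
  next
    case (Suc m)
    have "bdd_lip (vdist (block_end (K (Suc m)))) (\<lambda>z. U m z * h m z)"
      using Suc bh block_end_mono[OF less_imp_le[OF Klt[of m]]] by (intro bdd_lip_mult) (auto intro: bdd_lip_vdist_mono)
    then show ?case by (simp add: U_def[abs_def])
  qed
  have EU: "1 - (\<Sum>g<m. \<tau> g) \<le> E_path (U m)" for m
  proof (induction m)
    case 0 show ?case by (simp add: U_def[abs_def])
  next
    case (Suc m)
    have EU1: "E_path (U m) \<le> 1" "0 \<le> E_path (U m)"
      using E_path_mono[OF bU bdd_lip_const[of _ 1], of m] E_path_mono[OF bdd_lip_const[of _ 0] bU, of m] U01 by fastforce+
    have "E_path (U (Suc m)) = E_path (\<lambda>z. U m z * h m z)" by (simp add: U_def[abs_def])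
    also have "\<dots> = E_path (U m) * E_path (h m)"
      unfolding h_def using Klt[of m] by (intro E_path_mult_hit bU U01) auto
    finally have "E_path (U (Suc m)) = E_path (U m) * E_path (h m)" .
    moreover have "1 - \<tau> m \<le> E_path (h m)" using nxt(2)[of m "K m"] unfolding h_def[abs_def] KS .
    then have "E_path (U m) * (1 - \<tau> m) \<le> E_path (U m) * E_path (h m)" using EU1 by (intro mult_left_mono)
    moreover have "E_path (U m) * \<tau> m \<le> 1 * \<tau> m" using EU1 \<tau>[of m] by (intro mult_right_mono) auto
    ultimately show ?case using Suc by (simp add: algebra_simps)
  qed
  have "(\<Sum>g<m. \<tau> g) \<le> \<eta>" for m
  proof -
    have "\<eta> * (\<Sum>g<m. (1/2) ^ Suc g) \<le> \<eta> * 1"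
      using \<eta> by (intro mult_left_mono sum_half_powers_le) auto
    then show ?thesis by (simp add: \<tau>_def sum_distrib_left)
  qed
  then have EU': "1 - \<eta> \<le> E_path (U m)" for m using EU[of m] by (smt (verit))
  have "ereal (1 - \<eta>) \<le> cap_star {\<omega>\<in>space M. \<forall>g. \<exists>k\<ge>g. window_at (x g) (\<epsilon> g) (\<delta> g) k (path \<omega>) \<noteq> 0}"
  proof (rule cap_star_ge_of_regular[OF reg, where u = "\<lambda>m \<omega>. U m (path \<omega>)"])
    show "(\<lambda>\<omega>. U m (path \<omega>)) \<in> Hb" for m by (rule bdd_lip_path_Hb[OF bU])
    show "0 \<le> U m (path \<omega>) \<and> U m (path \<omega>) \<le> 1" for m \<omega> using U01 by simp
    show "decseq (\<lambda>m. U m (path \<omega>))" for \<omega>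
    proof (rule decseq_SucI)
      show "U (Suc m) (path \<omega>) \<le> U m (path \<omega>)" for m
        using mult_left_mono[OF h01(2) U01(1), of m "path \<omega>" m "path \<omega>"] by (simp add: U_def)
    qed
    show "1 - \<eta> \<le> expec (\<lambda>\<omega>. U m (path \<omega>))" for m using EU'[of m] by (simp add: E_path_def)
    fix \<omega> assume "\<omega> \<in> space M" "\<omega> \<notin> {\<omega>\<in>space M. \<forall>g. \<exists>k\<ge>g. window_at (x g) (\<epsilon> g) (\<delta> g) k (path \<omega>) \<noteq> 0}"
    then obtain g where g: "\<And>k. g \<le> k \<Longrightarrow> window_at (x g) (\<epsilon> g) (\<delta> g) k (path \<omega>) = 0" by blast
    \<comment> \<open>Since \<open>g \<le> K g\<close>, all blocks of the group lie beyond
      \<open>g\<close>, where every window for this target vanishes.\<close>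
    have "h g (path \<omega>) = 0" unfolding h_def miss_def using g Kge[of g] by simp
    then have "U m (path \<omega>) = 0" if "g < m" for m unfolding U_def using that by (intro prod_zero) auto
    then have "\<forall>\<^sub>F m in sequentially. U m (path \<omega>) = 0"
      by (intro eventually_mono[OF eventually_gt_at_top[of g]])
    then show "(\<lambda>m. U m (path \<omega>)) \<longlonglongrightarrow> 0" by (rule tendsto_eventually)
  qed
  then show ?thesis using that[of d] \<delta>(1) unfolding \<delta>_def by blast
qed

end

subsection \<open>Cluster sets\<close>

text \<open>The target 0 is avoided because \<open>window\<close> measures the error relative to the
  target.\<close>

lemma nonzero_rational_between:
  fixes u v :: real
  assumes "u < v" obtains r where "r \<in> \<rat>" "r \<noteq> 0" "u < r" "r < v"
proof (cases "u < 0")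
  case True
  then obtain r where "r \<in> \<rat>" "u < r" "r < min v 0" using Rats_dense_in_real[of u "min v 0"] assms by auto
  then show ?thesis using that by auto
next
  case False
  then obtain r where "r \<in> \<rat>" "u < r" "r < v" using Rats_dense_in_real[OF assms] by auto
  then show ?thesis using that False by auto
qed

text \<open>Quantifies how negligible the past of a block is: its norm is smaller by the factor
  sqrt(k + 2), which tends to infinity.\<close>

lemma lil_norm_block_end_ratio: "lil_norm (block_end k) * sqrt (real (k + 2)) \<le> lil_norm (block_end (Suc k))"
proof (rule power2_le_imp_le)
  have "LL (real (block_end k)) \<le> LL (real (block_end (Suc k)))" using block_end_mono[of k "Suc k"] by (intro LL_mono) simp
  then have "2 * real (block_end (Suc k)) * LL (real (block_end k)) \<le> 2 * real (block_end (Suc k)) * LL (real (block_end (Suc k)))"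
    by (intro mult_left_mono) auto
  moreover have "2 * real (block_end (Suc k)) * LL (real (block_end k)) = 2 * real (block_end k) * LL (real (block_end k)) * real (k + 2)"
    unfolding block_end_Suc of_nat_mult by simp
  ultimately show "(lil_norm (block_end k) * sqrt (real (k + 2)))\<^sup>2 \<le> (lil_norm (block_end (Suc k)))\<^sup>2"
    unfolding power_mult_distrib lil_norm_sq by simp
qed (rule lil_norm_nonneg)

lemma cluster_set_perturb:
  assumes lim: "(\<lambda>n. t n - B * s n) \<longlonglongrightarrow> 0" and r: "r \<in> cluster_set s"
  shows "B * r \<in> cluster_set t"
  unfolding cluster_set_iff
proof (intro allI impI)
  fix e :: real and m assume e: "0 < e"
  define e' where "e' = e / (2 * (\<bar>B\<bar> + 1))"
  have e': "0 < e'" using e by (simp add: e'_def)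
  have Be: "\<bar>B\<bar> * e' \<le> e / 2" using e by (simp add: e'_def field_simps)
  have "\<forall>\<^sub>F n in sequentially. dist (t n - B * s n) 0 < e / 2" using lim e by (intro tendstoD) auto
  then obtain n0 where n0: "\<And>n. n0 \<le> n \<Longrightarrow> \<bar>t n - B * s n\<bar> < e / 2"
    by (auto simp: eventually_sequentially dist_real_def)
  obtain n where n: "max m n0 \<le> n" "\<bar>s n - r\<bar> < e'" using r e' unfolding cluster_set_iff by blast
  have "\<bar>t n - B * r\<bar> \<le> \<bar>t n - B * s n\<bar> + \<bar>B * (s n - r)\<bar>" by (simp add: algebra_simps)
  also have "\<bar>B * (s n - r)\<bar> \<le> \<bar>B\<bar> * e'" using n by (simp add: abs_mult mult_left_mono)
  also have "\<bar>t n - B * s n\<bar> < e / 2" using n0 n by simp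
  finally show "\<exists>n\<ge>m. \<bar>t n - B * r\<bar> < e" using n Be by (intro exI[of _ n]) auto
qed

context lil_sequence
begin

text \<open>Evaluated at the block ends. The window gives the block sum up to 2 \<epsilon> |r| \<le>
  e/2; the sum before the block is at most (sqrt \<sigma>2 + 1) / sqrt(k + 2) times the norm,
  eventually below e/2.\<close>

lemma hit_gives_cluster_point:
  assumes r: "r \<noteq> 0" and negl: "(\<lambda>n. path \<omega> n / lil_norm n) \<longlonglongrightarrow> 0"
    and up: "\<forall>\<^sub>F n in sequentially. \<bar>\<Sum>i<n. path \<omega> i\<bar> \<le> (sqrt \<sigma>2 + 1) * lil_norm n"
    and hit: "\<And>e. 0 < e \<Longrightarrow> \<exists>\<epsilon>>0. \<exists>\<delta>>0. \<epsilon> \<le> e \<and> (\<forall>K. \<exists>k\<ge>K. window_at r \<epsilon> \<delta> k (path \<omega>) \<noteq> 0)"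
  shows "r \<in> cluster_set (\<lambda>n. (\<Sum>i<n. path \<omega> i) / lil_norm n)"
  unfolding cluster_set_iff
proof (intro allI impI)
  fix e :: real and m assume e: "0 < e"
  have "0 < e / (4 * \<bar>r\<bar>)" using e r by simp
  then obtain \<epsilon> \<delta> where \<epsilon>: "0 < \<epsilon>" "0 < \<delta>" "\<epsilon> \<le> e / (4 * \<bar>r\<bar>)" "\<And>K. \<exists>k\<ge>K. window_at r \<epsilon> \<delta> k (path \<omega>) \<noteq> 0"
    using hit by blast
  have \<epsilon>r: "2 * \<epsilon> * \<bar>r\<bar> \<le> e / 2" using \<epsilon>(3) r by (simp add: field_simps)
  have "\<forall>\<^sub>F n in sequentially. dist (path \<omega> n / lil_norm n) 0 < \<delta>" using negl \<epsilon>(2) by (rule tendstoD)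
  then obtain i0 where i0: "\<And>n. i0 \<le> n \<Longrightarrow> \<bar>path \<omega> n / lil_norm n\<bar> < \<delta>"
    by (auto simp: eventually_sequentially)
  obtain i1 where i1: "\<And>n. i1 \<le> n \<Longrightarrow> \<bar>\<Sum>i<n. path \<omega> i\<bar> \<le> (sqrt \<sigma>2 + 1) * lil_norm n"
    using up by (auto simp: eventually_sequentially)
  have "(\<lambda>k. (sqrt \<sigma>2 + 1) / sqrt (real (k + 2))) \<longlonglongrightarrow> 0"
    by (intro real_tendsto_divide_at_top[OF tendsto_const] filterlim_compose[OF sqrt_at_top]
        filterlim_compose[OF filterlim_real_sequentially] filterlim_add_const_nat_at_top)
  then have "\<forall>\<^sub>F k in sequentially. dist ((sqrt \<sigma>2 + 1) / sqrt (real (k + 2))) 0 < e / 2" using e by (intro tendstoD) auto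
  then obtain k0 where "\<And>k. k0 \<le> k \<Longrightarrow> dist ((sqrt \<sigma>2 + 1) / sqrt (real (k + 2))) 0 < e / 2"
    unfolding eventually_sequentially by blast
  then have k0: "\<And>k. k0 \<le> k \<Longrightarrow> (sqrt \<sigma>2 + 1) / sqrt (real (k + 2)) < e / 2"
    unfolding dist_real_def by (metis abs_ge_self diff_zero order_le_less_trans)
  obtain k where k: "max (max i0 i1) (max k0 m) \<le> k" "window_at r \<epsilon> \<delta> k (path \<omega>) \<noteq> 0" using \<epsilon>(4) by blast
  define n where "n = block_end (Suc k)"
  define a where "a = lil_norm n"
  define N where "N = n - block_end k"
  have nk: "k < block_end k" by (rule block_end_ge)
  have nn: "n = block_end k + N" using block_end_mono[of k "Suc k"] by (simp add: N_def n_def)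
  have a: "0 < a" unfolding a_def n_def by (rule lil_norm_pos[OF block_end_ge_1])
  \<comment> \<open>Late summands are below \<delta> times their norm, so the truncation inside the
    window is inactive and the window speaks of the true block sum.\<close>
  have clip: "clip (\<delta> * a) (path \<omega> (block_end k + i)) = path \<omega> (block_end k + i)" if "i < N" for i
  proof (rule clip_eq)
    let ?i = "block_end k + i"
    have "0 < lil_norm ?i" using block_end_ge_1[of k] by (intro lil_norm_pos) simp
    moreover have "\<bar>path \<omega> ?i / lil_norm ?i\<bar> < \<delta>" using k(1) nk by (intro i0) simp
    ultimately have "\<bar>path \<omega> ?i\<bar> < \<delta> * lil_norm ?i" by (simp add: abs_divide pos_divide_less_eq)
    also have "\<dots> \<le> \<delta> * a" unfolding a_def using \<epsilon>(2) that nn by (intro mult_left_mono lil_norm_mono) auto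
    finally show "\<bar>path \<omega> ?i\<bar> \<le> \<delta> * a" by simp
  qed
  then have ts: "clipped_sum (\<delta> * a) (block_end k) N (path \<omega>) = (\<Sum>i<N. path \<omega> (block_end k + i))" by (simp add: clipped_sum_def)
  have S: "(\<Sum>i<n. path \<omega> i) = (\<Sum>i<block_end k. path \<omega> i) + (\<Sum>i<N. path \<omega> (block_end k + i))"
    unfolding nn by (induction N) (auto simp: add.assoc)
  have "\<bar>clipped_sum (\<delta> * a) (block_end k) N (path \<omega>) / (r * a) - 1\<bar> < 2 * \<epsilon>"
    using k(2) unfolding window_at_def n_def[symmetric] N_def[symmetric] a_def[symmetric] by (rule window_nonzeroD[OF \<epsilon>(1)])
  then have "\<bar>r\<bar> * \<bar>(\<Sum>i<N. path \<omega> (block_end k + i)) / (r * a) - 1\<bar> < \<bar>r\<bar> * (2 * \<epsilon>)"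
    unfolding ts using r by (intro mult_strict_left_mono) auto
  moreover have "\<bar>r\<bar> * \<bar>(\<Sum>i<N. path \<omega> (block_end k + i)) / (r * a) - 1\<bar> = \<bar>(\<Sum>i<N. path \<omega> (block_end k + i)) / a - r\<bar>"
    unfolding abs_mult[symmetric] using r by (simp add: right_diff_distrib)
  ultimately have b1: "\<bar>(\<Sum>i<N. path \<omega> (block_end k + i)) / a - r\<bar> < e / 2" using \<epsilon>r by (simp add: mult_ac)
  have b2: "\<bar>(\<Sum>i<block_end k. path \<omega> i) / a\<bar> < e / 2"
  proof -
    have s0: "0 < sqrt (real (k + 2))" by simp
    have "\<bar>\<Sum>i<block_end k. path \<omega> i\<bar> \<le> (sqrt \<sigma>2 + 1) * lil_norm (block_end k)" using k(1) nk by (intro i1) simp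
    also have "lil_norm (block_end k) \<le> a / sqrt (real (k + 2))"
      using lil_norm_block_end_ratio[of k] s0 unfolding a_def n_def by (simp only: pos_le_divide_eq)
    then have "(sqrt \<sigma>2 + 1) * lil_norm (block_end k) \<le> (sqrt \<sigma>2 + 1) * (a / sqrt (real (k + 2)))"
      using \<sigma>2_nonneg by (intro mult_left_mono) auto
    also have "\<dots> = (sqrt \<sigma>2 + 1) / sqrt (real (k + 2)) * a" by simp
    also have "\<dots> < e / 2 * a" using k0[of k] k(1) a by (intro mult_strict_right_mono) auto
    finally show ?thesis using a by (simp add: abs_divide pos_divide_less_eq)
  qed
  have "\<bar>(\<Sum>i<n. path \<omega> i) / a - r\<bar> < e" using b1 b2 unfolding S add_divide_distrib by linarith
  moreover have "m \<le> n" using k(1) nk nn by simp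
  ultimately show "\<exists>n\<ge>m. \<bar>(\<Sum>i<n. path \<omega> i) / lil_norm n - r\<bar> < e" unfolding a_def by blast
qed

section \<open>The limit set of the linear process outside a null set\<close>

context
  fixes \<beta> :: "int \<Rightarrow> real" and N :: "'a set" and B :: real and T :: "nat \<Rightarrow> 'a \<Rightarrow> real"
  defines "B \<equiv> \<Sum>\<^sub>\<infinity>j. \<beta> j" and "T \<equiv> \<lambda>n \<omega>. process_sum \<beta> Y n \<omega> / lil_norm n"
  assumes N: "cap_star N = 0"
    and negl: "\<And>\<omega>. \<omega> \<in> space M \<Longrightarrow> \<omega> \<notin> N \<Longrightarrow> (\<lambda>n. path \<omega> n / lil_norm n) \<longlonglongrightarrow> 0"
    and up: "\<And>\<omega> e. \<omega> \<in> space M \<Longrightarrow> \<omega> \<notin> N \<Longrightarrow> 0 < e \<Longrightarrow>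
      \<forall>\<^sub>F n in sequentially. \<bar>\<Sum>i<n. path \<omega> i\<bar> \<le> (sqrt \<sigma>2 + e) * lil_norm n"
    and red: "\<And>\<omega>. \<omega> \<in> space M \<Longrightarrow> \<omega> \<notin> N \<Longrightarrow>
      (\<lambda>n. T n \<omega> - B * ((\<Sum>i<n. path \<omega> i) / lil_norm n)) \<longlonglongrightarrow> 0"
begin

lemma T_eventually_le:
  assumes \<omega>: "\<omega> \<in> space M" "\<omega> \<notin> N" and e: "0 < e"
  shows "\<forall>\<^sub>F n in sequentially. \<bar>T n \<omega>\<bar> \<le> \<bar>B\<bar> * sqrt \<sigma>2 + e"
proof -
  define e' where "e' = e / (\<bar>B\<bar> + 1)"
  have B1: "0 < \<bar>B\<bar> + 1" using abs_ge_zero[of B] by linarith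
  then have "(\<bar>B\<bar> + 1) * e' = e" by (simp add: e'_def)
  then have e'2: "\<bar>B\<bar> * e' + e' = e" by (simp only: distrib_right mult_1)
  have e'1: "0 < e'" unfolding e'_def by (rule divide_pos_pos[OF e B1])
  note e' = e'1 e'2
  have "\<forall>\<^sub>F n in sequentially. dist (T n \<omega> - B * ((\<Sum>i<n. path \<omega> i) / lil_norm n)) 0 < e'"
    using red[OF \<omega>] e'(1) by (rule tendstoD)
  then show ?thesis using up[OF \<omega> e'(1)] eventually_ge_at_top[of 1]
  proof eventually_elim
    case (elim n)
    have "0 < lil_norm n" by (rule lil_norm_pos[OF elim(3)])
    then have "\<bar>(\<Sum>i<n. path \<omega> i) / lil_norm n\<bar> \<le> sqrt \<sigma>2 + e'" using elim(2) by (simp add: abs_divide pos_divide_le_eq)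
    then have "\<bar>B * ((\<Sum>i<n. path \<omega> i) / lil_norm n)\<bar> \<le> \<bar>B\<bar> * (sqrt \<sigma>2 + e')"
      unfolding abs_mult by (intro mult_left_mono) auto
    then have "\<bar>T n \<omega>\<bar> \<le> e' + \<bar>B\<bar> * (sqrt \<sigma>2 + e')" using elim(1) unfolding dist_real_def by linarith
    also have "\<dots> = \<bar>B\<bar> * sqrt \<sigma>2 + e" using e'(2) by (simp add: distrib_left)
    finally show ?case .
  qed
qed

lemma limsup_T_le:
  assumes \<omega>: "\<omega> \<in> space M" "\<omega> \<notin> N"
  shows "limsup (\<lambda>n. ereal \<bar>T n \<omega>\<bar>) \<le> ereal (\<bar>B\<bar> * sqrt \<sigma>2)"
proof (rule ereal_le_epsilon2)
  fix e :: real assume "0 < e"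
  then have "\<forall>\<^sub>F n in sequentially. ereal \<bar>T n \<omega>\<bar> \<le> ereal (\<bar>B\<bar> * sqrt \<sigma>2) + ereal e"
    using T_eventually_le[OF \<omega>] by simp
  then show "limsup (\<lambda>n. ereal \<bar>T n \<omega>\<bar>) \<le> ereal (\<bar>B\<bar> * sqrt \<sigma>2) + ereal e" by (rule Limsup_bounded)
qed

lemma cluster_T_subset:
  assumes \<omega>: "\<omega> \<in> space M" "\<omega> \<notin> N"
  shows "cluster_set (\<lambda>n. T n \<omega>) \<subseteq> {- (\<bar>B\<bar> * sqrt \<sigma>2) .. \<bar>B\<bar> * sqrt \<sigma>2}"
proof
  fix c assume c: "c \<in> cluster_set (\<lambda>n. T n \<omega>)"
  have "\<bar>c\<bar> \<le> \<bar>B\<bar> * sqrt \<sigma>2"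
  proof (rule field_le_epsilon)
    fix e :: real assume e: "0 < e"
    then obtain n0 where n0: "\<And>n. n0 \<le> n \<Longrightarrow> \<bar>T n \<omega>\<bar> \<le> \<bar>B\<bar> * sqrt \<sigma>2 + e / 2"
      using T_eventually_le[OF \<omega>, of "e / 2"] by (auto simp: eventually_sequentially)
    obtain n where "n0 \<le> n" "\<bar>T n \<omega> - c\<bar> < e / 2" using c e unfolding cluster_set_iff by (meson half_gt_zero)
    then show "\<bar>c\<bar> \<le> \<bar>B\<bar> * sqrt \<sigma>2 + e" using n0[of n] by linarith
  qed
  then show "c \<in> {- (\<bar>B\<bar> * sqrt \<sigma>2) .. \<bar>B\<bar> * sqrt \<sigma>2}" by (simp add: abs_le_iff)
qed

text \<open>Covers \<beta> = 0 and \<open>\<sigma>2 = 0\<close>, where the interval is a point and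
  the upper bound alone forces convergence to 0. The hitting argument divides by \<sigma>2 and
  starts from positive variance.\<close>

lemma degenerate_cluster:
  assumes \<omega>: "\<omega> \<in> space M" "\<omega> \<notin> N" and z: "\<bar>B\<bar> * sqrt \<sigma>2 = 0"
  shows "cluster_set (\<lambda>n. T n \<omega>) = {- (\<bar>B\<bar> * sqrt \<sigma>2) .. \<bar>B\<bar> * sqrt \<sigma>2}"
proof -
  have "0 \<in> cluster_set (\<lambda>n. T n \<omega>)"
    unfolding cluster_set_iff
  proof (intro allI impI)
    fix e :: real and m assume "0 < e"
    then have "\<forall>\<^sub>F n in sequentially. \<bar>T n \<omega>\<bar> \<le> e / 2" using T_eventually_le[OF \<omega>, of "e / 2"] z by simp
    then obtain n0 where "\<And>n. n0 \<le> n \<Longrightarrow> \<bar>T n \<omega>\<bar> \<le> e / 2" by (auto simp: eventually_sequentially)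
    then have "\<bar>T (max m n0) \<omega>\<bar> \<le> e / 2" by simp
    then show "\<exists>n\<ge>m. \<bar>T n \<omega> - 0\<bar> < e" using \<open>0 < e\<close> by (intro exI[of _ "max m n0"]) auto
  qed
  then show ?thesis using cluster_T_subset[OF \<omega>] unfolding z by auto
qed

text \<open>Nonzero rationals are dense in the open interval for the partial sums, multiplication by
  \<open>B\<close> carries them to the linear process, and cluster sets are closed, which adds the
  end points.\<close>

lemma full_cluster:
  assumes \<omega>: "\<omega> \<in> space M" "\<omega> \<notin> N" and B: "B \<noteq> 0"
    and pts: "\<And>r. r \<in> \<rat> \<Longrightarrow> r \<noteq> 0 \<Longrightarrow> \<bar>r\<bar> < sqrt \<sigma>2 \<Longrightarrow> r \<in> cluster_set (\<lambda>n. (\<Sum>i<n. path \<omega> i) / lil_norm n)"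
    and \<sigma>: "0 < \<sigma>2"
  shows "cluster_set (\<lambda>n. T n \<omega>) = {- (\<bar>B\<bar> * sqrt \<sigma>2) .. \<bar>B\<bar> * sqrt \<sigma>2}"
proof (rule antisym[OF cluster_T_subset[OF \<omega>]], rule subsetI)
  fix c assume "c \<in> {- (\<bar>B\<bar> * sqrt \<sigma>2) .. \<bar>B\<bar> * sqrt \<sigma>2}"
  then have "\<bar>c\<bar> \<le> \<bar>B\<bar> * sqrt \<sigma>2" by (simp add: abs_le_iff)
  then have "\<bar>c / B\<bar> \<le> sqrt \<sigma>2" using B by (simp add: abs_divide pos_divide_le_eq mult.commute)
  from abs_le_D1[OF this] abs_le_D2[OF this] have w: "- sqrt \<sigma>2 \<le> c / B" "c / B \<le> sqrt \<sigma>2" by linarith+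
  show "c \<in> cluster_set (\<lambda>n. T n \<omega>)"
    unfolding cluster_set_iff
  proof (intro allI impI)
    fix e :: real and m assume e: "0 < e"
    define \<eta> where "\<eta> = e / (2 * \<bar>B\<bar>)"
    have \<eta>: "0 < \<eta>" using e B by (simp add: \<eta>_def)
    have "max (- sqrt \<sigma>2) (c / B - \<eta>) < min (sqrt \<sigma>2) (c / B + \<eta>)" using w \<eta> \<sigma> by auto
    then obtain r where r: "r \<in> \<rat>" "r \<noteq> 0" "max (- sqrt \<sigma>2) (c / B - \<eta>) < r" "r < min (sqrt \<sigma>2) (c / B + \<eta>)"
      by (rule nonzero_rational_between)
    have "\<bar>r\<bar> < sqrt \<sigma>2" "\<bar>r - c / B\<bar> < \<eta>" using r(3,4) by (auto simp: abs_less_iff)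
    then have "\<bar>B\<bar> * \<bar>r - c / B\<bar> < \<bar>B\<bar> * \<eta>" using B by (intro mult_strict_left_mono) auto
    then have Br: "\<bar>B * r - c\<bar> < e / 2" using B unfolding abs_mult[symmetric] by (simp add: \<eta>_def right_diff_distrib)
    have "B * r \<in> cluster_set (\<lambda>n. T n \<omega>)"
      by (rule cluster_set_perturb[OF red[OF \<omega>] pts[OF r(1,2) \<open>\<bar>r\<bar> < sqrt \<sigma>2\<close>]])
    then obtain n where n: "m \<le> n" "\<bar>T n \<omega> - B * r\<bar> < e / 2"
      using e unfolding cluster_set_iff by (meson half_gt_zero)
    have "\<bar>T n \<omega> - c\<bar> = \<bar>(T n \<omega> - B * r) + (B * r - c)\<bar>" by simp
    also have "\<dots> \<le> \<bar>T n \<omega> - B * r\<bar> + \<bar>B * r - c\<bar>" by (rule abs_triangle_ineq)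
    also have "\<dots> < e / 2 + e / 2" by (rule add_strict_mono[OF n(2) Br])
    finally show "\<exists>n\<ge>m. \<bar>T n \<omega> - c\<bar> < e" using n(1) by (intro exI[of _ n]) simp
  qed
qed

lemma lower_cap_limsup:
  "lower_cap_star M H E {\<omega>\<in>space M. limsup (\<lambda>n. ereal \<bar>T n \<omega>\<bar>) \<le> ereal (\<bar>B\<bar> * sqrt \<sigma>2)} = 1"
proof -
  have "space M - {\<omega>\<in>space M. limsup (\<lambda>n. ereal \<bar>T n \<omega>\<bar>) \<le> ereal (\<bar>B\<bar> * sqrt \<sigma>2)} \<subseteq> N"
    using limsup_T_le by blast
  then show ?thesis unfolding lower_cap_star_def using cap_star_null_mono[OF N] by simp
qed

text \<open>Countably many targets, each with countably many accuracies, describe the whole cluster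
  set; listing them in one sequence reduces the claim to \<open>all_targets_hit\<close>, up to the
  null set \<open>N\<close>.\<close>

lemma upper_cap_cluster_ge:
  assumes reg: "regular_on_bounded M H E" and \<eta>: "0 < \<eta>"
  shows "ereal (1 - \<eta>) \<le> cap_star {\<omega>\<in>space M. cluster_set (\<lambda>n. T n \<omega>) = {- (\<bar>B\<bar> * sqrt \<sigma>2) .. \<bar>B\<bar> * sqrt \<sigma>2}}"
    (is "_ \<le> cap_star ?A")
proof -
  have fin: "ereal (1 - \<eta>) \<le> cap_star ?A" if "ereal (1 - \<eta>) \<le> cap_star A'" "A' \<subseteq> ?A \<union> N" for A'
    using that cap_star_mono[OF that(2)] cap_star_null_Un[OF N, of ?A] by (metis order_trans)
  show ?thesis
  proof (cases "\<bar>B\<bar> * sqrt \<sigma>2 = 0")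
    case True
    have "ereal 1 \<le> cap_star (space M)"
      by (rule cap_star_ge_of_regular[OF reg, where u = "\<lambda>_ _. 1"]) (auto intro: Hb_const simp: decseq_def)
    then have "ereal (1 - \<eta>) \<le> cap_star (space M)" using \<eta> by (meson ereal_less_eq(3) diff_le_eq less_imp_le order_trans le_add_same_cancel1)
    then show ?thesis by (rule fin) (use degenerate_cluster True in blast)
  next
    case False
    then have B: "B \<noteq> 0" and \<sigma>: "0 < \<sigma>2" using \<sigma>2_nonneg by (auto simp: less_le)
    \<comment> \<open>Pairs of a rational target and an accuracy 1 / (m + 1) that satisfy the strict
      condition of the hitting argument. A rational inside the open interval satisfies it for all
      large m.\<close>
    define P where "P = {p \<in> \<rat> \<times> (UNIV :: nat set). fst p \<noteq> 0 \<and> (fst p)\<^sup>2 / \<sigma>2 * (1 + 4 * (1 / real (Suc (snd p))))\<^sup>2 < 1}"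
    have Pc: "countable P" unfolding P_def by (intro countable_subset[OF _ countable_SIGMA[OF countable_rat]]) auto
    have Pin: "\<exists>m0. \<forall>m\<ge>m0. (r, m) \<in> P" if r: "r \<in> \<rat>" "r \<noteq> 0" "\<bar>r\<bar> < sqrt \<sigma>2" for r
    proof -
      have "(\<lambda>m. r\<^sup>2 / \<sigma>2 * (1 + 4 * (1 / real (Suc m)))\<^sup>2) \<longlonglongrightarrow> r\<^sup>2 / \<sigma>2 * (1 + 4 * 0)\<^sup>2"
        using LIMSEQ_inverse_real_of_nat by (intro tendsto_intros) (simp add: divide_inverse)
      moreover have "\<bar>r\<bar>\<^sup>2 < (sqrt \<sigma>2)\<^sup>2" using r(3) by (intro power_strict_mono) auto
      then have "r\<^sup>2 / \<sigma>2 * (1 + 4 * 0)\<^sup>2 < 1" using \<sigma> by simp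
      ultimately have "\<forall>\<^sub>F m in sequentially. r\<^sup>2 / \<sigma>2 * (1 + 4 * (1 / real (Suc m)))\<^sup>2 < 1" by (rule order_tendstoD(2))
      then show ?thesis using r(1,2) by (auto simp: P_def eventually_sequentially)
    qed
    have Pne: "P \<noteq> {}"
    proof -
      obtain r where r: "r \<in> \<rat>" "r \<noteq> 0" "0 < r" "r < sqrt \<sigma>2" using nonzero_rational_between[of 0 "sqrt \<sigma>2"] \<sigma> by auto
      then show ?thesis using Pin[of r] by auto
    qed
    \<comment> \<open>The second component of the pair is discarded, so every target recurs
      infinitely often: the indices \<open>prod_encode (i, K)\<close> all carry target
      \<open>i\<close> and are at least \<open>K\<close>, which yields hits in arbitrarily late
      blocks.\<close>
    define tg where "tg g = from_nat_into P (fst (prod_decode g))" for g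
    define x where "x g = fst (tg g)" for g
    define \<epsilon> where "\<epsilon> g = 1 / real (Suc (snd (tg g)))" for g
    have tgP: "tg g \<in> P" for g unfolding tg_def by (rule from_nat_into[OF Pne])
    obtain d where d: "\<And>g. 0 < d (x g) (\<epsilon> g)"
      "ereal (1 - \<eta>) \<le> cap_star {\<omega>\<in>space M. \<forall>g. \<exists>k\<ge>g. window_at (x g) (\<epsilon> g) (d (x g) (\<epsilon> g)) k (path \<omega>) \<noteq> 0}"
    proof (rule all_targets_hit[OF reg \<sigma> \<eta>, of x \<epsilon>])
      show "x g \<noteq> 0" "(x g)\<^sup>2 / \<sigma>2 * (1 + 4 * \<epsilon> g)\<^sup>2 < 1" for g
        using tgP[of g] by (auto simp: P_def x_def \<epsilon>_def)
      show "0 < \<epsilon> g" "\<epsilon> g \<le> 1" for g by (auto simp: \<epsilon>_def)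
    qed blast
    show ?thesis
    proof (rule fin[OF d(2)], rule subsetI)
      fix \<omega> assume "\<omega> \<in> {\<omega>\<in>space M. \<forall>g. \<exists>k\<ge>g. window_at (x g) (\<epsilon> g) (d (x g) (\<epsilon> g)) k (path \<omega>) \<noteq> 0}"
      then have \<omega>: "\<omega> \<in> space M" and hit: "\<And>g. \<exists>k\<ge>g. window_at (x g) (\<epsilon> g) (d (x g) (\<epsilon> g)) k (path \<omega>) \<noteq> 0" by auto
      have "\<omega> \<in> ?A" if nN: "\<omega> \<notin> N"
      proof -
        have "r \<in> cluster_set (\<lambda>n. (\<Sum>i<n. path \<omega> i) / lil_norm n)" if r: "r \<in> \<rat>" "r \<noteq> 0" "\<bar>r\<bar> < sqrt \<sigma>2" for r
        proof (rule hit_gives_cluster_point[OF r(2) negl[OF \<omega> nN] up[OF \<omega> nN zero_less_one]])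
          fix e :: real assume e: "0 < e"
          obtain m0 where m0: "\<And>m. m0 \<le> m \<Longrightarrow> (r, m) \<in> P" using Pin[OF r] by blast
          obtain m1 where m1: "1 / real (Suc m1) < e" using nat_approx_posE[OF e] by blast
          define m where "m = max m0 m1"
          have "1 / real (Suc m) \<le> 1 / real (Suc m1)" by (simp add: m_def frac_le)
          then have me: "1 / real (Suc m) \<le> e" using m1 by linarith
          obtain i where i: "from_nat_into P i = (r, m)" using from_nat_into_surj[OF Pc m0[of m]] by (auto simp: m_def)
          have tgi: "x (prod_encode (i, K)) = r" "\<epsilon> (prod_encode (i, K)) = 1 / real (Suc m)" for K
            by (simp_all add: x_def \<epsilon>_def tg_def i)
          have "0 < d r (1 / real (Suc m))" using d(1)[of "prod_encode (i, 0)"] unfolding tgi .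
          moreover have "\<exists>k\<ge>K. window_at r (1 / real (Suc m)) (d r (1 / real (Suc m))) k (path \<omega>) \<noteq> 0" for K
            using hit[of "prod_encode (i, K)"] le_prod_encode_2[of K i] unfolding tgi by (meson order_trans)
          ultimately show "\<exists>\<epsilon>>0. \<exists>\<delta>>0. \<epsilon> \<le> e \<and> (\<forall>K. \<exists>k\<ge>K. window_at r \<epsilon> \<delta> k (path \<omega>) \<noteq> 0)"
            using me by (intro exI[of _ "1 / real (Suc m)"] conjI exI[of _ "d r (1 / real (Suc m))"]) auto
        qed
        then show ?thesis using full_cluster[OF \<omega> nN B _ \<sigma>] \<omega> by simp
      qed
      then show "\<omega> \<in> ?A \<union> N" by blast
    qed
  qed
qed

lemma upper_cap_cluster:
  assumes reg: "regular_on_bounded M H E"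
  shows "cap_star {\<omega>\<in>space M. cluster_set (\<lambda>n. T n \<omega>) = {- (\<bar>B\<bar> * sqrt \<sigma>2) .. \<bar>B\<bar> * sqrt \<sigma>2}} = 1"
    (is "cap_star ?A = 1")
proof (rule antisym)
  show "cap_star ?A \<le> 1" by (rule cap_star_space_le) auto
  show "1 \<le> cap_star ?A"
  proof (rule ereal_le_epsilon2)
    fix e :: real assume "0 < e"
    then have "ereal (1 - e) + ereal e \<le> cap_star ?A + ereal e"
      by (intro add_right_mono upper_cap_cluster_ge[OF reg])
    then show "1 \<le> cap_star ?A + ereal e" by (simp add: one_ereal_def)
  qed
qed

end

end

theorem theorem3p1:
  fixes M :: "'a measure"
    and H :: "('a \<Rightarrow> real) set"
    and E :: "('a \<Rightarrow> real) \<Rightarrow> ereal"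
    and Y :: "nat \<Rightarrow> 'a \<Rightarrow> real"
    and \<beta> :: "int \<Rightarrow> real"
    and \<sigma>2 :: real
  assumes "sublinear_expectation_space M H E"
    and "\<And>i. i \<ge> 1 \<Longrightarrow> Y i \<in> H"
    and "indep_seq E Y"
    and "ident_distr_seq E Y"
    and "(\<lambda>j. \<bar>\<beta> j\<bar>) summable_on UNIV"
    and "has_trunc_expectation E (Y 1) 0"
    and "has_trunc_expectation E (\<lambda>\<omega>. - Y 1 \<omega>) 0"
    and "has_trunc_expectation E (\<lambda>\<omega>. (Y 1 \<omega>)\<^sup>2) (ereal \<sigma>2)"
    and "choquet M H E (\<lambda>\<omega>. (Y 1 \<omega>)\<^sup>2 / llog (llog \<bar>Y 1 \<omega>\<bar>)) < \<infinity>"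
  shows "lower_cap_star M H E
           {\<omega>\<in>space M. limsup (\<lambda>n. ereal (\<bar>process_sum \<beta> Y n \<omega>\<bar> / lil_norm n))
                          \<le> ereal (\<bar>\<Sum>\<^sub>\<infinity>j. \<beta> j\<bar> * sqrt \<sigma>2)} = 1
       \<and> (regular_on_bounded M H E \<longrightarrow>
           upper_cap_star M H E
             {\<omega>\<in>space M. cluster_set (\<lambda>n. process_sum \<beta> Y n \<omega> / lil_norm n)
                = {- (\<bar>\<Sum>\<^sub>\<infinity>j. \<beta> j\<bar> * sqrt \<sigma>2) .. \<bar>\<Sum>\<^sub>\<infinity>j. \<beta> j\<bar> * sqrt \<sigma>2}} = 1)"
proof -
  interpret lil_sequence M H E Y \<sigma>2
    using assms
    by (intro lil_sequence.intro iid_sequence.intro iid_sequence_axioms.intro lil_sequence_axioms.intro)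
  obtain N where N: "upper_cap_star M H E N = 0"
    "\<And>\<omega>. \<omega> \<in> space M \<Longrightarrow> \<omega> \<notin> N \<Longrightarrow> (\<lambda>n. path \<omega> n / lil_norm n) \<longlonglongrightarrow> 0"
    "\<And>\<omega> e. \<omega> \<in> space M \<Longrightarrow> \<omega> \<notin> N \<Longrightarrow> 0 < e \<Longrightarrow>
      \<forall>\<^sub>F n in sequentially. \<bar>\<Sum>i<n. path \<omega> i\<bar> \<le> (sqrt \<sigma>2 + e) * lil_norm n"
    "\<And>\<omega>. \<omega> \<in> space M \<Longrightarrow> \<omega> \<notin> N \<Longrightarrow>
      (\<lambda>n. process_sum \<beta> Y n \<omega> / lil_norm n - (\<Sum>\<^sub>\<infinity>j. \<beta> j) * ((\<Sum>i<n. path \<omega> i) / lil_norm n)) \<longlonglongrightarrow> 0"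
    using almost_sure_reduction[OF assms(5)] by blast
  have abs: "\<bar>process_sum \<beta> Y n \<omega>\<bar> / lil_norm n = \<bar>process_sum \<beta> Y n \<omega> / lil_norm n\<bar>" for n \<omega>
    using lil_norm_nonneg[of n] by (simp add: abs_divide)
  show ?thesis
    unfolding abs using lower_cap_limsup[OF N] upper_cap_cluster[OF N] by blast
qed

end
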